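(* Let $i\in I$. 1) There exists a unique algebra automorphism $\tau_i^-$ of $U_q'(\mathfrak k)$ such that for all $j\in I$ $$\tau_i^-(B_j)=\begin{cases} B_j & \text{if } j=i \text{ or } a_{ij}=0,\\ B_iB_j-q_iB_jB_i & \text{if } a_{ij}=-1,\\ [2]^{-1}\big(B_i^2B_j-q[2]B_iB_jB_i+q^2B_jB_i^2\big)+B_j & \text{if } a_{ij}=-2,\\ [3]^{-1}[2]^{-1}\big(B_i^3B_j-q[3]B_i^2B_jB_i+q^2[3]B_iB_jB_i^2-q^3B_jB_i^3+q^{-1}(B_iB_j-q^3B_jB_i)\big)+(B_iB_j-qB_jB_i) & \text{if } a_{ij}=-3.\end{cases}$$ 2) The inverse automorphism $\tau_i$ of $\tau_i^-$ is determined by $$\tau_i(B_j)=\begin{cases} B_j & \text{if } j=i \text{ or } a_{ij}=0,\\ B_jB_i-q_iB_iB_j & \text{if } a_{ij}=-1,\\ [2]^{-1}\big(B_jB_i^2-q[2]B_iB_jB_i+q^2B_i^2B_j\big)+B_j & \text{if } a_{ij}=-2,\\ [3]^{-1}[2]^{-1}\big(B_jB_i^3-q[3]B_iB_jB_i^2+q^2[3]B_i^2B_jB_i-q^3B_i^3B_j+q^{-1}(B_jB_i-q^3B_iB_j)\big)+(B_jB_i-qB_iB_j) & \text{if } a_{ij}=-3.\end{cases}$$ 3) There exists a unique group homomorphism $Br(\mathfrak g)\to\mathrm{Aut}_{alg}(U_q'(\mathfrak k))$ such that $s_j\mapsto\tau_j^-$ for all $j\in I$.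
   Context: Let $\mathfrak g$ be a complex simple Lie algebra with simple roots $\{\alpha_i\mid i\in I\}$, Weyl group $W$, and $W$-invariant scalar product $(\cdot,\cdot)$ normalized so that short roots $\alpha$ satisfy $(\alpha,\alpha)=2$. Let $a_{ij}=2(\alpha_i,\alpha_j)/(\alpha_i,\alpha_i)$. For $i,j\in I$ let $m_{ij}$ be the order of $s_{\alpha_i}s_{\alpha_j}$ in $W$. The braid group $Br(\mathfrak g)$ is generated by $\{s_i\mid i\in I\}$ with relations $s_is_js_i\cdots=s_js_is_j\cdots$ ($m_{ij}$ factors on each side, $i\ne j$). Let $k$ be a field containing $q\ne0$, not a root of unity, and a square root $q^{1/2}$ of $q$. Put $q_i=q^{(\alpha_i,\alpha_i)/2}$, $[n]_i=(q_i^n-q_i^{-n})/(q_i-q_i^{-1})$, $[n]=(q^n-q^{-n})/(q-q^{-1})$. $U_q(\mathfrak g)$ is the $k$-algebra with generators $E_i,F_i,K_i^{\pm1}$ ($i\in I$) and relations $K_iK_i^{-1}=K_i^{-1}K_i=1$, $K_iK_j=K_jK_i$, $K_iE_jK_i^{-1}=q^{(\alpha_i,\alpha_j)}E_j$, $K_iF_jK_i^{-1}=q^{-(\alpha_i,\alpha_j)}F_j$, $E_iF_j-F_jE_i=\delta_{ij}(K_i-K_i^{-1})/(q_i-q_i^{-1})$, and the quantum Serre relations $\sum_{s=0}^{1-a_{ij}}(-1)^s\begin{bmatrix}1-a_{ij}\\ s\end{bmatrix}_i X_i^{1-a_{ij}-s}X_jX_i^s=0$ for $i\neq j$, $X=E$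 and $X=F$, where $\begin{bmatrix}a\\ n\end{bmatrix}_i=\frac{[a]_i[a-1]_i\cdots[a-n+1]_i}{[n]_i\cdots[1]_i}$. The algebra $U_q'(\mathfrak k)$ is the $k$-subalgebra of $U_q(\mathfrak g)$ generated by $B_i=F_i-K_i^{-1}E_i$ for all $i\in I$ (the quantum symmetric pair coideal subalgebra for the Chevalley involution). $\mathrm{Aut}_{alg}$ denotes the group of $k$-algebra automorphisms. *)

theory Defs
  imports
    "HOL-Analysis.Linear_Algebra"
    "HOL-Library.Poly_Mapping"
    "HOL-Algebra.QuotRing"
    "HOL-Algebra.Module"
    "HOL-Algebra.Bij"
    "HOL-Algebra.Generated_Groups"
    "HOL-Algebra.Multiplicative_Group"
    "HOL-Algebra.Algebraic_Closure_Type"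
begin

section \<open>Root systems and Weyl groups\<close>

text \<open>A complex simple Lie algebra enters only through its root system, i.e. an irreducible
  reduced crystallographic root system. The inner product of the Euclidean space spanned by the
  roots is the Weyl group invariant scalar product.\<close>

definition reflection :: "'v::euclidean_space \<Rightarrow> 'v \<Rightarrow> 'v" where
  "reflection \<beta> v = v - (2 * (\<beta> \<bullet> v) / (\<beta> \<bullet> \<beta>)) *\<^sub>R \<beta>"

definition root_system :: "'v::euclidean_space set \<Rightarrow> bool" where
  "root_system \<Phi> \<longleftrightarrow>
     finite \<Phi> \<and> 0 \<notin> \<Phi> \<and> span \<Phi> = UNIV \<and>
     (\<forall>\<beta>\<in>\<Phi>. reflection \<beta> ` \<Phi> = \<Phi>) \<and>
     (\<forall>\<beta>\<in>\<Phi>. \<forall>\<gamma>\<in>\<Phi>. 2 * (\<beta> \<bullet> \<gamma>) / (\<beta> \<bullet> \<beta>) \<in> \<int>) \<and>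
     (\<forall>\<beta>\<in>\<Phi>. \<forall>c. c *\<^sub>R \<beta> \<in> \<Phi> \<longrightarrow> c = 1 \<or> c = -1)"

definition irreducible_root_system :: "'v::euclidean_space set \<Rightarrow> bool" where
  "irreducible_root_system \<Phi> \<longleftrightarrow>
     root_system \<Phi> \<and> \<Phi> \<noteq> {} \<and>
     \<not> (\<exists>A B. A \<noteq> {} \<and> B \<noteq> {} \<and> A \<union> B = \<Phi> \<and> (\<forall>\<beta>\<in>A. \<forall>\<gamma>\<in>B. \<beta> \<bullet> \<gamma> = 0))"

definition simple_roots :: "'v::euclidean_space set \<Rightarrow> ('i::finite \<Rightarrow> 'v) \<Rightarrow> bool" where
  "simple_roots \<Phi> \<alpha> \<longleftrightarrow>
     range \<alpha> \<subseteq> \<Phi> \<and> inj \<alpha> \<and> independent (range \<alpha>) \<and>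
     (\<forall>\<beta>\<in>\<Phi>. \<exists>c :: 'i \<Rightarrow> int. \<beta> = (\<Sum>i\<in>UNIV. of_int (c i) *\<^sub>R \<alpha> i) \<and>
        ((\<forall>i. 0 \<le> c i) \<or> (\<forall>i. c i \<le> 0)))"

text \<open>A short root is one of minimal length; in particular all roots are short in the
  simply laced case.\<close>

definition short_root :: "'v::euclidean_space set \<Rightarrow> 'v \<Rightarrow> bool" where
  "short_root \<Phi> \<beta> \<longleftrightarrow> \<beta> \<in> \<Phi> \<and> (\<forall>\<gamma>\<in>\<Phi>. \<beta> \<bullet> \<beta> \<le> \<gamma> \<bullet> \<gamma>)"

definition weyl_group :: "'v::euclidean_space set \<Rightarrow> ('v \<Rightarrow> 'v) monoid" where
  "weyl_group \<Phi> =
     BijGroup UNIV \<lparr>carrier := generate (BijGroup UNIV) (reflection ` \<Phi>)\<rparr>"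

definition coxeter_order ::
    "'v::euclidean_space set \<Rightarrow> ('i \<Rightarrow> 'v) \<Rightarrow> 'i \<Rightarrow> 'i \<Rightarrow> nat" where
  "coxeter_order \<Phi> \<alpha> i j =
     group.ord (weyl_group \<Phi>)
       (reflection (\<alpha> i) \<otimes>\<^bsub>weyl_group \<Phi>\<^esub> reflection (\<alpha> j))"

text \<open>The real numbers below are integers whenever \<open>\<alpha>\<close> is a system of simple roots of an
  irreducible root system in which short roots \<open>\<beta>\<close> satisfy \<open>\<beta> \<bullet> \<beta> = 2\<close>;
  taking the floor only changes their type.\<close>

definition pairing :: "('i \<Rightarrow> 'v::euclidean_space) \<Rightarrow> 'i \<Rightarrow> 'i \<Rightarrow> int" where
  "pairing \<alpha> i j = \<lfloor>\<alpha> i \<bullet> \<alpha> j\<rfloor>"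

definition cartan :: "('i \<Rightarrow> 'v::euclidean_space) \<Rightarrow> 'i \<Rightarrow> 'i \<Rightarrow> int" where
  "cartan \<alpha> i j = \<lfloor>2 * (\<alpha> i \<bullet> \<alpha> j) / (\<alpha> i \<bullet> \<alpha> i)\<rfloor>"

definition q_root :: "('i \<Rightarrow> 'v::euclidean_space) \<Rightarrow> 'k::field \<Rightarrow> 'i \<Rightarrow> 'k" where
  "q_root \<alpha> q i = q powi \<lfloor>(\<alpha> i \<bullet> \<alpha> i) / 2\<rfloor>"


section \<open>The braid group\<close>

text \<open>Words in the generators \<open>s\<^sub>i\<close> and their formal inverses; the letter \<open>(i, True)\<close>
  is \<open>s\<^sub>i\<close> and \<open>(i, False)\<close> is its inverse.\<close>

type_synonym 'i braid_word = "('i \<times> bool) list"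

fun alternating :: "nat \<Rightarrow> 'i \<Rightarrow> 'i \<Rightarrow> 'i braid_word" where
  "alternating 0 i j = []"
| "alternating (Suc n) i j = (i, True) # alternating n j i"

inductive braid_eq :: "('i \<Rightarrow> 'i \<Rightarrow> nat) \<Rightarrow> 'i braid_word \<Rightarrow> 'i braid_word \<Rightarrow> bool"
  for m :: "'i \<Rightarrow> 'i \<Rightarrow> nat" where
  refl: "braid_eq m u u"
| sym: "braid_eq m u v \<Longrightarrow> braid_eq m v u"
| trans: "braid_eq m u v \<Longrightarrow> braid_eq m v w \<Longrightarrow> braid_eq m u w"
| append: "braid_eq m u u' \<Longrightarrow> braid_eq m v v' \<Longrightarrow> braid_eq m (u @ v) (u' @ v')"
| cancel: "braid_eq m [(i, b), (i, \<not> b)] []"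
| braid: "i \<noteq> j \<Longrightarrow> braid_eq m (alternating (m i j) i j) (alternating (m i j) j i)"

definition braid_class :: "('i \<Rightarrow> 'i \<Rightarrow> nat) \<Rightarrow> 'i braid_word \<Rightarrow> 'i braid_word set" where
  "braid_class m u = {v. braid_eq m u v}"

definition braid_group :: "('i \<Rightarrow> 'i \<Rightarrow> nat) \<Rightarrow> 'i braid_word set monoid" where
  "braid_group m =
     \<lparr>carrier = range (braid_class m),
      monoid.mult = (\<lambda>S T. \<Union>u\<in>S. \<Union>v\<in>T. braid_class m (u @ v)),
      one = braid_class m []\<rparr>"

definition braid_gen :: "('i \<Rightarrow> 'i \<Rightarrow> nat) \<Rightarrow> 'i \<Rightarrow> 'i braid_word set" where
  "braid_gen m i = braid_class m [(i, True)]"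


section \<open>Free algebras\<close>

text \<open>The free monoid, written additively so that finitely supported functions on it carry
  the convolution product, i.e. form the free associative algebra.\<close>

datatype 'a word = Word (letters: "'a list")

instantiation word :: (type) monoid_add
begin

definition zero_word :: "'a word" where
  "zero_word = Word []"

definition plus_word :: "'a word \<Rightarrow> 'a word \<Rightarrow> 'a word" where
  "plus_word u v = Word (letters u @ letters v)"

instance
  by standard (simp_all add: zero_word_def plus_word_def)

end

type_synonym ('a, 'k) free_algebra = "'a word \<Rightarrow>\<^sub>0 'k"

definition fa_gen :: "'a \<Rightarrow> ('a, 'k::field) free_algebra" where
  "fa_gen x = Poly_Mapping.single (Word [x]) 1"

definition fa_const :: "'k::field \<Rightarrow> ('a, 'k) free_algebra" where
  "fa_const c = Poly_Mapping.single 0 c"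

definition presented_algebra ::
    "('a, 'k::field) free_algebra set \<Rightarrow> ('k, ('a, 'k) free_algebra set) module" where
  "presented_algebra rels =
     (let R = ring_of_type_algebra; J = genideal R rels; Q = R Quot J
      in \<lparr>carrier = carrier Q, monoid.mult = monoid.mult Q, one = one Q, zero = zero Q, add = add Q,
          module.smult = (\<lambda>c x. (J +>\<^bsub>R\<^esub> fa_const c) \<otimes>\<^bsub>Q\<^esub> x)\<rparr>)"

definition presented_gen ::
    "('a, 'k::field) free_algebra set \<Rightarrow> 'a \<Rightarrow> ('a, 'k) free_algebra set" where
  "presented_gen rels x =
     genideal ring_of_type_algebra rels +>\<^bsub>ring_of_type_algebra\<^esub> fa_gen x"


section \<open>Subalgebras and algebra automorphisms\<close>

definition subalgebra_of :: "('k, 'a) module \<Rightarrow> 'a set \<Rightarrow> bool" where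
  "subalgebra_of A V \<longleftrightarrow> subring V A \<and> (\<forall>c. \<forall>x\<in>V. c \<odot>\<^bsub>A\<^esub> x \<in> V)"

definition generated_subalgebra :: "('k, 'a) module \<Rightarrow> 'a set \<Rightarrow> ('k, 'a) module" where
  "generated_subalgebra A S = A \<lparr>carrier := \<Inter>{V. subalgebra_of A V \<and> S \<subseteq> V}\<rparr>"

text \<open>As in \<^const>\<open>BijGroup\<close>, automorphisms are extensional functions, so that
  equality of automorphisms is equality on the carrier.\<close>

definition algebra_automorphisms :: "('k, 'a) module \<Rightarrow> ('a \<Rightarrow> 'a) set" where
  "algebra_automorphisms A =
     {\<phi> \<in> Bij (carrier A). \<phi> \<in> ring_hom A A \<and>
        (\<forall>c. \<forall>x\<in>carrier A. \<phi> (c \<odot>\<^bsub>A\<^esub> x) = c \<odot>\<^bsub>A\<^esub> \<phi> x)}"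

definition Aut_alg :: "('k, 'a) module \<Rightarrow> ('a \<Rightarrow> 'a) monoid" where
  "Aut_alg A = BijGroup (carrier A) \<lparr>carrier := algebra_automorphisms A\<rparr>"


section \<open>Quantized enveloping algebras\<close>

definition qint :: "'k::field \<Rightarrow> int \<Rightarrow> 'k" where
  "qint p n = (p powi n - p powi (- n)) / (p - inverse p)"

definition qbinomial :: "'k::field \<Rightarrow> int \<Rightarrow> nat \<Rightarrow> 'k" where
  "qbinomial p a n = (\<Prod>t<n. qint p (a - int t)) / (\<Prod>t=1..n. qint p (int t))"

datatype 'i uq_gen = GE 'i | GF 'i | GK 'i | GKinv 'i

definition serre ::
    "('i \<Rightarrow> 'v::euclidean_space) \<Rightarrow> 'k::field \<Rightarrow> ('i \<Rightarrow> 'i uq_gen) \<Rightarrow> 'i \<Rightarrow> 'i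
      \<Rightarrow> ('i uq_gen, 'k) free_algebra" where
  "serre \<alpha> q G i j =
     (let N = nat (1 - cartan \<alpha> i j)
      in \<Sum>s=0..N. fa_const ((-1) ^ s * qbinomial (q_root \<alpha> q i) (1 - cartan \<alpha> i j) s)
           * fa_gen (G i) ^ (N - s) * fa_gen (G j) * fa_gen (G i) ^ s)"

definition uq_relators ::
    "('i \<Rightarrow> 'v::euclidean_space) \<Rightarrow> 'k::field \<Rightarrow> ('i uq_gen, 'k) free_algebra set" where
  "uq_relators \<alpha> q =
     (\<Union>i. {fa_gen (GK i) * fa_gen (GKinv i) - 1, fa_gen (GKinv i) * fa_gen (GK i) - 1}) \<union>
     (\<Union>i j. {fa_gen (GK i) * fa_gen (GK j) - fa_gen (GK j) * fa_gen (GK i),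
       fa_gen (GK i) * fa_gen (GE j) * fa_gen (GKinv i) - fa_const (q powi pairing \<alpha> i j) * fa_gen (GE j),
       fa_gen (GK i) * fa_gen (GF j) * fa_gen (GKinv i) - fa_const (q powi (- pairing \<alpha> i j)) * fa_gen (GF j),
       fa_gen (GE i) * fa_gen (GF j) - fa_gen (GF j) * fa_gen (GE i) -
         (if i = j
          then fa_const (1 / (q_root \<alpha> q i - inverse (q_root \<alpha> q i))) * (fa_gen (GK i) - fa_gen (GKinv i))
          else 0)}) \<union>
     (\<Union>i. \<Union>j\<in>- {i}. {serre \<alpha> q GE i j, serre \<alpha> q GF i j})"

definition Uq ::
    "('i \<Rightarrow> 'v::euclidean_space) \<Rightarrow> 'k::field \<Rightarrow> ('k, ('i uq_gen, 'k) free_algebra set) module"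
  where
  "Uq \<alpha> q = presented_algebra (uq_relators \<alpha> q)"

definition uq_elem ::
    "('i \<Rightarrow> 'v::euclidean_space) \<Rightarrow> 'k::field \<Rightarrow> 'i uq_gen \<Rightarrow> ('i uq_gen, 'k) free_algebra set"
  where
  "uq_elem \<alpha> q = presented_gen (uq_relators \<alpha> q)"


section \<open>The coideal subalgebra and the maps on its generators\<close>

definition qsp_B ::
    "('i \<Rightarrow> 'v::euclidean_space) \<Rightarrow> 'k::field \<Rightarrow> 'i \<Rightarrow> ('i uq_gen, 'k) free_algebra set" where
  "qsp_B \<alpha> q i = uq_elem \<alpha> q (GF i) \<ominus>\<^bsub>Uq \<alpha> q\<^esub>
     (uq_elem \<alpha> q (GKinv i) \<otimes>\<^bsub>Uq \<alpha> q\<^esub> uq_elem \<alpha> q (GE i))"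

definition Uqk ::
    "('i \<Rightarrow> 'v::euclidean_space) \<Rightarrow> 'k::field \<Rightarrow> ('k, ('i uq_gen, 'k) free_algebra set) module"
  where
  "Uqk \<alpha> q = generated_subalgebra (Uq \<alpha> q) (range (qsp_B \<alpha> q))"

text \<open>The right-hand sides of the defining formulas, with \<open>x\<close> for \<open>B\<^sub>i\<close>,
  \<open>y\<close> for \<open>B\<^sub>j\<close>, \<open>qi\<close> for \<open>q\<^sub>i\<close> and \<open>a\<close> for
  \<open>a\<^sub>i\<^sub>j\<close>, when \<open>j \<noteq> i\<close>. Only \<open>a \<in> {0, -1, -2, -3}\<close> occurs.\<close>

context
  fixes A :: "('k::field, 'a) module" (structure) and q :: 'k
begin

definition tau_minus_expr :: "'k \<Rightarrow> int \<Rightarrow> 'a \<Rightarrow> 'a \<Rightarrow> 'a" where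
  "tau_minus_expr qi a x y =
    (if a = 0 then y
     else if a = -1 then x \<otimes> y \<ominus> qi \<odot> (y \<otimes> x)
     else if a = -2 then
       inverse (qint q 2) \<odot>
         (x [^] (2::nat) \<otimes> y \<ominus> (q * qint q 2) \<odot> (x \<otimes> y \<otimes> x) \<oplus> q^2 \<odot> (y \<otimes> x [^] (2::nat)))
       \<oplus> y
     else if a = -3 then
       (inverse (qint q 3) * inverse (qint q 2)) \<odot>
         (x [^] (3::nat) \<otimes> y \<ominus> (q * qint q 3) \<odot> (x [^] (2::nat) \<otimes> y \<otimes> x)
          \<oplus> (q^2 * qint q 3) \<odot> (x \<otimes> y \<otimes> x [^] (2::nat)) \<ominus> q^3 \<odot> (y \<otimes> x [^] (3::nat))
          \<oplus> inverse q \<odot> (x \<otimes> y \<ominus> q^3 \<odot> (y \<otimes> x)))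
       \<oplus> (x \<otimes> y \<ominus> q \<odot> (y \<otimes> x))
     else undefined)"

definition tau_expr :: "'k \<Rightarrow> int \<Rightarrow> 'a \<Rightarrow> 'a \<Rightarrow> 'a" where
  "tau_expr qi a x y =
    (if a = 0 then y
     else if a = -1 then y \<otimes> x \<ominus> qi \<odot> (x \<otimes> y)
     else if a = -2 then
       inverse (qint q 2) \<odot>
         (y \<otimes> x [^] (2::nat) \<ominus> (q * qint q 2) \<odot> (x \<otimes> y \<otimes> x) \<oplus> q^2 \<odot> (x [^] (2::nat) \<otimes> y))
       \<oplus> y
     else if a = -3 then
       (inverse (qint q 3) * inverse (qint q 2)) \<odot>
         (y \<otimes> x [^] (3::nat) \<ominus> (q * qint q 3) \<odot> (x \<otimes> y \<otimes> x [^] (2::nat))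
          \<oplus> (q^2 * qint q 3) \<odot> (x [^] (2::nat) \<otimes> y \<otimes> x) \<ominus> q^3 \<odot> (x [^] (3::nat) \<otimes> y)
          \<oplus> inverse q \<odot> (y \<otimes> x \<ominus> q^3 \<odot> (x \<otimes> y)))
       \<oplus> (y \<otimes> x \<ominus> q \<odot> (x \<otimes> y))
     else undefined)"

end

definition tau_minus_image ::
    "('i \<Rightarrow> 'v::euclidean_space) \<Rightarrow> 'k::field \<Rightarrow> 'i \<Rightarrow> 'i \<Rightarrow> ('i uq_gen, 'k) free_algebra set" where
  "tau_minus_image \<alpha> q i j =
     (if j = i then qsp_B \<alpha> q j
      else tau_minus_expr (Uqk \<alpha> q) q (q_root \<alpha> q i) (cartan \<alpha> i j) (qsp_B \<alpha> q i) (qsp_B \<alpha> q j))"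

definition tau_image ::
    "('i \<Rightarrow> 'v::euclidean_space) \<Rightarrow> 'k::field \<Rightarrow> 'i \<Rightarrow> 'i \<Rightarrow> ('i uq_gen, 'k) free_algebra set" where
  "tau_image \<alpha> q i j =
     (if j = i then qsp_B \<alpha> q j
      else tau_expr (Uqk \<alpha> q) q (q_root \<alpha> q i) (cartan \<alpha> i j) (qsp_B \<alpha> q i) (qsp_B \<alpha> q j))"

definition tau_minus ::
    "('i \<Rightarrow> 'v::euclidean_space) \<Rightarrow> 'k::field \<Rightarrow> 'i
      \<Rightarrow> ('i uq_gen, 'k) free_algebra set \<Rightarrow> ('i uq_gen, 'k) free_algebra set" where
  "tau_minus \<alpha> q i =
     (THE \<phi>. \<phi> \<in> carrier (Aut_alg (Uqk \<alpha> q)) \<and> (\<forall>j. \<phi> (qsp_B \<alpha> q j) = tau_minus_image \<alpha> q i j))"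

end

theory Submission
  imports Defs
begin

text \<open>Let \<open>T\<close> be the free algebra on letters \<open>B\<^sub>i\<close> and \<open>ker\<close> the kernel of the map from \<open>T\<close> onto the
  coideal subalgebra. The action of the quantized enveloping algebra on the Verma module of highest
  weight zero modulo the Serre relations shows that the leading term of an element of \<open>ker\<close> lies in the Serre ideal; conversely,
  \<open>ker\<close> contains a deformation by lower order terms of every Serre relation. Since right multiplication
  by a generator is injective modulo the Serre ideal, an element of
  \<open>ker + T (B\<^sub>i - c)\<close> for infinitely many scalars \<open>c\<close> belongs to \<open>ker\<close> by a degree argument.

  The deformed Serre relation between \<open>B\<^sub>i\<close> and \<open>B\<^sub>j\<close> is a polynomial in left and right multiplication by
  \<open>B\<^sub>i\<close>. Choosing \<open>c\<close> among the scalars \<open>l\<^sub>n = (q\<^sub>i\<^sup>n + q\<^sub>i\<^sup>-\<^sup>n\<^sup>-\<^sup>1) / (q\<^sub>i - q\<^sub>i\<^sup>-\<^sup>1)\<close>, it follows for large \<open>n\<close> that \<open>T / (ker + T (B\<^sub>i - l\<^sub>n))\<close>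
  is spanned by eigenvectors of \<open>B\<^sub>i\<close> with eigenvalues among the \<open>l\<^sub>m\<close>, and that \<open>B\<^sub>j\<close> shifts \<open>m\<close> by
  \<open>a, a + 2, \<dots>, -a\<close>, where \<open>a = a\<^sub>i\<^sub>j\<close>. On these quotients the formulas for \<open>\<tau>\<^sub>i\<^sup>-\<close> and \<open>\<tau>\<^sub>i\<close> are conjugation by the operator
  with eigenvalues \<open>(-1)^m q\<^sub>i^(- m (m + 1) / 2)\<close> and by its inverse. Hence both formulas preserve \<open>ker\<close>, they are
  inverse to each other modulo \<open>ker\<close>, and they fix whatever commutes with \<open>B\<^sub>i\<close>.

  In rank two, the product of all but one of the factors on one side of a braid relation maps \<open>B\<^sub>i\<close>
  or \<open>B\<^sub>j\<close> to the generator fixed by the omitted factor, which is an explicit computation. As Dynkin diagrams have no triangles, every \<open>B\<^sub>k\<close>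
  commutes with \<open>B\<^sub>i\<close> or \<open>B\<^sub>j\<close>, unless \<open>a\<^sub>i\<^sub>j = 0\<close>, when \<open>\<tau>\<^sub>i\<^sup>-\<close> and \<open>\<tau>\<^sub>j\<^sup>-\<close> visibly commute. Both sides of the
  braid relation therefore agree on \<open>B\<^sub>k\<close>, because \<open>\<tau>\<^sub>i\<^sup>-\<close> fixes the centraliser of \<open>B\<^sub>i\<close>.\<close>

section \<open>Free algebras\<close>

text \<open>Neither a basis nor a presentation of the coideal subalgebra is at hand, and
  substituting the formulas into the deformed Serre relations would be a large noncommutative
  computation. Eigenvalues reduce it to scalar identities. For a = -1 the relation is the conic L^2
  - (q_i + q_i^-1) L R + R^2 + q_i^-1 = 0, and the l_n parametrise it: its points over R = l_n are
  (l_(n+1), l_n) and (l_(n-1), l_n). For the other a the relation factors along the same sequence.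
  At these two points the formula L - q_i R takes the values -q_i^(-n-1) and -q_i^n. They are
  g(n+1)/g(n) and g(n-1)/g(n) precisely for g(n) = (-1)^n q_i^(-n(n+1)/2) up to a constant, which is
  the origin of the Gaussian weights. The formulas for a = -2 and a = -3 take as values the ratios
  of the same g over their own shifts; for a = -2 the summand B_j supplies the value 1 at shift 0.
  One letter lowers an index by at most 3, so for large n all indices stay natural numbers, where
  the l_n are distinct.\<close>

abbreviation mon :: "'a list \<Rightarrow> ('a, 'k::field) free_algebra" where
  "mon w \<equiv> Poly_Mapping.single (Word w) 1"

lemma Word_Nil: "Word [] = 0"
  by (simp add: zero_word_def)

lemma Word_add: "Word u + Word v = Word (u @ v)"
  by (simp add: plus_word_def)

lemma fa_const_add: "fa_const (c + d) = fa_const c + fa_const d"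
  by (simp add: fa_const_def single_add)

lemma fa_const_mult: "fa_const (c * d) = fa_const c * fa_const d"
  by (simp add: fa_const_def mult_single)

lemma fa_const_0 [simp]: "fa_const 0 = 0"
  by (simp add: fa_const_def)

lemma fa_const_1 [simp]: "fa_const 1 = 1"
  by (simp add: fa_const_def)

lemma fa_const_uminus: "fa_const (- c) = - fa_const c"
  by (simp add: fa_const_def single_uminus)

lemma fa_const_diff: "fa_const (c - d) = fa_const c - fa_const d"
  by (simp add: fa_const_def single_diff)

lemma fa_const_sum: "fa_const (sum f A) = (\<Sum>x\<in>A. fa_const (f x))"
  by (induction A rule: infinite_finite_induct) (simp_all add: fa_const_add)

lemma fa_const_mult_single: "fa_const c * Poly_Mapping.single w d = Poly_Mapping.single w (c * d)"
  by (simp add: fa_const_def mult_single)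

lemma single_mult_fa_const: "Poly_Mapping.single w d * fa_const c = Poly_Mapping.single w (c * d)"
  by (simp add: fa_const_def mult_single mult.commute)

lemma fa_gen_mult_single: "fa_gen x * Poly_Mapping.single (Word w) c = Poly_Mapping.single (Word (x # w)) c"
  by (simp add: fa_gen_def mult_single Word_add)

lemma single_Word_Nil: "Poly_Mapping.single (Word []) c = fa_const c"
  by (simp add: fa_const_def Word_Nil)

lemma fa_single_induct [case_names single add]:
  assumes s: "\<And>w c. P (Poly_Mapping.single (Word w) c)" and a: "\<And>p q. P p \<Longrightarrow> P q \<Longrightarrow> P (p + q)"
  shows "P (p :: ('a, 'k::field) free_algebra)"
proof (induction p rule: update_induct)
  case const
  then show ?case using s[of "[]" 0] by simp
next
  case (update f w c)
  have "Poly_Mapping.update w c f = f + Poly_Mapping.single w c"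
    using update by (intro poly_mapping_eqI)
      (auto simp: lookup_update lookup_add lookup_single in_keys_iff when_def)
  then show ?case using update a s by (metis word.collapse)
qed

lemma fa_left_induct [case_names const gen add]:
  assumes c: "\<And>c. P (fa_const c)" and g: "\<And>x p. P p \<Longrightarrow> P (fa_gen x * p)"
    and a: "\<And>p q. P p \<Longrightarrow> P q \<Longrightarrow> P (p + q)"
  shows "P (p :: ('a, 'k::field) free_algebra)"
proof (induction p rule: fa_single_induct)
  case (single w c)
  show ?case
    by (induction w) (auto simp: single_Word_Nil c simp flip: fa_gen_mult_single intro: g)
qed (rule a)

lemma fa_const_commute: "p * fa_const c = fa_const c * p"
  by (induction p rule: fa_single_induct)
    (simp_all add: fa_const_mult_single single_mult_fa_const algebra_simps)

lemma fa_const_left: "p * (fa_const c * r) = fa_const c * (p * r)"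
  by (metis fa_const_commute mult.assoc)

text \<open>Collects all scalars into one constant on the left. The guard \<open>NO_MATCH\<close>
  keeps the first two rules from exchanging two constants for ever.\<close>

lemma fa_const_pull:
  "NO_MATCH (fa_const d) p \<Longrightarrow> p * fa_const c = fa_const c * p"
  "NO_MATCH (fa_const d) p \<Longrightarrow> p * (fa_const c * r) = fa_const c * (p * r)"
  "fa_const c * fa_const d = fa_const (c * d)"
  "fa_const c * (fa_const d * r) = fa_const (c * d) * r"
  by (rule fa_const_commute fa_const_left fa_const_mult[symmetric])+ (simp add: fa_const_mult mult.assoc)

definition fa_extend :: "('a word \<Rightarrow> ('b, 'k) free_algebra) \<Rightarrow> ('a, 'k::field) free_algebra \<Rightarrow> ('b, 'k) free_algebra" where
  "fa_extend h p = (\<Sum>w\<in>Poly_Mapping.keys p. fa_const (Poly_Mapping.lookup p w) * h w)"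

lemma fa_extend_superset:
  assumes "finite A" "Poly_Mapping.keys p \<subseteq> A"
  shows "fa_extend h p = (\<Sum>w\<in>A. fa_const (Poly_Mapping.lookup p w) * h w)"
  unfolding fa_extend_def using assms
  by (intro sum.mono_neutral_left) (auto simp: in_keys_iff)

lemma fa_extend_add: "fa_extend h (p + q) = fa_extend h p + fa_extend h q"
  using Poly_Mapping.keys_add[of p q]
  by (simp add: fa_extend_superset[of "Poly_Mapping.keys p \<union> Poly_Mapping.keys q"] lookup_add
      fa_const_add distrib_right sum.distrib)

lemma fa_extend_single [simp]: "fa_extend h (Poly_Mapping.single w c) = fa_const c * h w"
  by (cases "c = 0") (simp_all add: fa_extend_def)

lemma fa_extend_0 [simp]: "fa_extend h 0 = 0"
  by (simp add: fa_extend_def)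

lemma fa_extend_const_mult: "fa_extend h (fa_const c * p) = fa_const c * fa_extend h p"
  by (induction p rule: fa_single_induct)
    (simp_all add: fa_extend_add distrib_left fa_const_mult_single fa_const_mult mult.assoc)

lemma fa_extend_uminus: "fa_extend h (- p) = - fa_extend h p"
  using fa_extend_const_mult[of h "-1" p] by (simp add: fa_const_uminus)

lemma fa_extend_diff: "fa_extend h (p - q) = fa_extend h p - fa_extend h q"
  using fa_extend_add[of h p "- q"] by (simp add: fa_extend_uminus)

definition fa_linear :: "(('a, 'k::field) free_algebra \<Rightarrow> ('b, 'k) free_algebra) \<Rightarrow> bool" where
  "fa_linear f \<longleftrightarrow> (\<forall>p r. f (p + r) = f p + f r) \<and> (\<forall>c p. f (fa_const c * p) = fa_const c * f p)"

lemma fa_linear_extend: "fa_linear (fa_extend h)"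
  by (simp add: fa_linear_def fa_extend_add fa_extend_const_mult)

lemma fa_linearD:
  assumes "fa_linear f"
  shows "f (p + r) = f p + f r" "f (fa_const c * p) = fa_const c * f p"
    "f 0 = 0" "f (- p) = - f p" "f (p - r) = f p - f r"
proof -
  have a: "f (p + r) = f p + f r" and c: "f (fa_const c * p) = fa_const c * f p" for p r c
    using assms by (auto simp: fa_linear_def)
  show "f (p + r) = f p + f r" "f (fa_const c * p) = fa_const c * f p" by (fact a c)+
  show "f 0 = 0" using c[of 0 0] by simp
  show m: "f (- p) = - f p" for p using c[of "-1" p] by (simp add: fa_const_uminus)
  show "f (p - r) = f p - f r" using a[of p "- r"] m[of r] by simp
qed

lemma fa_linear_sum: "fa_linear f \<Longrightarrow> f (sum g A) = (\<Sum>x\<in>A. f (g x))"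
  by (induction A rule: infinite_finite_induct) (simp_all add: fa_linearD)

lemma fa_linear_eq:
  assumes "fa_linear f" "fa_linear g" "\<And>w. f (mon w) = g (mon w)"
  shows "f p = g p"
proof (induction p rule: fa_single_induct)
  case (single w c)
  have e: "Poly_Mapping.single (Word w) c = fa_const c * mon w" by (simp add: fa_const_mult_single)
  show ?case unfolding e fa_linearD(2)[OF assms(1)] fa_linearD(2)[OF assms(2)] assms(3) ..
qed (simp add: fa_linearD[OF assms(1)] fa_linearD[OF assms(2)])

definition fa_hom :: "('a \<Rightarrow> ('b, 'k) free_algebra) \<Rightarrow> ('a, 'k::field) free_algebra \<Rightarrow> ('b, 'k) free_algebra" where
  "fa_hom f = fa_extend (\<lambda>w. prod_list (map f (letters w)))"

lemma fa_linear_hom: "fa_linear (fa_hom f)"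
  by (simp add: fa_hom_def fa_linear_extend)

lemmas fa_hom_linear = fa_linearD[OF fa_linear_hom]

lemma fa_hom_single: "fa_hom f (Poly_Mapping.single (Word w) c) = fa_const c * prod_list (map f w)"
  by (simp add: fa_hom_def)

lemma fa_hom_const [simp]: "fa_hom f (fa_const c) = fa_const c"
  using fa_hom_single[of f "[]" c] by (simp add: single_Word_Nil)

lemma fa_hom_1 [simp]: "fa_hom f 1 = 1"
  using fa_hom_const[of f 1] by simp

lemma fa_hom_gen [simp]: "fa_hom f (fa_gen x) = f x"
  by (simp add: fa_gen_def fa_hom_single)

lemma fa_hom_gen_mult: "fa_hom f (fa_gen x * p) = f x * fa_hom f p"
  by (induction p rule: fa_single_induct)
    (simp_all add: fa_gen_mult_single fa_hom_single distrib_left fa_hom_linear fa_const_left)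

lemma fa_hom_mult [simp]: "fa_hom f (p * r) = fa_hom f p * fa_hom f r"
  by (induction p rule: fa_left_induct)
    (simp_all add: fa_hom_linear distrib_right mult.assoc fa_hom_gen_mult)

lemma fa_hom_power [simp]: "fa_hom f (p ^ n) = fa_hom f p ^ n"
  by (induction n) simp_all

lemma fa_hom_cong_eq:
  assumes "\<And>c. h (fa_const c) = fa_const c" "\<And>p r. h (p + r) = h p + h r" "\<And>p r. h (p * r) = h p * h r"
  shows "h p = fa_hom (\<lambda>x. h (fa_gen x)) p"
  by (induction p rule: fa_left_induct) (simp_all add: assms fa_hom_linear)

lemma fa_hom_gen_id: "fa_hom fa_gen p = p"
  using fa_hom_cong_eq[of id p] by simp

lemma fa_hom_comp: "fa_hom f (fa_hom g p) = fa_hom (\<lambda>x. fa_hom f (g x)) p"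
  using fa_hom_cong_eq[of "\<lambda>p. fa_hom f (fa_hom g p)" p] by (simp add: fa_hom_linear)

section \<open>Degrees\<close>

text \<open>The bound is strict so that \<open>deglt 0\<close> holds only of zero and inductions on
  the degree can end there.\<close>

definition deglt :: "nat \<Rightarrow> ('a, 'k::field) free_algebra \<Rightarrow> bool" where
  "deglt n p \<longleftrightarrow> (\<forall>w\<in>Poly_Mapping.keys p. length (letters w) < n)"

definition homog :: "nat \<Rightarrow> ('a, 'k::field) free_algebra \<Rightarrow> bool" where
  "homog n p \<longleftrightarrow> (\<forall>w\<in>Poly_Mapping.keys p. length (letters w) = n)"

definition hcomp :: "nat \<Rightarrow> ('a, 'k::field) free_algebra \<Rightarrow> ('a, 'k) free_algebra" where
  "hcomp n = fa_extend (\<lambda>w. if length (letters w) = n then Poly_Mapping.single w 1 else 0)"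

lemma fa_linear_comp: "fa_linear (hcomp n)"
  by (simp add: hcomp_def fa_linear_extend)

lemma lookup_comp: "Poly_Mapping.lookup (hcomp n p) w = (if length (letters w) = n then Poly_Mapping.lookup p w else 0)"
proof (induction p rule: fa_single_induct)
  case (single v c)
  then show ?case by (auto simp: hcomp_def fa_const_mult_single lookup_single when_def)
qed (simp add: fa_linearD[OF fa_linear_comp] lookup_add)

lemma homog_comp: "homog n (hcomp n p)"
  by (auto simp: homog_def in_keys_iff lookup_comp split: if_splits)

lemma comp_homog: "homog m p \<Longrightarrow> hcomp n p = (if n = m then p else 0)"
  by (intro poly_mapping_eqI) (auto simp: lookup_comp homog_def in_keys_iff)

lemma comp_deglt: "deglt n p \<Longrightarrow> hcomp n p = 0"
  by (intro poly_mapping_eqI) (auto simp: lookup_comp deglt_def in_keys_iff)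

lemma deglt_comp_decomp: "deglt (Suc n) p \<Longrightarrow> deglt n (p - hcomp n p)"
  by (force simp: deglt_def in_keys_iff lookup_minus lookup_comp less_Suc_eq split: if_splits)

lemma deglt_add: "deglt n p \<Longrightarrow> deglt n r \<Longrightarrow> deglt n (p + r)"
  using Poly_Mapping.keys_add[of p r] by (auto simp: deglt_def)

lemma deglt_uminus [simp]: "deglt n (- p) = deglt n p"
  by (simp add: deglt_def in_keys_iff)

lemma deglt_diff: "deglt n p \<Longrightarrow> deglt n r \<Longrightarrow> deglt n (p - r)"
  using deglt_add[of n p "- r"] by simp

lemma deglt_zero [simp]: "deglt n 0"
  by (simp add: deglt_def)

lemma deglt_sum: "(\<And>x. x \<in> A \<Longrightarrow> deglt n (f x)) \<Longrightarrow> deglt n (sum f A)"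
  by (induction A rule: infinite_finite_induct) (auto intro: deglt_add)

lemma deglt_mono: "deglt n p \<Longrightarrow> n \<le> m \<Longrightarrow> deglt m p"
  by (force simp: deglt_def)

lemma homog_deglt: "homog n p \<Longrightarrow> deglt (Suc n) p"
  by (auto simp: deglt_def homog_def)

lemma deglt_mult:
  assumes "deglt (Suc n) p" "deglt m r" shows "deglt (n + m) (p * r)"
  unfolding deglt_def
proof
  fix w assume "w \<in> Poly_Mapping.keys (p * r)"
  then obtain u v where w: "w = u + v" "u \<in> Poly_Mapping.keys p" "v \<in> Poly_Mapping.keys r"
    using keys_mult[of p r] by fastforce
  then have "length (letters u) < Suc n" "length (letters v) < m"
    using assms by (auto simp: deglt_def)
  then show "length (letters w) < n + m" by (simp add: w plus_word_def)
qed

lemma deglt_mult':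
  assumes "deglt m r" "deglt (Suc n) p" shows "deglt (m + n) (r * p)"
  unfolding deglt_def
proof
  fix w assume "w \<in> Poly_Mapping.keys (r * p)"
  then obtain u v where w: "w = u + v" "u \<in> Poly_Mapping.keys r" "v \<in> Poly_Mapping.keys p"
    using keys_mult[of r p] by fastforce
  then have "length (letters v) < Suc n" "length (letters u) < m"
    using assms by (auto simp: deglt_def)
  then show "length (letters w) < m + n" by (simp add: w plus_word_def)
qed

lemma homog_mult:
  assumes "homog n p" "homog m r" shows "homog (n + m) (p * r)"
  unfolding homog_def
proof
  fix w assume "w \<in> Poly_Mapping.keys (p * r)"
  then obtain u v where w: "w = u + v" "u \<in> Poly_Mapping.keys p" "v \<in> Poly_Mapping.keys r"
    using keys_mult[of p r] by fastforce
  then show "length (letters w) = n + m" using assms by (auto simp: w plus_word_def homog_def)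
qed

lemma homog_add: "homog n p \<Longrightarrow> homog n r \<Longrightarrow> homog n (p + r)"
  using Poly_Mapping.keys_add[of p r] by (auto simp: homog_def)

lemma homog_sum: "(\<And>x. x \<in> A \<Longrightarrow> homog n (f x)) \<Longrightarrow> homog n (sum f A)"
  by (induction A rule: infinite_finite_induct) (auto intro: homog_add simp: homog_def[of n 0])

lemma homog_single: "homog (length w) (Poly_Mapping.single (Word w) c)"
  by (simp add: homog_def)

lemma homog_const: "homog 0 (fa_const c)"
  using homog_single[of "[]"] by (simp add: single_Word_Nil)

lemma homog_gen: "homog 1 (fa_gen x)"
  using homog_single[of "[x]"] by (simp add: fa_gen_def)

lemma homog_1: "homog 0 1"
  using homog_const[of 1] by simp

lemma homog_power: "homog n p \<Longrightarrow> homog (n * k) (p ^ k)"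
  by (induction k) (auto simp: homog_1 intro: homog_mult)

lemma deglt_const_mult: "deglt n p \<Longrightarrow> deglt n (fa_const c * p)"
  using deglt_mult[OF homog_deglt[OF homog_const[of c]], of n p] by simp

lemma deglt_gen_mult: "deglt n p \<Longrightarrow> deglt (Suc n) (fa_gen x * p)"
  using deglt_mult[OF homog_deglt[OF homog_gen[of x]], of n p] by simp

lemma deglt_ex: "\<exists>n. deglt n p"
proof (induction p rule: fa_single_induct)
  case (single w c)
  then show ?case using homog_deglt[OF homog_single] by blast
next
  case (add p q)
  then obtain m n where "deglt m p" "deglt n q" by blast
  then have "deglt (max m n) (p + q)" by (intro deglt_add) (auto intro: deglt_mono)
  then show ?case by blast
qed

lemma deglt_0: "deglt 0 p \<Longrightarrow> p = 0"
  by (simp add: deglt_def)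

section \<open>Two-sided ideals\<close>

definition two_sided :: "'r::ring_1 set \<Rightarrow> bool" where
  "two_sided J \<longleftrightarrow> 0 \<in> J \<and> (\<forall>x\<in>J. \<forall>y\<in>J. x + y \<in> J) \<and> (\<forall>x\<in>J. \<forall>r. r * x \<in> J \<and> x * r \<in> J)"

lemma two_sidedD:
  assumes "two_sided J"
  shows "0 \<in> J" "x \<in> J \<Longrightarrow> y \<in> J \<Longrightarrow> x + y \<in> J" "x \<in> J \<Longrightarrow> r * x \<in> J" "x \<in> J \<Longrightarrow> x * r \<in> J"
    "x \<in> J \<Longrightarrow> - x \<in> J" "x \<in> J \<Longrightarrow> y \<in> J \<Longrightarrow> x - y \<in> J"
proof -
  have "0 \<in> J" and add: "\<And>x y. x \<in> J \<Longrightarrow> y \<in> J \<Longrightarrow> x + y \<in> J"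
    and l: "\<And>x r. x \<in> J \<Longrightarrow> r * x \<in> J" and "\<And>x r. x \<in> J \<Longrightarrow> x * r \<in> J"
    using assms by (auto simp: two_sided_def)
  then show "0 \<in> J" "x \<in> J \<Longrightarrow> y \<in> J \<Longrightarrow> x + y \<in> J" "x \<in> J \<Longrightarrow> r * x \<in> J" "x \<in> J \<Longrightarrow> x * r \<in> J" by blast+
  show neg: "x \<in> J \<Longrightarrow> - x \<in> J" for x using l[of x "-1"] by simp
  show "x \<in> J \<Longrightarrow> y \<in> J \<Longrightarrow> x - y \<in> J" using add[of x "- y"] neg[of y] by simp
qed

text \<open>Each step adds one relation with a monomial on either side, so additive properties of
  the ideal need to be checked on such products only.\<close>

inductive_set fa_ideal :: "('a, 'k::field) free_algebra set \<Rightarrow> ('a, 'k) free_algebra set" for R where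
  zero: "0 \<in> fa_ideal R"
| step: "p \<in> fa_ideal R \<Longrightarrow> s \<in> R \<Longrightarrow>
    p + Poly_Mapping.single (Word u) c * s * mon v \<in> fa_ideal R"

lemma fa_ideal_add: "r \<in> fa_ideal R \<Longrightarrow> p \<in> fa_ideal R \<Longrightarrow> p + r \<in> fa_ideal R"
  by (induction r rule: fa_ideal.induct) (auto simp: add.assoc[symmetric] intro: fa_ideal.intros)

lemma fa_ideal_single_mult: "p \<in> fa_ideal R \<Longrightarrow> Poly_Mapping.single (Word w) d * p \<in> fa_ideal R"
proof (induction p rule: fa_ideal.induct)
  case (step p s u c v)
  have "Poly_Mapping.single (Word w) d * (p + Poly_Mapping.single (Word u) c * s * mon v) =
    Poly_Mapping.single (Word w) d * p + Poly_Mapping.single (Word (w @ u)) (d * c) * s * mon v"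
    by (simp add: distrib_left mult_single Word_add flip: mult.assoc)
  then show ?case using step by (simp add: fa_ideal.step)
qed (simp add: fa_ideal.zero)

lemma fa_ideal_mult_single: "p \<in> fa_ideal R \<Longrightarrow> p * Poly_Mapping.single (Word w) d \<in> fa_ideal R"
proof (induction p rule: fa_ideal.induct)
  case (step p s u c v)
  have "mon v * Poly_Mapping.single (Word w) d = fa_const d * mon (v @ w)"
    by (simp add: mult_single Word_add fa_const_mult_single)
  then have "(p + Poly_Mapping.single (Word u) c * s * mon v) * Poly_Mapping.single (Word w) d =
    p * Poly_Mapping.single (Word w) d + (Poly_Mapping.single (Word u) c * fa_const d) * s * mon (v @ w)"
    by (simp add: distrib_right mult.assoc fa_const_left fa_const_commute[of "Poly_Mapping.single _ _"])
  then show ?case using step by (simp add: fa_ideal.step single_mult_fa_const)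
qed (simp add: fa_ideal.zero)

lemma two_sided_fa_ideal: "two_sided (fa_ideal R)"
  unfolding two_sided_def
proof (intro conjI ballI allI)
  fix p r assume p: "p \<in> fa_ideal R"
  show "r * p \<in> fa_ideal R"
    by (induction r rule: fa_single_induct) (auto simp: distrib_right p intro: fa_ideal_single_mult fa_ideal_add)
  show "p * r \<in> fa_ideal R"
    by (induction r rule: fa_single_induct) (auto simp: distrib_left p intro: fa_ideal_mult_single fa_ideal_add)
qed (auto intro: fa_ideal.zero fa_ideal_add)

lemma fa_ideal_gen: "s \<in> R \<Longrightarrow> s \<in> fa_ideal R"
  using fa_ideal.step[OF fa_ideal.zero, of s R "[]" 1 "[]"] by (simp add: Word_Nil)

lemma fa_ideal_minimal:
  assumes "two_sided J" "R \<subseteq> J" shows "fa_ideal R \<subseteq> J"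
proof
  fix x assume "x \<in> fa_ideal R"
  then show "x \<in> J"
    by (induction rule: fa_ideal.induct) (use assms in \<open>auto intro: two_sidedD(1-4)[OF assms(1)]\<close>)
qed

section \<open>Quantum binomial coefficients\<close>

text \<open>The unnormalised quantum integer 1 + P^2 + ... + P^(2n-2): the factor that a skew
  derivation produces on an n-th power, see \<open>skew_power\<close>.\<close>

definition alpha :: "'k::field \<Rightarrow> nat \<Rightarrow> 'k" where
  "alpha P n = (\<Sum>t<n. P ^ (2 * t))"

lemma alpha_0 [simp]: "alpha P 0 = 0"
  by (simp add: alpha_def)

lemma alpha_Suc': "alpha P (Suc n) = alpha P n + P ^ (2 * n)"
  by (simp add: alpha_def)

locale q_generic =
  fixes p :: "'k::field"
  assumes p0: "p \<noteq> 0" and p_power: "\<And>n::nat. n > 0 \<Longrightarrow> p ^ n \<noteq> 1"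
begin

lemma p_diff: "p - inverse p \<noteq> 0"
proof
  assume "p - inverse p = 0"
  then have "p ^ 2 = 1" using p0 by (simp add: power2_eq_square field_simps)
  then show False using p_power[of 2] by simp
qed

lemma p_powi_ne_1: "n \<noteq> 0 \<Longrightarrow> p powi n \<noteq> 1"
proof (cases "n > 0")
  case True
  then show ?thesis using p_power[of "nat n"] by (simp add: power_int_def)
next
  case False
  assume "n \<noteq> 0"
  then show ?thesis using False p_power[of "nat (- n)"]
    by (auto simp: power_int_def power_inverse)
qed

lemma p_powi_inj: "p powi m = p powi n \<Longrightarrow> m = n"
proof (rule ccontr)
  assume e: "p powi m = p powi n" and "m \<noteq> n"
  then have "p powi (m - n) = 1" using p0 by (simp add: power_int_diff)
  then show False using p_powi_ne_1[of "m - n"] \<open>m \<noteq> n\<close> by simp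
qed

lemma qint_nonzero: "n \<noteq> 0 \<Longrightarrow> qint p n \<noteq> 0"
  using p_powi_inj[of n "- n"] p_diff by (auto simp: qint_def)

lemma qint_inverse: "qint (inverse p) n = qint p n"
proof -
  have "qint (inverse p) n = (p powi (- n) - p powi n) / (inverse p - p)"
    by (simp add: qint_def power_int_inverse power_int_minus)
  also have "\<dots> = qint p n"
    unfolding qint_def by (metis minus_diff_eq minus_divide_divide)
  finally show ?thesis .
qed

lemma q_generic_inverse: "q_generic (inverse p)"
proof
  show "inverse p ^ n \<noteq> 1" if "n > 0" for n
    using p_power[OF that] p0 by (metis inverse_1 inverse_inverse_eq power_inverse)
qed (simp add: p0)

lemma qint_0 [simp]: "qint p 0 = 0"
  by (simp add: qint_def)

lemma qint_1 [simp]: "qint p 1 = 1"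
  using p_diff by (simp add: qint_def)

lemma qbinomial_0 [simp]: "qbinomial p a 0 = 1"
  by (simp add: qbinomial_def)

lemma qbinomial_Suc: "qbinomial p a (Suc n) = qbinomial p a n * qint p (a - int n) / qint p (int n + 1)"
  by (simp add: qbinomial_def add.commute)

lemma qbinomial_Suc': "qbinomial p a (Suc n) = qbinomial p (a - 1) n * qint p a / qint p (int n + 1)"
  by (simp add: qbinomial_def prod.lessThan_Suc_shift algebra_simps del: prod.lessThan_Suc)

text \<open>After multiplication by P - 1/P both sides become the difference of the same two powers.
  Both \<open>p\<close> and its inverse are allowed because \<open>opE\<close> is a difference of
  two skew derivations, one for each.\<close>

lemma alpha_qint:
  assumes P: "P \<in> {p, inverse p}"
  shows "alpha P n = P powi (int n - 1) * qint p (int n)"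
proof -
  interpret P: q_generic P
    using P q_generic_inverse q_generic_axioms by auto
  have "qint p (int n) = qint P (int n)"
    using P qint_inverse by auto
  moreover have "P powi (int n - 1) * qint P (int n) * (P - inverse P) = P powi (2 * int n - 1) - P powi (-1)"
  proof -
    have "qint P (int n) * (P - inverse P) = P powi int n - P powi (- int n)"
      using P.p_diff by (simp add: qint_def)
    then have "P powi (int n - 1) * qint P (int n) * (P - inverse P) =
        P powi (int n - 1) * (P powi int n - P powi (- int n))"
      by (simp only: mult.assoc)
    then show ?thesis
      using P.p0 by (simp add: right_diff_distrib [of "P powi _"] power_int_add [symmetric] del: power_int_of_nat)
  qed
  moreover have "alpha P n * (P - inverse P) = P powi (2 * int n - 1) - P powi (-1)"
  proof (induction n)
    case (Suc n)
    have "P ^ (2 * n) * (P - inverse P) = P powi (2 * int n + 1) - P powi (2 * int n - 1)"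
      using P.p0 by (simp add: right_diff_distrib power_int_add power_int_diff power_int_mult power_mult divide_inverse)
    then show ?case using Suc by (simp add: alpha_Suc' distrib_right add.commute)
  qed simp
  ultimately show ?thesis using P.p_diff by (metis mult_right_cancel)
qed

lemma alpha_nonzero: "P \<in> {p, inverse p} \<Longrightarrow> n > 0 \<Longrightarrow> alpha P n \<noteq> 0"
  using p0 by (auto simp: alpha_qint qint_nonzero)

definition sc :: "nat \<Rightarrow> nat \<Rightarrow> 'k" where
  "sc N s = (-1) ^ s * qbinomial p (int N) s"

lemma sc_0 [simp]: "sc N 0 = 1"
  by (simp add: sc_def)

text \<open>Consecutive Serre coefficients have the ratio -[N - s]/[s + 1], which the quantum
  integers inside \<open>alpha\<close> undo.\<close>

lemma sc_alpha:
  assumes P: "P \<in> {p, inverse p}" and s: "s < N"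
  shows "sc N s * alpha P (N - s) * P powi (1 - int N + 2 * int s) + sc N (Suc s) * alpha P (Suc s) = 0"
proof -
  have P0: "P \<noteq> 0" using P p0 by auto
  have "sc N (Suc s) = - sc N s * qint p (int N - int s) / qint p (int s + 1)"
    by (simp add: sc_def qbinomial_Suc)
  moreover have "qint p (int s + 1) \<noteq> 0" by (rule qint_nonzero) simp
  moreover have "alpha P (Suc s) = P powi (int s) * qint p (int s + 1)"
    using alpha_qint[OF P, of "Suc s"] by (simp add: add.commute)
  moreover have "alpha P (N - s) * P powi (1 - int N + 2 * int s) = P powi (int s) * qint p (int N - int s)"
  proof -
    have "P powi (int (N - s) - 1) * P powi (1 - int N + 2 * int s) = P powi int s"
      using s P0 by (simp add: of_nat_diff power_int_add [symmetric] del: power_int_of_nat)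
    then show ?thesis using s by (simp add: alpha_qint[OF P] of_nat_diff mult.commute mult.left_commute)
  qed
  ultimately show ?thesis by (simp add: mult.assoc)
qed

lemma qint_split:
  assumes P: "P \<in> {p, inverse p}"
  shows "qint p (m + n) = P powi n * qint p m + P powi (- m) * qint p n"
proof -
  interpret P: q_generic P
    using P q_generic_inverse q_generic_axioms by auto
  have "qint p k = qint P k" for k
    using P qint_inverse by auto
  moreover have "qint P (m + n) = P powi n * qint P m + P powi (- m) * qint P n"
    using P.p0 by (simp add: qint_def right_diff_distrib power_int_add [symmetric]
        add_divide_distrib [symmetric] add.commute)
  ultimately show ?thesis by metis
qed

text \<open>The partial sums up to m have a closed form with the factor
  \<open>qbinomial p (int N - 1) m\<close>, which vanishes at m = N.\<close>

lemma sc_sum: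
  assumes P: "P \<in> {p, inverse p}" and N: "N > 0"
  shows "(\<Sum>s=0..N. sc N s * P powi ((1 - int N) * int s)) = 0"
proof -
  have P0: "P \<noteq> 0" using P p0 by auto
  have "(\<Sum>s=0..m. sc N s * P powi ((1 - int N) * int s)) =
      (-1) ^ m * P powi (- int m * int N) * qbinomial p (int N - 1) m" for m
  proof (induction m)
    case (Suc m)
    have nz: "qint p (int m + 1) \<noteq> 0" by (rule qint_nonzero) simp
    \<comment> \<open>The quantum Pascal rule: of the two parts of [N], the first cancels the
      previous partial sum and the second yields the next one.\<close>
    have sp: "qint p (int N) = P powi (int N - 1 - int m) * qint p (int m + 1) +
        P powi (- (int m + 1)) * qint p (int N - 1 - int m)"
      using qint_split[OF P, of "int m + 1" "int N - 1 - int m"] by simp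
    let ?b = "qbinomial p (int N - 1) m"
    have 1: "sc N (Suc m) * P powi ((1 - int N) * int (Suc m)) =
       - ((-1) ^ m) * ?b * (P powi (- int m * int N) +
         P powi (- int (Suc m) * int N) * qint p (int N - 1 - int m) / qint p (int m + 1))"
    proof -
      have e1: "P powi (int N - 1 - int m) * P powi ((1 - int N) * int (Suc m)) = P powi (- int m * int N)"
        using P0 by (simp add: power_int_add [symmetric] algebra_simps)
      have e2: "P powi (- (int m + 1)) * P powi ((1 - int N) * int (Suc m)) = P powi (- int (Suc m) * int N)"
        using P0 by (simp add: power_int_add [symmetric] algebra_simps)
      have "sc N (Suc m) = - ((-1) ^ m) * ?b * qint p (int N) / qint p (int m + 1)"
        by (simp add: sc_def qbinomial_Suc')
      then have "sc N (Suc m) * P powi ((1 - int N) * int (Suc m)) * qint p (int m + 1) =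
        - ((-1) ^ m) * ?b * (qint p (int N) * P powi ((1 - int N) * int (Suc m)))"
        using nz by simp
      also have "qint p (int N) * P powi ((1 - int N) * int (Suc m)) =
        P powi (- int m * int N) * qint p (int m + 1) + P powi (- int (Suc m) * int N) * qint p (int N - 1 - int m)"
        unfolding sp distrib_right e1[symmetric] e2[symmetric] by (simp only: mult_ac)
      finally have "sc N (Suc m) * P powi ((1 - int N) * int (Suc m)) = - ((-1) ^ m) * ?b *
        (P powi (- int m * int N) * qint p (int m + 1) + P powi (- int (Suc m) * int N) * qint p (int N - 1 - int m)) / qint p (int m + 1)"
        using nz by (subst nonzero_eq_divide_eq)
      then show ?thesis using nz by (simp only: add_divide_distrib distrib_left times_divide_eq_right nonzero_mult_div_cancel_right) (simp add: mult.assoc)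
    qed
    have 2: "qbinomial p (int N - 1) (Suc m) = ?b * qint p (int N - 1 - int m) / qint p (int m + 1)"
      by (rule qbinomial_Suc)
    have "(\<Sum>s=0..Suc m. sc N s * P powi ((1 - int N) * int s)) =
      (-1) ^ m * P powi (- int m * int N) * ?b + sc N (Suc m) * P powi ((1 - int N) * int (Suc m))"
      using Suc by simp
    also have "\<dots> = (-1) ^ Suc m * P powi (- int (Suc m) * int N) * qbinomial p (int N - 1) (Suc m)"
      unfolding 1 2 by (simp add: algebra_simps)
    finally show ?case .
  qed simp
  moreover have "qbinomial p (int N - 1) N = 0"
    using N qbinomial_Suc[of "int N - 1" "N - 1"] by (simp add: of_nat_diff)
  ultimately show ?thesis by simp
qed

definition serre_poly :: "nat \<Rightarrow> ('b, 'k) free_algebra \<Rightarrow> ('b, 'k) free_algebra \<Rightarrow> ('b, 'k) free_algebra" where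
  "serre_poly N u v = (\<Sum>s=0..N. fa_const (sc N s) * u ^ (N - s) * v * u ^ s)"

text \<open>The common telescoping argument behind the compatibility of Serre elements with
  skew derivations: \<open>W m n\<close> stands for the word with \<open>m\<close> and \<open>n\<close> letters
  on either side of the middle letter.\<close>

lemma serre_telescope:
  fixes W :: "nat \<Rightarrow> nat \<Rightarrow> ('b, 'k) free_algebra"
  assumes P: "P \<in> {p, inverse p}"
  shows "(\<Sum>s=0..N. fa_const (sc N s) * (fa_const (alpha P (N - s) * P powi (1 - int N + 2 * int s)) * W (N - s - 1) s
           + fa_const (alpha P s) * W (N - s) (s - 1))) = 0"
proof -
  let ?f = "\<lambda>s. fa_const (sc N s * alpha P (N - s) * P powi (1 - int N + 2 * int s)) * W (N - s - 1) s"
  let ?g = "\<lambda>s. fa_const (sc N s * alpha P s) * W (N - s) (s - 1)"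
  have "(\<Sum>s=0..N. fa_const (sc N s) * (fa_const (alpha P (N - s) * P powi (1 - int N + 2 * int s)) * W (N - s - 1) s
           + fa_const (alpha P s) * W (N - s) (s - 1))) = sum ?f {0..N} + sum ?g {0..N}"
    by (simp add: distrib_left fa_const_mult mult.assoc sum.distrib)
  also have "sum ?f {0..N} = sum ?f {0..<N}"
    by (simp add: sum.last_plus)
  also have "sum ?g {0..N} = (\<Sum>s=0..<N. ?g (Suc s))"
    by (simp add: sum.atLeast0_atMost_Suc_shift atLeast0AtMost sum.atMost_shift atLeast0LessThan)
  also have "sum ?f {0..<N} + (\<Sum>s=0..<N. ?g (Suc s)) =
    (\<Sum>s=0..<N. fa_const (sc N s * alpha P (N - s) * P powi (1 - int N + 2 * int s) + sc N (Suc s) * alpha P (Suc s)) * W (N - s - 1) s)"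
    unfolding sum.distrib [symmetric]
  proof (rule sum.cong)
    fix s
    have "N - Suc s = N - s - 1" by simp
    then show "?f s + ?g (Suc s) = fa_const (sc N s * alpha P (N - s) * P powi (1 - int N + 2 * int s) + sc N (Suc s) * alpha P (Suc s)) * W (N - s - 1) s"
      by (simp only: fa_const_add distrib_right diff_Suc_1)
  qed simp
  also have "\<dots> = 0"
    by (intro sum.neutral) (simp add: sc_alpha[OF P])
  finally show ?thesis .
qed

end

section \<open>Skew derivations of the free algebra\<close>

definition fa_scale :: "('i \<Rightarrow> 'k) \<Rightarrow> ('i, 'k::field) free_algebra \<Rightarrow> ('i, 'k) free_algebra" where
  "fa_scale \<chi> = fa_hom (\<lambda>j. fa_const (\<chi> j) * fa_gen j)"

lemma fa_linear_scale: "fa_linear (fa_scale \<chi>)"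
  by (simp add: fa_scale_def fa_linear_hom)

lemmas fa_scale_linear = fa_linearD[OF fa_linear_scale]

lemma fa_scale_simps [simp]:
  "fa_scale \<chi> (fa_const c) = fa_const c" "fa_scale \<chi> 1 = 1"
  "fa_scale \<chi> (fa_gen j) = fa_const (\<chi> j) * fa_gen j"
  "fa_scale \<chi> (p * r) = fa_scale \<chi> p * fa_scale \<chi> r"
  by (simp_all add: fa_scale_def)

lemma fa_scale_power: "fa_scale \<chi> (fa_gen j ^ n) = fa_const (\<chi> j ^ n) * fa_gen j ^ n"
proof (induction n)
  case (Suc n)
  have "fa_scale \<chi> (fa_gen j ^ Suc n) = fa_const (\<chi> j) * (fa_gen j * fa_const (\<chi> j ^ n)) * fa_gen j ^ n"
    by (simp add: Suc mult.assoc)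
  also have "fa_gen j * fa_const (\<chi> j ^ n) = fa_const (\<chi> j ^ n) * fa_gen j" by (rule fa_const_commute)
  finally show ?case by (simp add: fa_const_mult mult.assoc)
qed simp

lemma fa_scale_commute: "fa_scale \<chi> (fa_scale \<psi> p) = fa_scale \<psi> (fa_scale \<chi> p)"
  unfolding fa_scale_def fa_hom_comp
  by (simp add: fa_const_pull fa_hom_linear mult.commute)

lemma fa_scale_inverse:
  assumes "\<And>j. \<chi> j * \<psi> j = 1" shows "fa_scale \<chi> (fa_scale \<psi> p) = p"
proof -
  have "fa_scale \<chi> (fa_scale \<psi> p) = fa_hom (\<lambda>j. fa_const (\<psi> j) * (fa_const (\<chi> j) * fa_gen j)) p"
    unfolding fa_scale_def fa_hom_comp by (simp add: fa_hom_linear)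
  also have "\<dots> = fa_hom fa_gen p"
    using assms by (simp flip: mult.assoc fa_const_mult add: mult.commute)
  finally show ?thesis by (simp add: fa_hom_gen_id)
qed

text \<open>Deletes each letter i in turn and rescales the letters to its right. For the characters
  \<open>chi\<close> these are skew derivations of the kind used by Kashiwara and Lusztig to
  describe the action of E_i.\<close>

primrec skew_word :: "'i \<Rightarrow> ('i \<Rightarrow> 'k) \<Rightarrow> 'i list \<Rightarrow> ('i, 'k::field) free_algebra" where
  "skew_word i \<chi> [] = 0"
| "skew_word i \<chi> (j # w) = fa_gen j * skew_word i \<chi> w + (if j = i then fa_scale \<chi> (mon w) else 0)"

definition skew :: "'i \<Rightarrow> ('i \<Rightarrow> 'k) \<Rightarrow> ('i, 'k::field) free_algebra \<Rightarrow> ('i, 'k) free_algebra" where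
  "skew i \<chi> = fa_extend (\<lambda>w. skew_word i \<chi> (letters w))"

lemma fa_linear_skew: "fa_linear (skew i \<chi>)"
  by (simp add: skew_def fa_linear_extend)

lemmas skew_linear = fa_linearD[OF fa_linear_skew]

lemma skew_const [simp]: "skew i \<chi> (fa_const c) = 0" "skew i \<chi> 1 = 0"
proof -
  show "skew i \<chi> (fa_const c) = 0" for c
    by (simp add: skew_def flip: single_Word_Nil)
  from this[of 1] show "skew i \<chi> 1 = 0" by simp
qed

lemma skew_gen_mult:
  "skew i \<chi> (fa_gen j * p) = fa_gen j * skew i \<chi> p + (if j = i then fa_scale \<chi> p else 0)"
proof (induction p rule: fa_single_induct)
  case (single w c)
  have e: "Poly_Mapping.single (Word w) c = fa_const c * mon w" by (simp add: fa_const_mult_single)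
  show ?case
    by (simp add: fa_gen_mult_single skew_def distrib_left fa_const_left)
      (simp add: e fa_scale_linear)
qed (simp add: distrib_left skew_linear fa_scale_linear)

lemma skew_gen: "skew i \<chi> (fa_gen j) = (if j = i then 1 else 0)"
  using skew_gen_mult[of i \<chi> j 1] by simp

lemma skew_mult: "skew i \<chi> (p * r) = skew i \<chi> p * fa_scale \<chi> r + p * skew i \<chi> r"
  by (induction p rule: fa_left_induct)
    (simp_all add: skew_linear distrib_right distrib_left skew_gen_mult mult.assoc)

lemma fa_scale_skew:
  "skew i \<psi> (fa_scale \<chi> p) = fa_const (\<chi> i) * fa_scale \<chi> (skew i \<psi> p)"
proof (induction p rule: fa_left_induct)
  case (gen j p)
  then show ?case
    by (simp add: skew_linear fa_scale_linear skew_gen_mult mult.assoc distrib_left fa_const_pull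
        fa_scale_commute[of \<chi> \<psi>] mult.commute)
qed (simp_all add: skew_linear fa_scale_linear distrib_left)

lemma fa_extend_deglt:
  assumes "deglt m p" "\<And>w. length w < m \<Longrightarrow> deglt n (h (Word w))"
  shows "deglt n (fa_extend h p)"
  unfolding fa_extend_def
proof (rule deglt_sum)
  fix w assume "w \<in> Poly_Mapping.keys p"
  then have "deglt n (h w)" using assms by (metis deglt_def word.collapse)
  then show "deglt n (fa_const (poly_mapping.lookup p w) * h w)" by (rule deglt_const_mult)
qed

lemma fa_scale_mon: "\<exists>c. fa_scale \<chi> (mon w) = Poly_Mapping.single (Word w) c"
proof (induction w)
  case (Cons x w)
  then obtain c where "fa_scale \<chi> (mon w) = Poly_Mapping.single (Word w) c" by blast
  then have "fa_scale \<chi> (fa_gen x * mon w) = Poly_Mapping.single (Word (x # w)) (\<chi> x * c)"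
    by (simp add: mult.assoc fa_gen_mult_single[of x w c] fa_const_mult_single)
  then have "fa_scale \<chi> (mon (x # w)) = Poly_Mapping.single (Word (x # w)) (\<chi> x * c)"
    by (simp only: fa_gen_mult_single)
  then show ?case by blast
next
  case Nil
  have "fa_scale \<chi> (mon []) = Poly_Mapping.single (Word []) 1" by (simp add: single_Word_Nil)
  then show ?case by blast
qed

lemma deglt_mon: "length w < n \<Longrightarrow> deglt n (Poly_Mapping.single (Word w) c)"
  by (simp add: deglt_def)

lemma deglt_fa_scale:
  assumes "deglt n p" shows "deglt n (fa_scale \<chi> p)"
proof -
  have "fa_scale \<chi> p = fa_extend (\<lambda>w. fa_scale \<chi> (Poly_Mapping.single w 1)) p"
    by (rule fa_linear_eq[OF fa_linear_scale fa_linear_extend]) simp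
  moreover have "deglt n (fa_extend (\<lambda>w. fa_scale \<chi> (Poly_Mapping.single w 1)) p)"
    by (rule fa_extend_deglt[OF assms]) (metis fa_scale_mon deglt_mon)
  ultimately show ?thesis by simp
qed

lemma deglt_skew_word: "length w < Suc n \<Longrightarrow> deglt n (skew_word i \<chi> w)"
proof (induction w arbitrary: n)
  case (Cons j w)
  then obtain m where m: "n = Suc m" "length w < Suc m" by (cases n) auto
  have "deglt n (fa_scale \<chi> (mon w))"
    using m deglt_mon deglt_fa_scale by blast
  then show ?case
    using Cons.IH[OF m(2)] m(1) by (auto intro!: deglt_add deglt_gen_mult)
qed simp

lemma deglt_skew: "deglt (Suc n) p \<Longrightarrow> deglt n (skew i \<chi> p)"
  unfolding skew_def by (erule fa_extend_deglt) (simp add: deglt_skew_word)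

section \<open>A Verma module\<close>

text \<open>\<open>a\<close> is the Cartan matrix and \<open>d i\<close> half the squared length of
  the i-th simple root, which makes \<open>qi i\<close> below the parameter q_i.\<close>

locale cartan_datum =
  fixes a :: "'i \<Rightarrow> 'i \<Rightarrow> int" and d :: "'i \<Rightarrow> int" and q :: "'k::field"
  assumes q0: "q \<noteq> 0" and q_power: "\<And>n::nat. n > 0 \<Longrightarrow> q ^ n \<noteq> 1"
    and d_pos: "d i > 0" and a_diag: "a i i = 2"
    and a_range: "i \<noteq> j \<Longrightarrow> a i j \<in> {0, -1, -2, -3}"
    and a_sym: "d i * a i j = d j * a j i"
begin

definition qi :: "'i \<Rightarrow> 'k" where "qi i = q powi d i"

definition ip :: "'i \<Rightarrow> 'i \<Rightarrow> int" where "ip i j = d i * a i j"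

lemma ip_sym: "ip i j = ip j i"
  by (simp add: ip_def a_sym)

sublocale q_generic q
  by standard (fact q0 q_power)+

lemma qi_generic: "q_generic (qi i)"
proof
  show "qi i \<noteq> 0" using q0 by (simp add: qi_def)
  show "qi i ^ n \<noteq> 1" if "n > 0" for n
  proof -
    have "qi i ^ n = q powi (d i * int n)"
      by (simp add: qi_def power_int_mult)
    then show ?thesis using p_powi_ne_1[of "d i * int n"] d_pos[of i] that by simp
  qed
qed

lemma qi_ip: "q powi (ip i j) = qi i powi (a i j)"
  by (simp add: qi_def ip_def power_int_mult)

definition chi :: "int \<Rightarrow> 'i \<Rightarrow> 'i \<Rightarrow> 'k" where
  "chi e i j = q powi (e * ip i j)"

definition N :: "'i \<Rightarrow> 'i \<Rightarrow> nat" where "N i j = nat (1 - a i j)"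

lemma int_N: "i \<noteq> j \<Longrightarrow> int (N i j) = 1 - a i j" and N_pos: "i \<noteq> j \<Longrightarrow> N i j > 0"
  using a_range[of i j] by (auto simp: N_def)

definition serre_rel :: "'i \<Rightarrow> 'i \<Rightarrow> ('i, 'k) free_algebra" where
  "serre_rel i j = q_generic.serre_poly (qi i) (N i j) (fa_gen i) (fa_gen j)"

definition serre_ideal :: "('i, 'k) free_algebra set" where
  "serre_ideal = fa_ideal {serre_rel i j |i j. i \<noteq> j}"

lemma two_sided_serre: "two_sided serre_ideal"
  by (simp add: serre_ideal_def two_sided_fa_ideal)

lemmas serre_idealI = two_sidedD[OF two_sided_serre]

lemma serre_rel_in: "i \<noteq> j \<Longrightarrow> serre_rel i j \<in> serre_ideal"
  unfolding serre_ideal_def by (rule fa_ideal_gen) blast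

lemma serre_sandwich:
  assumes "i \<noteq> j"
  shows "x * serre_rel i j * y \<in> serre_ideal" "x * (fa_const c * serre_rel i j * y) \<in> serre_ideal"
    "x * (fa_const c * serre_rel i j) * y \<in> serre_ideal"
proof -
  show 1: "x * serre_rel i j * y \<in> serre_ideal" for x
    by (intro serre_idealI(4) serre_idealI(3) serre_rel_in assms)
  show "x * (fa_const c * serre_rel i j * y) \<in> serre_ideal"
    "x * (fa_const c * serre_rel i j) * y \<in> serre_ideal"
    using 1[of "x * fa_const c"] by (simp_all add: mult.assoc)
qed

lemma serre_induct [consumes 1, case_names zero step]:
  assumes "x \<in> serre_ideal" "P 0"
    "\<And>p i j u c v. p \<in> serre_ideal \<Longrightarrow> P p \<Longrightarrow> i \<noteq> j \<Longrightarrow>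
       P (p + Poly_Mapping.single (Word u) c * serre_rel i j * mon v)"
  shows "P x"
  using assms(1) unfolding serre_ideal_def
  by (induction rule: fa_ideal.induct) (auto simp: assms(2) intro!: assms(3) simp flip: serre_ideal_def)

lemma fa_scale_serre_rel:
  "fa_scale \<chi> (serre_rel i j) = fa_const (\<chi> i ^ N i j * \<chi> j) * serre_rel i j"
proof -
  interpret q: q_generic "qi i" by (rule qi_generic)
  have "fa_scale \<chi> (fa_const c * fa_gen i ^ m * fa_gen j * fa_gen i ^ n) =
    fa_const (\<chi> i ^ (m + n) * \<chi> j) * (fa_const c * fa_gen i ^ m * fa_gen j * fa_gen i ^ n)" for c m n
    by (simp add: fa_scale_power fa_const_pull mult.assoc power_add mult_ac)
  then show ?thesis
    by (simp add: serre_rel_def q.serre_poly_def fa_linear_sum[OF fa_linear_scale] sum_distrib_left)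
qed

lemma fa_scale_serre: "s \<in> serre_ideal \<Longrightarrow> fa_scale \<chi> s \<in> serre_ideal"
proof (induction rule: serre_induct)
  case (step p i j u c v)
  then show ?case
    by (simp add: fa_scale_linear fa_scale_serre_rel serre_idealI(2) serre_sandwich)
qed (simp add: fa_scale_linear serre_idealI)

lemma skew_power:
  assumes "\<chi> j = P ^ 2"
  shows "skew j \<chi> (fa_gen j ^ n) = fa_const (alpha P n) * fa_gen j ^ (n - 1)"
proof (induction n)
  case (Suc n)
  have "skew j \<chi> (fa_gen j ^ Suc n) = fa_const (alpha P n) * (fa_gen j * fa_gen j ^ (n - 1)) + fa_const (P ^ (2 * n)) * fa_gen j ^ n"
    by (simp add: skew_gen_mult Suc fa_scale_power assms fa_const_pull power_mult)
  then show ?case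
    by (cases n) (simp_all add: alpha_Suc' fa_const_add distrib_right)
qed simp

lemma chi_diag: "chi e i i = (qi i powi e) ^ 2" "chi e i j = (qi i powi e) powi a i j"
    "chi e j i = (qi i powi e) powi a i j"
proof -
  have e: "e * (d i * m) = d i * e * m" for m by simp
  show 1: "chi e i j = (qi i powi e) powi a i j" for j
    by (simp only: chi_def ip_def qi_def power_int_mult[symmetric] e)
  show "chi e j i = (qi i powi e) powi a i j"
    using 1[of j] by (simp add: chi_def ip_sym)
  show "chi e i i = (qi i powi e) ^ 2"
    using 1[of i] by (simp add: a_diag)
qed

lemma pm_in: "e \<in> {1, -1::int} \<Longrightarrow> qi i powi e \<in> {qi i, inverse (qi i)}"
  by (auto simp: power_int_minus)

text \<open>If i is the repeated letter, the terms telescope; if i is the middle letter, a power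
  times the sum in \<open>sc_sum\<close> remains; otherwise there is no letter to delete.\<close>

lemma skew_serre_rel:
  assumes e: "e \<in> {1, -1}" and "j \<noteq> k"
  shows "skew i (chi e i) (serre_rel j k) = 0"
proof -
  interpret q: q_generic "qi j" by (rule qi_generic)
  let ?N = "N j k"
  consider "i = j" | "i = k" | "i \<noteq> j" "i \<noteq> k" by blast
  then show ?thesis
  proof cases
    case 1
    define P where "P = qi j powi e"
    have P: "P \<in> {qi j, inverse (qi j)}" "chi e j j = P ^ 2" "\<And>k. chi e j k = P powi (a j k)"
      using pm_in[OF e] by (auto simp: P_def chi_diag)
    have P0: "P \<noteq> 0" using P q.p0 by auto
    have w: "skew j (chi e j) (fa_const c * fa_gen j ^ m * fa_gen k * fa_gen j ^ n) =
      fa_const c * (fa_const (alpha P m * P powi (a j k + 2 * int n)) * (fa_gen j ^ (m - 1) * fa_gen k * fa_gen j ^ n)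
        + fa_const (alpha P n) * (fa_gen j ^ m * fa_gen k * fa_gen j ^ (n - 1)))" for c m n
    proof -
      have "P powi (a j k + 2 * int n) = P powi a j k * (P ^ 2) ^ n"
        using P0 by (simp add: power_int_add power_int_mult)
      then show ?thesis using assms(2)
        by (simp add: skew_mult skew_power[of "chi e j" j P] P(2) skew_gen P(3)[of k] fa_scale_power fa_const_pull
          mult.assoc distrib_left; simp only: ac_simps)
    qed
    have "skew j (chi e j) (serre_rel j k) = (\<Sum>s=0..?N. fa_const (q.sc ?N s) * (fa_const (alpha P (?N - s) * P powi (1 - int ?N + 2 * int s)) *
        (fa_gen j ^ (?N - s - 1) * fa_gen k * fa_gen j ^ s) + fa_const (alpha P s) * (fa_gen j ^ (?N - s) * fa_gen k * fa_gen j ^ (s - 1))))"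
      using int_N[OF assms(2)] by (simp add: serre_rel_def q.serre_poly_def fa_linear_sum[OF fa_linear_skew] w)
    also have "\<dots> = 0"
      by (rule q.serre_telescope[OF P(1)])
    finally show ?thesis using 1 by simp
  next
    case 2
    define P where "P = qi j powi e"
    have P: "P \<in> {qi j, inverse (qi j)}" "chi e k j = P powi (a j k)"
      using pm_in[OF e] by (auto simp: P_def chi_diag(3)[of e k j])
    have P0: "P \<noteq> 0" using P q.p0 by auto
    have z: "skew k (chi e k) (fa_gen j ^ n) = 0" for n
      using assms(2) by (induction n) (simp_all add: skew_gen_mult)
    have w: "skew k (chi e k) (fa_const c * fa_gen j ^ m * fa_gen k * fa_gen j ^ n) =
      fa_const (c * P powi (a j k * int n)) * fa_gen j ^ (m + n)" for c m n
      using assms(2) by (simp add: skew_mult z skew_gen fa_scale_power fa_const_pull P(2) power_add power_int_mult mult.assoc)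
    have "skew k (chi e k) (serre_rel j k) = (\<Sum>s=0..?N. fa_const (q.sc ?N s * P powi ((1 - int ?N) * int s)) * fa_gen j ^ ?N)"
      using int_N[OF assms(2)] by (simp add: serre_rel_def q.serre_poly_def fa_linear_sum[OF fa_linear_skew] w)
    also have "\<dots> = fa_const (\<Sum>s=0..?N. q.sc ?N s * P powi ((1 - int ?N) * int s)) * fa_gen j ^ ?N"
      by (simp add: sum_distrib_right fa_const_sum)
    also have "\<dots> = 0" using q.sc_sum[OF P(1) N_pos[OF assms(2)]] by simp
    finally show ?thesis using 2 by simp
  next
    case 3
    have "skew i (chi e i) (fa_gen j ^ n) = 0" for n
      using 3 by (induction n) (simp_all add: skew_gen_mult)
    then show ?thesis using 3
      by (simp add: serre_rel_def q.serre_poly_def fa_linear_sum[OF fa_linear_skew] skew_mult skew_gen)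
  qed
qed

lemma skew_serre:
  assumes "e \<in> {1, -1}" "s \<in> serre_ideal"
  shows "skew i (chi e i) s \<in> serre_ideal"
  using assms(2)
proof (induction rule: serre_induct)
  case (step p j k u c v)
  then show ?case using assms(1)
    by (simp add: skew_linear skew_mult skew_serre_rel fa_scale_serre_rel distrib_right
        serre_idealI(2) serre_sandwich)
qed (simp add: skew_linear serre_idealI)

end

context cartan_datum
begin

lemma chi_inverse: "chi 1 i j * chi (-1) i j = 1" "chi (-1) i j * chi 1 i j = 1"
  using q0 by (simp_all add: chi_def power_int_minus)

definition hh :: "'i \<Rightarrow> 'k" where "hh i = 1 / (qi i - inverse (qi i))"

text \<open>The operators \<open>E\<^sub>i\<close> on the Verma module of highest weight zero, realised on
  the free algebra generated by the \<open>F\<^sub>j\<close>.\<close>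

definition opE :: "'i \<Rightarrow> ('i, 'k) free_algebra \<Rightarrow> ('i, 'k) free_algebra" where
  "opE i u = fa_const (hh i) * (skew i (chi (-1) i) u - skew i (chi 1 i) u)"

text \<open>For e = -1 and e = 1 these are the two summands of (K_i - K_i^-1)/(q_i - q_i^-1), where
  K_i acts as \<open>fa_scale (chi (-1) i)\<close>.\<close>

definition opA :: "'i \<Rightarrow> int \<Rightarrow> ('i, 'k) free_algebra \<Rightarrow> ('i, 'k) free_algebra" where
  "opA i e u = fa_const (- of_int e * hh i) * fa_scale (chi e i) u"

lemma fa_linear_opE: "fa_linear (opE i)"
  unfolding fa_linear_def opE_def
  by (simp add: skew_linear distrib_left right_diff_distrib fa_const_pull mult.commute)

lemmas opE_linear = fa_linearD[OF fa_linear_opE]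

lemma opE_const: "opE i (fa_const c) = 0"
  by (simp add: opE_def)

lemma opE_gen_mult:
  "opE i (fa_gen j * u) = fa_gen j * opE i u + (if j = i then opA i 1 u + opA i (-1) u else 0)"
  by (simp add: opE_def opA_def skew_gen_mult fa_const_pull algebra_simps fa_const_uminus)

lemma fa_scale_opE: "fa_scale (chi (- e) i) (opE j u) = fa_const (chi e i j) * opE j (fa_scale (chi (- e) i) u)"
proof -
  have c: "chi e i j * chi (- e) i j = 1"
    using q0 by (simp add: chi_def power_int_minus)
  show ?thesis
    by (simp add: opE_def fa_scale_linear fa_scale_skew fa_const_pull right_diff_distrib c mult.left_commute)
qed

lemma opA_opE: "opA i (- e) (opE j u) = fa_const (chi e i j) * opE j (opA i (- e) u)"
  by (simp add: opA_def fa_scale_opE opE_linear fa_const_pull mult.commute)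

lemma opE_serre: "s \<in> serre_ideal \<Longrightarrow> opE i s \<in> serre_ideal"
  unfolding opE_def by (intro serre_idealI skew_serre) auto

lemma fa_linear_funpow:
  fixes f :: "('a, 'b::field) free_algebra \<Rightarrow> ('a, 'b) free_algebra"
  shows "fa_linear f \<Longrightarrow> fa_linear (f ^^ n)"
  by (induction n) (auto simp: fa_linear_def)

definition opE_serre_word :: "'i \<Rightarrow> 'i \<Rightarrow> nat \<Rightarrow> nat \<Rightarrow> ('i, 'k) free_algebra \<Rightarrow> ('i, 'k) free_algebra" where
  "opE_serre_word i j m n u = (opE i ^^ m) (opE j ((opE i ^^ n) u))"

lemma fa_linear_opE_word: "fa_linear (opE_serre_word i j m n)"
  using fa_linear_opE[of j] fa_linear_funpow[OF fa_linear_opE[of i]]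
  by (simp add: opE_serre_word_def fa_linear_def)

lemmas opE_word_linear = fa_linearD[OF fa_linear_opE_word]
lemmas opE_funpow_linear = fa_linearD[OF fa_linear_funpow[OF fa_linear_opE]]

definition opS :: "'i \<Rightarrow> 'i \<Rightarrow> ('i, 'k) free_algebra \<Rightarrow> ('i, 'k) free_algebra" where
  "opS i j u = (\<Sum>s=0..N i j. fa_const (q_generic.sc (qi i) (N i j) s) * opE_serre_word i j (N i j - s) s u)"

lemma opE_funpow_gen_other: "l \<noteq> i \<Longrightarrow> (opE i ^^ n) (fa_gen l * u) = fa_gen l * (opE i ^^ n) u"
  by (induction n) (simp_all add: opE_gen_mult)

text \<open>The commutation of E_i^n with F_i, with the contributions of K_i and of its inverse kept
  apart: each of them alone fits \<open>serre_telescope\<close>.\<close>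

lemma opE_funpow_gen_same:
  "(opE i ^^ n) (fa_gen i * u) = fa_gen i * (opE i ^^ n) u +
     (\<Sum>e\<in>{1,-1}. fa_const (alpha (qi i powi e) n) * (opE i ^^ (n - 1)) (opA i (- e) u))"
proof (induction n)
  case (Suc n)
  have c: "opA i (- e) ((opE i ^^ n) u) = fa_const ((qi i powi e) ^ (2 * n)) * (opE i ^^ n) (opA i (- e) u)" for e
    by (induction n) (simp_all add: opA_opE chi_diag opE_linear fa_const_pull power_add power2_eq_square ac_simps)
  have "(opE i ^^ Suc n) (fa_gen i * u) = opE i (fa_gen i * (opE i ^^ n) u +
     (\<Sum>e\<in>{1,-1}. fa_const (alpha (qi i powi e) n) * (opE i ^^ (n - 1)) (opA i (- e) u)))"
    by (simp only: funpow.simps o_apply Suc)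
  with c[of 1] c[of "-1"] show ?case
    by (cases n) (simp_all add: opE_linear opE_gen_mult alpha_Suc' fa_const_add algebra_simps)
qed simp

lemma opE_funpow_const: "n > 0 \<Longrightarrow> (opE i ^^ n) (fa_const c) = 0"
proof (induction n)
  case (Suc n)
  show ?case
    using opE_const opE_funpow_linear(3) by (simp add: funpow_Suc_right del: funpow.simps)
qed simp

text \<open>The Serre element in the E_i kills the constants and commutes with left multiplication
  by every generator, hence acts by zero on the whole free algebra, before any quotient is
  taken.\<close>

lemma opS_zero:
  assumes ij: "i \<noteq> j"
  shows "opS i j u = 0"
proof (induction u rule: fa_left_induct)
  case (const c)
  have "opE_serre_word i j m n (fa_const c) = 0" for m n
    by (cases "n = 0")
      (simp_all add: opE_serre_word_def opE_funpow_const opE_const opE_linear opE_funpow_linear)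
  then show ?case by (simp add: opS_def)
next
  case (gen l u)
  interpret q: q_generic "qi i" by (rule qi_generic)
  let ?N = "N i j"
  let ?w = "opE_serre_word i j"
  have c: "opA l (- e) ((opE i ^^ n) u) = fa_const (chi e l i ^ n) * (opE i ^^ n) (opA l (- e) u)" for e n l u
    by (induction n) (simp_all add: opA_opE opE_linear fa_const_pull mult.commute)
  consider "l = i" | "l = j" | "l \<noteq> i" "l \<noteq> j" by blast
  then have "opS i j (fa_gen l * u) = fa_gen l * opS i j u"
  proof cases
    case 1
    have "?w m n (fa_gen i * u) = fa_gen i * ?w m n u +
      (\<Sum>e\<in>{1,-1}. fa_const (alpha (qi i powi e) m * (qi i powi e) powi (a i j + 2 * int n)) * ?w (m - 1) n (opA i (- e) u)
         + fa_const (alpha (qi i powi e) n) * ?w m (n - 1) (opA i (- e) u))" for m n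
    proof -
      have p: "(qi i powi e) powi (a i j + 2 * int n) = ((qi i powi e) powi a i j) * ((qi i powi e) ^ 2) ^ n" for e
        using q.p0 by (simp add: power_int_add power_int_mult)
      have r: "opA i (- e) (opE j ((opE i ^^ n) u)) =
        fa_const ((qi i powi e) powi (a i j + 2 * int n)) * opE j ((opE i ^^ n) (opA i (- e) u))" for e
        unfolding p by (simp add: opA_opE c opE_linear fa_const_pull chi_diag)
      show ?thesis
        using ij r[of 1] r[of "-1"] by (simp add: opE_serre_word_def opE_funpow_gen_same opE_linear opE_funpow_linear opE_gen_mult
            fa_const_pull algebra_simps)
    qed
    then have "opS i j (fa_gen i * u) = fa_gen i * opS i j u + (\<Sum>e\<in>{1,-1}. \<Sum>s=0..?N.
      fa_const (q.sc ?N s) * (fa_const (alpha (qi i powi e) (?N - s) * (qi i powi e) powi (1 - int ?N + 2 * int s)) * ?w (?N - s - 1) s (opA i (- e) u)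
         + fa_const (alpha (qi i powi e) s) * ?w (?N - s) (s - 1) (opA i (- e) u)))"
      using int_N[OF ij]
      by (simp add: opS_def sum.distrib distrib_left sum_distrib_left fa_const_pull ac_simps)
    also have "\<dots> = fa_gen i * opS i j u"
      using q.serre_telescope[OF pm_in, where W = "\<lambda>m n. ?w m n (opA i (- e) u)" for e] by simp
    finally show ?thesis using 1 by simp
  next
    case 2
    have "?w m n (fa_gen j * u) = fa_gen j * ?w m n u +
      (\<Sum>e\<in>{1,-1}. fa_const ((qi i powi e) powi (a i j * int n)) * (opE i ^^ (m + n)) (opA j (- e) u))" for m n
    proof -
      have "chi e j i ^ n = (qi i powi e) powi (a i j * int n)" for e
        by (simp add: chi_diag(3)[of e j i] power_int_mult)
      then have r: "opA j (- e) ((opE i ^^ n) u) = fa_const ((qi i powi e) powi (a i j * int n)) * (opE i ^^ n) (opA j (- e) u)" for e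
        by (simp add: c)
      show ?thesis
        using ij r[of 1] r[of "-1"] by (simp add: opE_serre_word_def opE_funpow_gen_other opE_linear opE_funpow_linear opE_gen_mult
            fa_const_pull algebra_simps funpow_add)
    qed
    then have "opS i j (fa_gen j * u) = fa_gen j * opS i j u + (\<Sum>e\<in>{1,-1}. \<Sum>s=0..?N.
      fa_const (q.sc ?N s * (qi i powi e) powi ((1 - int ?N) * int s)) * (opE i ^^ ?N) (opA j (- e) u))"
      using int_N[OF ij]
      by (simp add: opS_def sum.distrib distrib_left sum_distrib_left fa_const_pull ac_simps)
    also have "\<dots> = fa_gen j * opS i j u"
    proof -
      have "(\<Sum>s=0..?N. fa_const (q.sc ?N s * (qi i powi e) powi ((1 - int ?N) * int s)) * v) = 0"
        if "e \<in> {1, -1}" for e v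
        using q.sc_sum[OF pm_in[OF that] N_pos[OF ij]] by (simp flip: sum_distrib_right fa_const_sum)
      then have "(\<Sum>e\<in>{1,-1}. \<Sum>s=0..?N. fa_const (q.sc ?N s * (qi i powi e) powi ((1 - int ?N) * int s)) *
          (opE i ^^ ?N) (opA j (- e) u)) = 0"
        by (intro sum.neutral) blast
      then show ?thesis by (simp only: add_0_right)
    qed
    finally show ?thesis using 2 by simp
  next
    case 3
    have "?w m n (fa_gen l * u) = fa_gen l * ?w m n u" for m n
      using 3 by (simp add: opE_serre_word_def opE_funpow_gen_other opE_gen_mult)
    then show ?thesis by (simp add: opS_def sum_distrib_left fa_const_pull)
  qed
  then show ?case using gen by simp
next
  case (add u v)
  have "opS i j (u + v) = opS i j u + opS i j v"
    by (simp add: opS_def opE_word_linear distrib_left sum.distrib)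
  then show ?case using add by simp
qed

section \<open>The action of the quantized enveloping algebra on the free algebra\<close>

fun act :: "'i uq_gen \<Rightarrow> ('i, 'k) free_algebra \<Rightarrow> ('i, 'k) free_algebra" where
  "act (GE i) = opE i"
| "act (GF i) = (*) (fa_gen i)"
| "act (GK i) = fa_scale (chi (-1) i)"
| "act (GKinv i) = fa_scale (chi 1 i)"

lemma fa_linear_act: "fa_linear (act g)"
proof (cases g)
  case (GF i)
  show ?thesis unfolding GF act.simps fa_linear_def by (simp add: distrib_left fa_const_left)
qed (simp_all add: fa_linear_opE fa_linear_scale)

definition rho :: "('i uq_gen, 'k) free_algebra \<Rightarrow> ('i, 'k) free_algebra \<Rightarrow> ('i, 'k) free_algebra" where
  "rho p u = fa_extend (\<lambda>w. foldr act (letters w) u) p"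

lemma rho_linear:
  "rho (p + r) u = rho p u + rho r u" "rho (fa_const c * p) u = fa_const c * rho p u"
  "rho (p - r) u = rho p u - rho r u" "rho (- p) u = - rho p u" "rho 0 u = 0"
  by (simp_all add: rho_def fa_extend_add fa_extend_const_mult fa_extend_diff fa_extend_uminus)

lemma rho_sum: "rho (sum f A) u = (\<Sum>x\<in>A. rho (f x) u)"
  by (induction A rule: infinite_finite_induct) (simp_all add: rho_linear)

lemma rho_const [simp]: "rho (fa_const c) u = fa_const c * u"
  by (simp add: rho_def flip: single_Word_Nil)

lemma rho_1 [simp]: "rho 1 u = u"
  using rho_const[of 1 u] by simp

lemma rho_gen_mult: "rho (fa_gen g * p) u = act g (rho p u)"
  by (induction p rule: fa_single_induct)
    (simp_all add: distrib_left rho_linear fa_linearD[OF fa_linear_act] rho_def fa_gen_mult_single fa_extend_add)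

lemma rho_gen [simp]: "rho (fa_gen g) u = act g u"
  using rho_gen_mult[of g 1 u] by simp

lemma rho_mult [simp]: "rho (p * r) u = rho p (rho r u)"
  by (induction p rule: fa_left_induct) (simp_all add: rho_linear distrib_right rho_gen_mult mult.assoc)

lemma rho_power: "rho (fa_gen g ^ n) u = (act g ^^ n) u"
  by (induction n) simp_all

lemma rho_serre: "s \<in> serre_ideal \<Longrightarrow> rho p s \<in> serre_ideal"
proof (induction p rule: fa_left_induct)
  case (gen g p)
  then show ?case
    by (cases g) (simp_all add: rho_gen_mult opE_serre fa_scale_serre serre_idealI)
qed (simp_all add: rho_linear serre_idealI)

definition uq_rels :: "('i uq_gen, 'k) free_algebra set" where
  "uq_rels =
     (\<Union>i. {fa_gen (GK i) * fa_gen (GKinv i) - 1, fa_gen (GKinv i) * fa_gen (GK i) - 1}) \<union>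
     (\<Union>i j. {fa_gen (GK i) * fa_gen (GK j) - fa_gen (GK j) * fa_gen (GK i),
       fa_gen (GK i) * fa_gen (GE j) * fa_gen (GKinv i) - fa_const (q powi ip i j) * fa_gen (GE j),
       fa_gen (GK i) * fa_gen (GF j) * fa_gen (GKinv i) - fa_const (q powi (- ip i j)) * fa_gen (GF j),
       fa_gen (GE i) * fa_gen (GF j) - fa_gen (GF j) * fa_gen (GE i) -
         (if i = j
          then fa_const (1 / (qi i - inverse (qi i))) * (fa_gen (GK i) - fa_gen (GKinv i))
          else 0)}) \<union>
     (\<Union>i. \<Union>j\<in>- {i}. {q_generic.serre_poly (qi i) (N i j) (fa_gen (GE i)) (fa_gen (GE j)),
        q_generic.serre_poly (qi i) (N i j) (fa_gen (GF i)) (fa_gen (GF j))})"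

text \<open>Only the Serre elements in the F_i can act nontrivially on the free algebra, namely as
  left multiplication by \<open>serre_rel\<close>; every other relator acts by zero.\<close>

lemma rho_rels:
  assumes "x \<in> uq_rels"
  shows "rho x u \<in> serre_ideal"
proof -
  have S: "x = q_generic.serre_poly (qi i) (N i j) (fa_gen (GE i)) (fa_gen (GE j)) \<Longrightarrow> i \<noteq> j \<Longrightarrow> rho x u = 0" for i j
  proof -
    assume "i \<noteq> j" and x: "x = q_generic.serre_poly (qi i) (N i j) (fa_gen (GE i)) (fa_gen (GE j))"
    interpret q: q_generic "qi i" by (rule qi_generic)
    have "rho x u = opS i j u"
      by (simp add: x q.serre_poly_def opS_def rho_sum opE_serre_word_def rho_power)
    then show ?thesis using opS_zero[OF \<open>i \<noteq> j\<close>] by simp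
  qed
  have F: "x = q_generic.serre_poly (qi i) (N i j) (fa_gen (GF i)) (fa_gen (GF j)) \<Longrightarrow> i \<noteq> j \<Longrightarrow> rho x u \<in> serre_ideal" for i j
  proof -
    assume "i \<noteq> j" and x: "x = q_generic.serre_poly (qi i) (N i j) (fa_gen (GF i)) (fa_gen (GF j))"
    interpret q: q_generic "qi i" by (rule qi_generic)
    have p: "((*) (fa_gen i) ^^ n) v = fa_gen i ^ n * v" for n v
      by (induction n) (simp_all add: mult.assoc)
    have "rho x u = serre_rel i j * u"
      by (simp add: x q.serre_poly_def serre_rel_def rho_sum rho_power p sum_distrib_right mult.assoc)
    then show ?thesis using serre_rel_in[OF \<open>i \<noteq> j\<close>] serre_idealI by simp
  qed
  have i1: "fa_scale (chi 1 i) (fa_scale (chi (-1) i) v) = v" "fa_scale (chi (-1) i) (fa_scale (chi 1 i) v) = v" for i v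
    by (auto intro!: fa_scale_inverse simp: chi_inverse)
  have K: "rho x u = 0" if "x = fa_gen (GK i) * fa_gen (GKinv i) - 1 \<or> x = fa_gen (GKinv i) * fa_gen (GK i) - 1 \<or>
      x = fa_gen (GK i) * fa_gen (GK j) - fa_gen (GK j) * fa_gen (GK i) \<or>
      x = fa_gen (GK i) * fa_gen (GE j) * fa_gen (GKinv i) - fa_const (q powi ip i j) * fa_gen (GE j) \<or>
      x = fa_gen (GK i) * fa_gen (GF j) * fa_gen (GKinv i) - fa_const (q powi (- ip i j)) * fa_gen (GF j)" for i j
    using that
  proof (elim disjE)
    assume "x = fa_gen (GK i) * fa_gen (GE j) * fa_gen (GKinv i) - fa_const (q powi ip i j) * fa_gen (GE j)"
    then show ?thesis using fa_scale_opE[of 1 i j] by (simp add: rho_linear i1 chi_def)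
  qed (simp_all add: rho_linear i1 fa_scale_commute chi_def mult.assoc)
  have EF: "rho x u = 0" if "x = fa_gen (GE i) * fa_gen (GF j) - fa_gen (GF j) * fa_gen (GE i) -
         (if i = j then fa_const (1 / (qi i - inverse (qi i))) * (fa_gen (GK i) - fa_gen (GKinv i)) else 0)" for i j
    unfolding that by (simp add: rho_linear opE_gen_mult opA_def hh_def algebra_simps fa_const_uminus)
  note z = subst[OF HOL.sym, where P = "\<lambda>v. v \<in> serre_ideal", OF _ serre_idealI(1)]
  show ?thesis
    using assms unfolding uq_rels_def
    apply (elim UnE UN_E insertE emptyE)
    subgoal for i by (rule z, rule K[of i i]) (simp only: simp_thms)
    subgoal for i by (rule z, rule K[of i i]) (simp only: simp_thms)
    subgoal for i j by (rule z, rule K[of i j]) (simp only: simp_thms)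
    subgoal for i j by (rule z, rule K[of i j]) (simp only: simp_thms)
    subgoal for i j by (rule z, rule K[of i j]) (simp only: simp_thms)
    subgoal for i j by (rule z, rule EF[of i j])
    subgoal for i j by (rule z, rule S[of i j]) auto
    subgoal for i j by (rule F[of i j]) auto
    done
qed

lemma rho_uq_ideal: "x \<in> fa_ideal uq_rels \<Longrightarrow> rho x u \<in> serre_ideal"
proof -
  have "two_sided {x. \<forall>u. rho x u \<in> serre_ideal}"
    unfolding two_sided_def by (auto simp: rho_linear rho_serre serre_idealI)
  from fa_ideal_minimal[OF this, of uq_rels] rho_rels
  show "x \<in> fa_ideal uq_rels \<Longrightarrow> rho x u \<in> serre_ideal" by auto
qed

section \<open>Leading terms\<close>

definition ev :: "('i, 'k) free_algebra \<Rightarrow> ('i uq_gen, 'k) free_algebra" where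
  "ev = fa_hom (\<lambda>j. fa_gen (GF j) - fa_gen (GKinv j) * fa_gen (GE j))"

lemma fa_linear_ev: "fa_linear ev" by (simp add: ev_def fa_linear_hom)
lemmas ev_linear = fa_linearD[OF fa_linear_ev]

lemma deglt_opE: "deglt (Suc n) u \<Longrightarrow> deglt n (opE i u)"
  unfolding opE_def by (intro deglt_const_mult deglt_diff deglt_skew)

text \<open>F_j prepends a letter while K_j^-1 E_j lowers the degree, so on the highest weight
  vector 1 the leading term of the result is the word itself.\<close>

lemma rho_ev_word: "deglt (length w) (rho (ev (mon w)) 1 - mon w)"
proof (induction w)
  case Nil
  then show ?case by (simp add: single_Word_Nil ev_def)
next
  case (Cons j w)
  let ?l = "rho (ev (mon w)) 1 - mon w"
  have m: "mon (j # w) = fa_gen j * mon w" by (simp add: fa_gen_mult_single)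
  have r: "rho (ev (mon w)) 1 = mon w + ?l" by simp
  have "rho (ev (mon (j # w))) 1 - mon (j # w) = fa_gen j * ?l - fa_scale (chi 1 j) (opE j (mon w + ?l))"
    unfolding m by (simp add: ev_def rho_linear right_diff_distrib)
  moreover have "deglt (Suc (length w)) (mon w + ?l)"
    by (intro deglt_add deglt_mon deglt_mono[OF Cons]) auto
  then have "deglt (Suc (length w)) (fa_scale (chi 1 j) (opE j (mon w + ?l)))"
    by (intro deglt_fa_scale deglt_opE deglt_mono[of "Suc (length w)" _ "Suc (Suc (length w))"]) auto
  moreover have "deglt (Suc (length w)) (fa_gen j * ?l)"
    by (rule deglt_gen_mult[OF Cons])
  ultimately show ?case by (metis deglt_diff length_Cons)
qed

lemma rho_ev:
  assumes "deglt (Suc n) p" shows "deglt n (rho (ev p) 1 - p)"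
proof -
  let ?f = "\<lambda>p. rho (ev p) 1 - p"
  have "fa_linear ?f"
    by (simp add: fa_linear_def ev_def fa_hom_linear rho_linear algebra_simps)
  then have "?f p = fa_extend (\<lambda>w. ?f (Poly_Mapping.single w 1)) p"
    by (rule fa_linear_eq[OF _ fa_linear_extend]) simp
  moreover have "deglt n (fa_extend (\<lambda>w. ?f (Poly_Mapping.single w 1)) p)"
    by (rule fa_extend_deglt[OF assms]) (rule deglt_mono[OF rho_ev_word], simp)
  ultimately show ?thesis by simp
qed

lemma serre_rel_homog: "homog (N i j + 1) (serre_rel i j)"
proof -
  interpret q: q_generic "qi i" by (rule qi_generic)
  have "homog (N i j + 1) (fa_const c * fa_gen i ^ (N i j - s) * fa_gen j * fa_gen i ^ s)" if "s \<le> N i j" for c s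
  proof -
    have "homog (0 + (1 * (N i j - s)) + 1 + 1 * s) (fa_const c * fa_gen i ^ (N i j - s) * fa_gen j * fa_gen i ^ s)"
      by (intro homog_mult homog_const homog_power homog_gen)
    then show ?thesis using that by simp
  qed
  then show ?thesis unfolding serre_rel_def q.serre_poly_def by (intro homog_sum) auto
qed

lemma comp_serre: "s \<in> serre_ideal \<Longrightarrow> hcomp n s \<in> serre_ideal"
proof (induction rule: serre_induct)
  case (step p i j u c v)
  have "homog (length u + (N i j + 1) + length v) (Poly_Mapping.single (Word u) c * serre_rel i j * mon v)"
    by (intro homog_mult homog_single serre_rel_homog)
  then show ?case using step
    by (simp add: fa_linearD[OF fa_linear_comp] comp_homog serre_idealI serre_sandwich)
qed (simp add: fa_linearD[OF fa_linear_comp] serre_idealI)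

text \<open>A relation among the B_i maps 1 into the Serre ideal. That ideal is homogeneous, and by
  \<open>rho_ev\<close> the top component of the image is that of \<open>p\<close>.\<close>

lemma leading_in_serre:
  assumes "ev p \<in> fa_ideal uq_rels" "deglt (Suc n) p"
  shows "hcomp n p \<in> serre_ideal"
proof -
  have "hcomp n (rho (ev p) 1) \<in> serre_ideal"
    by (intro comp_serre rho_uq_ideal assms)
  moreover have "hcomp n (rho (ev p) 1) = hcomp n p"
    using comp_deglt[OF rho_ev[OF assms(2)]] by (simp add: fa_linearD[OF fa_linear_comp])
  ultimately show ?thesis by simp
qed

text \<open>Right multiplication by a generator is injective modulo the Serre ideal: apply powers
  of the skew derivation, which is locally nilpotent.\<close>

lemma serre_cancel_gen:
  assumes "h * fa_gen i \<in> serre_ideal" shows "h \<in> serre_ideal"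
proof -
  interpret q: q_generic "qi i" by (rule qi_generic)
  let ?r = "skew i (chi 1 i)"
  have c: "chi 1 i i = qi i ^ 2" by (simp add: chi_diag)
  have r: "(?r ^^ m) (h * fa_gen i) = fa_const (qi i ^ (2 * m)) * ((?r ^^ m) h * fa_gen i) + fa_const (alpha (qi i) m) * (?r ^^ (m - 1)) h" for m
  proof (induction m)
    case (Suc m)
    then show ?case
      by (cases m) (simp_all add: skew_linear skew_mult skew_gen c alpha_Suc' fa_const_add distrib_left distrib_right
          fa_const_pull mult.commute add.assoc add.commute power2_eq_square mult.assoc)
  qed simp
  have S: "(?r ^^ m) s \<in> serre_ideal" if "s \<in> serre_ideal" for m s
    by (induction m) (use that in \<open>auto intro: skew_serre\<close>)
  obtain n where n: "deglt n h" using deglt_ex by blast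
  have "deglt (n - m) ((?r ^^ m) h)" if "m \<le> n" for m
    using that
  proof (induction m)
    case (Suc m)
    then have "deglt (Suc (n - Suc m)) ((?r ^^ m) h)" by (simp add: Suc_diff_Suc)
    then show ?case using deglt_skew by simp
  qed (simp add: n)
  then have z: "(?r ^^ n) h = 0" using deglt_0 by force
  \<comment> \<open>Downward induction from the power that kills h: the formula \<open>r\<close>
    expresses each lower power through the next higher one, since \<open>alpha\<close> is invertible
    at positive arguments.\<close>
  have "(?r ^^ (n - m)) h \<in> serre_ideal" if "m \<le> n" for m
    using that
  proof (induction m)
    case (Suc m)
    let ?k = "n - m"
    have k: "?k > 0" "n - Suc m = ?k - 1" using Suc by auto
    have "fa_const (alpha (qi i) ?k) * (?r ^^ (?k - 1)) h = (?r ^^ ?k) (h * fa_gen i) - fa_const (qi i ^ (2 * ?k)) * ((?r ^^ ?k) h * fa_gen i)"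
      using r[of ?k] by simp
    also have "\<dots> \<in> serre_ideal"
    proof (rule serre_idealI(6))
      show "fa_const (qi i ^ (2 * ?k)) * ((?r ^^ ?k) h * fa_gen i) \<in> serre_ideal"
        by (rule serre_idealI(3)[OF serre_idealI(4)], rule Suc.IH) (use Suc.prems in simp)
    qed (rule S[OF assms])
    finally have "fa_const (1 / alpha (qi i) ?k) * (fa_const (alpha (qi i) ?k) * (?r ^^ (?k - 1)) h) \<in> serre_ideal"
      by (rule serre_idealI(3))
    moreover have "1 / alpha (qi i) ?k * alpha (qi i) ?k = 1"
      using k(1) q.alpha_nonzero[of "qi i" ?k] by simp
    ultimately show ?case unfolding k(2) by (simp only: fa_const_pull(4) fa_const_1 mult_1_left)
  qed (simp add: z serre_idealI)
  from this[of n] show ?thesis by simp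
qed

end

section \<open>The deformed Serre relations\<close>

text \<open>A list of triples \<open>(c, m, n)\<close> stands for the polynomial \<open>\<Sum> c L^m R^n\<close> in left and
  right multiplication by \<open>x\<close>, applied to \<open>y\<close>.\<close>

definition bip :: "('k \<times> nat \<times> nat) list \<Rightarrow> ('a, 'k::field) free_algebra \<Rightarrow> ('a, 'k) free_algebra \<Rightarrow> ('a, 'k) free_algebra" where
  "bip f x y = (\<Sum>(c, m, n)\<leftarrow>f. fa_const c * x ^ m * y * x ^ n)"

lemma bip_simps [simp]:
  "bip [] x y = 0" "bip ((c, m, n) # f) x y = fa_const c * x ^ m * y * x ^ n + bip f x y"
  by (simp_all add: bip_def)

lemma bip_add: "bip f x (y + y') = bip f x y + bip f x y'"
  by (induction f) (auto simp: algebra_simps)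

text \<open>A chain of twisted commutators with x. For k = 0 they are iterated q-commutators ending
  in the Serre element; the correction by \<open>k\<close> accounts for replacing F_i by B_i, see
  \<open>deformed_chain\<close>.\<close>

fun dch :: "(nat \<Rightarrow> 'k) \<Rightarrow> (nat \<Rightarrow> 'k) \<Rightarrow> ('a, 'k::field) free_algebra \<Rightarrow> ('a, 'k) free_algebra \<Rightarrow> nat \<Rightarrow> ('a, 'k) free_algebra" where
  "dch c k x y 0 = y"
| "dch c k x y (Suc 0) = x * y - fa_const (c 0) * y * x"
| "dch c k x y (Suc (Suc n)) = x * dch c k x y (Suc n) - fa_const (c (Suc n)) * dch c k x y (Suc n) * x
      - fa_const (k (Suc n)) * dch c k x y n"

lemma dch_Suc: "k 0 = 0 \<Longrightarrow> dch c k x y (Suc n) = x * dch c k x y n - fa_const (c n) * dch c k x y n * x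
      - fa_const (k n) * dch c k x y (n - 1)"
  by (cases n) auto

lemmas fa_const_ring = fa_const_add fa_const_uminus fa_const_diff

lemma dch_bip:
  "dch c k x y 1 = bip [(1,1,0), (- c 0,0,1)] x y"
  "dch c k x y 2 = bip [(1,2,0), (- (c 0 + c 1),1,1), (c 0 * c 1,0,2), (- k 1,0,0)] x y"
  "dch c k x y 3 = bip [(1,3,0), (- (c 0 + c 1 + c 2),2,1), (c 0 * c 1 + c 2 * (c 0 + c 1),1,2), (- (c 0 * c 1 * c 2),0,3),
      (- (k 1 + k 2),1,0), (c 2 * k 1 + k 2 * c 0,0,1)] x y"
  "dch c k x y 4 = bip [(1,4,0), (- (c 0 + c 1 + c 2 + c 3),3,1), (c 0 * c 1 + c 2 * (c 0 + c 1) + c 3 * (c 0 + c 1 + c 2),2,2),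
      (- (c 0 * c 1 * c 2 + c 3 * (c 0 * c 1 + c 2 * (c 0 + c 1))),1,3), (c 0 * c 1 * c 2 * c 3,0,4),
      (- (k 1 + k 2 + k 3),2,0), (c 3 * (k 1 + k 2) + (c 2 * k 1 + k 2 * c 0) + k 3 * (c 0 + c 1),1,1),
      (- (c 3 * (c 2 * k 1 + k 2 * c 0) + k 3 * (c 0 * c 1)),0,2), (k 3 * k 1,0,0)] x y"
proof -
  define W where "W m n = x ^ m * y * x ^ n" for m n
  have W: "bip [] x y = 0" "bip ((c, m, n) # f) x y = fa_const c * W m n + bip f x y"
    "x * (fa_const c * W m n) = fa_const c * W (Suc m) n" "fa_const c * W m n * x = fa_const c * W m (Suc n)"
    "fa_const d * (fa_const c * W m n) = fa_const (d * c) * W m n"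
    "x * W m n = W (Suc m) n" "W m n * x = W m (Suc n)" "fa_const c * (W m n * x) = fa_const c * W m (Suc n)"
    "fa_const c * (fa_const d * (W m n * x)) = fa_const (c * d) * W m (Suc n)"
    for c d m n f
  proof -
    show "x * W m n = W (Suc m) n" "W m n * x = W m (Suc n)" "fa_const c * (W m n * x) = fa_const c * W m (Suc n)"
      "fa_const c * (fa_const d * (W m n * x)) = fa_const (c * d) * W m (Suc n)"
      by (simp_all add: W_def mult.assoc power_commutes fa_const_mult)
    show "x * (fa_const c * W m n) = fa_const c * W (Suc m) n"
      unfolding W_def by (subst fa_const_left) (simp add: mult.assoc)
    show "fa_const c * W m n * x = fa_const c * W m (Suc n)"
      by (simp add: W_def mult.assoc power_commutes)
    show "fa_const d * (fa_const c * W m n) = fa_const (d * c) * W m n"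
      by (simp add: fa_const_mult mult.assoc)
  qed (simp_all add: W_def mult.assoc)
  have y: "y = fa_const 1 * W 0 0" by (simp add: W_def)
  have s: "dch c k x y 1 = x * y - fa_const (c 0) * (y * x)"
    "dch c k x y 2 = x * dch c k x y 1 - fa_const (c 1) * (dch c k x y 1 * x) - fa_const (k 1) * y"
    "dch c k x y 3 = x * dch c k x y 2 - fa_const (c 2) * (dch c k x y 2 * x) - fa_const (k 2) * dch c k x y 1"
    "dch c k x y 4 = x * dch c k x y 3 - fa_const (c 3) * (dch c k x y 3 * x) - fa_const (k 3) * dch c k x y 2"
    by (simp_all add: numeral_eq_Suc mult.assoc)
  have 1: "dch c k x y 1 = bip [(1,1,0), (- c 0,0,1)] x y"
    unfolding s by (simp add: fa_const_uminus mult.assoc)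
  show "dch c k x y 1 = bip [(1,1,0), (- c 0,0,1)] x y" by (fact 1)
  show 2: "dch c k x y 2 = bip [(1,2,0), (- (c 0 + c 1),1,1), (c 0 * c 1,0,2), (- k 1,0,0)] x y"
    unfolding s(2) 1 W
    by (subst y) (simp add: W algebra_simps fa_const_ring numeral_eq_Suc del: bip_simps)
  show 3: "dch c k x y 3 = bip [(1,3,0), (- (c 0 + c 1 + c 2),2,1), (c 0 * c 1 + c 2 * (c 0 + c 1),1,2), (- (c 0 * c 1 * c 2),0,3),
      (- (k 1 + k 2),1,0), (c 2 * k 1 + k 2 * c 0,0,1)] x y"
    unfolding s(3) 1 2 W by (simp add: W algebra_simps fa_const_ring numeral_eq_Suc del: bip_simps)
  show "dch c k x y 4 = bip [(1,4,0), (- (c 0 + c 1 + c 2 + c 3),3,1), (c 0 * c 1 + c 2 * (c 0 + c 1) + c 3 * (c 0 + c 1 + c 2),2,2),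
      (- (c 0 * c 1 * c 2 + c 3 * (c 0 * c 1 + c 2 * (c 0 + c 1))),1,3), (c 0 * c 1 * c 2 * c 3,0,4),
      (- (k 1 + k 2 + k 3),2,0), (c 3 * (k 1 + k 2) + (c 2 * k 1 + k 2 * c 0) + k 3 * (c 0 + c 1),1,1),
      (- (c 3 * (c 2 * k 1 + k 2 * c 0) + k 3 * (c 0 * c 1)),0,2), (k 3 * k 1,0,0)] x y"
    unfolding s(4) 2 3 W by (simp add: W algebra_simps fa_const_ring numeral_eq_Suc del: bip_simps)
qed

text \<open>The deformed Serre polynomial in L and R. At m = 0 it is the quantum Serre polynomial;
  \<open>drel\<close> takes m = 1/q_i. Here \<open>t1\<close>, \<open>t2 + 1\<close> and
  \<open>t1 + t3\<close> are the quantum integers [2], [3] and [4].\<close>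

definition dlist :: "'k::field \<Rightarrow> 'k \<Rightarrow> int \<Rightarrow> ('k \<times> nat \<times> nat) list" where
  "dlist p m a = (let t1 = p + inverse p; t2 = p ^ 2 + inverse p ^ 2; t3 = p ^ 3 + inverse p ^ 3; k3 = (t2 + 1) ^ 2 * m in
    if a = 0 then [(1,1,0), (-1,0,1)]
    else if a = -1 then [(1,2,0), (- t1,1,1), (1,0,2), (m,0,0)]
    else if a = -2 then [(1,3,0), (- (t2 + 1),2,1), (t2 + 1,1,2), (-1,0,3), (t1 ^ 2 * m,1,0), (- (t1 ^ 2 * m),0,1)]
    else [(1,4,0), (- (t1 + t3),3,1), (2 + t1 * t3,2,2), (- (t1 + t3),1,3), (1,0,4),
      (m + k3,2,0), (- (t1 * k3 + t3 * m),1,1), (m + k3,0,2), (m * k3,0,0)])"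

lemma dlist_inverse: "dlist (inverse p) m a = dlist p m a"
  by (simp only: dlist_def inverse_inverse_eq add.commute[of "inverse p"] add.commute[of "inverse p ^ _"])

text \<open>The recursion for \<open>k\<close> is the one that \<open>deformed_chain\<close>
  imposes. Its solution consists of multiples of -m, after which the coefficients agree by
  identities in P and 1/P.\<close>

lemma dch_dlist:
  assumes a: "a \<in> {0, -1, -2, -3}" and P: "P \<noteq> (0::'k::field)"
    and eta: "eta * (1 - inverse P ^ 2) = m"
    and k: "k 0 = 0" "\<And>n. k (Suc n) = P ^ 2 * k n - eta * (1 - (P powi (a + 2 * int n)) ^ 2)"
  shows "dch (\<lambda>n. P powi (a + 2 * int n)) k x y (nat (1 - a)) = bip (dlist P m a) x y"
proof -
  define r where "r = inverse P"
  have r: "P * r = 1" using P by (simp add: r_def)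
  have pw: "P powi (-1) = r" "P powi (-2) = r ^ 2" "P powi (-3) = r ^ 3"
    by (simp_all add: r_def power_int_minus power_inverse)
  have k1: "k 1 = P ^ 2 * k 0 - eta * (1 - (P powi a) ^ 2)"
    and k2: "k 2 = P ^ 2 * k 1 - eta * (1 - (P powi (a + 2)) ^ 2)"
    and k3: "k 3 = P ^ 2 * k 2 - eta * (1 - (P powi (a + 4)) ^ 2)"
    using k(2)[of 0] k(2)[of 1] k(2)[of 2] by (simp_all add: numeral_eq_Suc)
  have eta': "eta * (1 - r ^ 2) = m" using eta by (simp add: r_def)
  consider "a = 0" | "a = -1" | "a = -2" | "a = -3" using a by blast
  then show ?thesis
  proof cases
    case 1
    then show ?thesis using dch_bip(1)[of "\<lambda>n. P powi (a + 2 * int n)" k x y] by (simp add: dlist_def)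
  next
    case 2
    have "k 1 = P ^ 2 * 0 - eta * (1 - r ^ 2)" using k1 by (simp only: 2 k(1) pw)
    then have e: "- k 1 = m" using eta' by simp
    show ?thesis using dch_bip(2)[of "\<lambda>n. P powi (a + 2 * int n)" k x y] pw r e
      by (simp add: 2 dlist_def mult.commute add.commute del: bip_simps One_nat_def flip: r_def)
  next
    case 3
    have "k 1 = P ^ 2 * 0 - eta * (1 - (r ^ 2) ^ 2)" using k1 by (simp only: 3 k(1) pw)
    then have e1: "k 1 = - m * (1 + r ^ 2)" by (simp add: eta'[symmetric] algebra_simps eval_nat_numeral)
    have "k 2 = P ^ 2 * k 1" using k2 by (simp add: 3)
    moreover have "P ^ 2 * (- m * (1 + r ^ 2)) = - m * (P ^ 2 + 1)" using r by Groebner_Basis.algebra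
    ultimately have e2: "k 2 = - m * (P ^ 2 + 1)" unfolding e1 by simp
    have c1: "- (k 1 + k 2) = (P + r) ^ 2 * m" unfolding e1 e2 using r by Groebner_Basis.algebra
    have c2: "P ^ 2 * k 1 + k 2 * r ^ 2 = - ((P + r) ^ 2 * m)" unfolding e1 e2 using r by Groebner_Basis.algebra
    have c3: "r ^ 2 * 1 + P ^ 2 * (r ^ 2 + 1) = P ^ 2 + r ^ 2 + 1" "r ^ 2 * 1 * P ^ 2 = 1"
      using r by Groebner_Basis.algebra+
    have c4: "r ^ 2 + 1 + P ^ 2 = P ^ 2 + r ^ 2 + 1" by simp
    show ?thesis using dch_bip(3)[of "\<lambda>n. P powi (a + 2 * int n)" k x y] pw c1 c2 c3 c4
      by (simp add: 3 dlist_def Let_def add_ac del: bip_simps One_nat_def flip: r_def)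
  next
    case 4
    have "k 1 = P ^ 2 * 0 - eta * (1 - (r ^ 3) ^ 2)" using k1 by (simp only: 4 k(1) pw)
    then have e1: "k 1 = - m * (1 + r ^ 2 + r ^ 4)" by (simp add: eta'[symmetric] algebra_simps eval_nat_numeral)
    have "k 2 = P ^ 2 * k 1 - eta * (1 - r ^ 2)" using k2 pw(1) by (simp add: 4)
    moreover have "P ^ 2 * (- m * (1 + r ^ 2 + r ^ 4)) - m = - m * (P ^ 2 + 2 + r ^ 2)" using r by Groebner_Basis.algebra
    ultimately have e2: "k 2 = - m * (P ^ 2 + 2 + r ^ 2)" unfolding e1 eta' by simp
    have "k 3 = P ^ 2 * k 2 - eta * (1 - P ^ 2)" using k3 by (simp add: 4)
    moreover have "eta * (1 - P ^ 2) = - m * P ^ 2" unfolding eta'[symmetric] using r by Groebner_Basis.algebra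
    moreover have "P ^ 2 * (- m * (P ^ 2 + 2 + r ^ 2)) - (- m * P ^ 2) = - m * (P ^ 4 + P ^ 2 + 1)" using r by Groebner_Basis.algebra
    ultimately have e3: "k 3 = - m * (P ^ 4 + P ^ 2 + 1)" unfolding e2 by (simp only:)
    let ?k3 = "(P ^ 2 + r ^ 2 + 1) ^ 2 * m"
    have c0: "- (r ^ 3 + r + P + P ^ 3) = - (P + r + (P ^ 3 + r ^ 3))" by simp
    have c: "r ^ 3 * r + P * (r ^ 3 + r) + P ^ 3 * (r ^ 3 + r + P) = 2 + (P + r) * (P ^ 3 + r ^ 3)"
      "- (r ^ 3 * r * P + P ^ 3 * (r ^ 3 * r + P * (r ^ 3 + r))) = - (P + r + (P ^ 3 + r ^ 3))"
      "r ^ 3 * r * P * P ^ 3 = 1" using r by Groebner_Basis.algebra+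
    have d: "- (k 1 + k 2 + k 3) = m + ?k3"
      "P ^ 3 * (k 1 + k 2) + (P * k 1 + k 2 * r ^ 3) + k 3 * (r ^ 3 + r) = - ((P + r) * ?k3 + (P ^ 3 + r ^ 3) * m)"
      "- (P ^ 3 * (P * k 1 + k 2 * r ^ 3) + k 3 * (r ^ 3 * r)) = m + ?k3"
      "k 3 * k 1 = m * ?k3"
      unfolding e1 e2 e3 using r by Groebner_Basis.algebra+
    have cv: "P powi (-3 + 2 * int 0) = r ^ 3" "P powi (-3 + 2 * int 1) = r" "P powi (-3 + 2 * int 2) = P"
        "P powi (-3 + 2 * int 3) = P ^ 3" using pw by simp_all
    have dl: "dlist P m (-3) = [(1,4,0), (- (P + r + (P ^ 3 + r ^ 3)),3,1), (2 + (P + r) * (P ^ 3 + r ^ 3),2,2),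
      (- (P + r + (P ^ 3 + r ^ 3)),1,3), (1,0,4), (m + ?k3,2,0), (- ((P + r) * ?k3 + (P ^ 3 + r ^ 3) * m),1,1),
      (m + ?k3,0,2), (m * ?k3,0,0)]"
      by (simp add: dlist_def Let_def r_def)
    have n: "nat (1 - (-3)) = 4" by simp
    show ?thesis unfolding 4 n dl by (simp only: dch_bip(4) cv c0 c d)
  qed
qed

text \<open>Without corrections the chain is the product of the factors L - P^(a + 2n) R for n = 0,
  ..., -a, as in the q-binomial theorem. The exponents are symmetric about zero, so \<open>P\<close>
  may be inverted.\<close>

lemma (in q_generic) serre_dch:
  assumes a: "a \<in> {0, -1, -2, -3}" and P: "P \<in> {p, inverse p}"
  shows "dch (\<lambda>n. P powi (a + 2 * int n)) (\<lambda>_. 0) x y (nat (1 - a)) = serre_poly (nat (1 - a)) x y"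
proof -
  have d: "dch (\<lambda>n. P powi (a + 2 * int n)) (\<lambda>_. 0) x y (nat (1 - a)) = bip (dlist p 0 a) x y"
  proof -
    have "bip (dlist P 0 a) x y = bip (dlist p 0 a) x y" using P dlist_inverse[of p] by auto
    moreover have "P \<noteq> 0" using P p0 by auto
    ultimately show ?thesis using dch_dlist[OF a \<open>P \<noteq> 0\<close>, of 0 0 "\<lambda>_. 0" x y] by simp
  qed
  have pr: "p * inverse p = 1" using p0 by simp
  have q: "qint p n * (p - inverse p) = p powi n - p powi (- n)" for n
    using p_diff by (simp add: qint_def)
  have qq: "qint p n = v" if "v * (p - inverse p) = p powi n - p powi (- n)" for n v
    using that q[of n] p_diff by (metis mult_right_cancel)
  have pw: "p powi 2 = p ^ 2" "p powi 3 = p ^ 3" "p powi 4 = p ^ 4" "p powi (-2) = inverse p ^ 2"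
      "p powi (-3) = inverse p ^ 3" "p powi (-4) = inverse p ^ 4"
    by (simp_all add: power_int_minus power_inverse)
  have qr: "(p ^ 2 + r ^ 2 + 1) * (p - r) = p ^ 3 - r ^ 3" "(p + r + (p ^ 3 + r ^ 3)) * (p - r) = p ^ 4 - r ^ 4"
    "(p + r + (p ^ 3 + r ^ 3)) * (p ^ 2 + r ^ 2 + 1) = (2 + (p + r) * (p ^ 3 + r ^ 3)) * (p + r)"
    if "p * r = 1" for r using that by Groebner_Basis.algebra+
  have q2: "qint p 2 = p + inverse p" by (rule qq, unfold pw) (simp add: algebra_simps eval_nat_numeral)
  have q3: "qint p 3 = p ^ 2 + inverse p ^ 2 + 1" by (rule qq, unfold pw) (rule qr(1)[OF pr])
  have q4: "qint p 4 = p + inverse p + (p ^ 3 + inverse p ^ 3)" by (rule qq, unfold pw) (rule qr(2)[OF pr])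
  have nz: "qint p 2 \<noteq> 0" "qint p 3 \<noteq> 0" "qint p 4 \<noteq> 0" by (simp_all add: qint_nonzero)
  have one: "qint p 1 = 1" by simp
  have b: "qbinomial p a 1 = qint p a" "qbinomial p a 2 = qint p a * qint p (a - 1) / qint p 2"
    "qbinomial p a 3 = qbinomial p a 2 * qint p (a - 2) / qint p 3"
    "qbinomial p a 4 = qbinomial p a 3 * qint p (a - 3) / qint p 4" for a
    using qbinomial_Suc[of a 0] qbinomial_Suc[of a 1] qbinomial_Suc[of a 2] qbinomial_Suc[of a 3]
    by (simp_all add: numeral_eq_Suc)
  have b42': "qint p 4 * qint p 3 = (2 + (p + inverse p) * (p ^ 3 + inverse p ^ 3)) * qint p 2"
    unfolding q2 q3 q4 by (rule qr(3)[OF pr])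
  then have b42: "qint p 4 * qint p 3 / qint p 2 = 2 + (p + inverse p) * (p ^ 3 + inverse p ^ 3)"
    using nz by simp
  have s1: "sc 1 1 = -1" by (simp add: sc_def b del: One_nat_def)
  have s2: "sc 2 1 = - qint p 2" "sc 2 2 = 1" using nz by (simp_all add: sc_def b del: One_nat_def)
  have s3: "sc 3 1 = - qint p 3" "sc 3 2 = qint p 3" "sc 3 3 = -1" using nz by (simp_all add: sc_def b del: One_nat_def)
  have s4: "sc 4 1 = - qint p 4" "sc 4 2 = 2 + (p + inverse p) * (p ^ 3 + inverse p ^ 3)" "sc 4 3 = - qint p 4" "sc 4 4 = 1"
    using nz b42 by (simp_all add: sc_def b b42'[symmetric] del: One_nat_def)
  have set: "{0..1::nat} = {0,1}" "{0..2::nat} = {0,1,2}" "{0..3::nat} = {0,1,2,3}" "{0..4::nat} = {0,1,2,3,4}" by auto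
  consider "a = 0" | "a = -1" | "a = -2" | "a = -3" using a by blast
  then show ?thesis
  proof cases
    case 1 then show ?thesis unfolding d using s1 set(1) by (simp add: dlist_def serre_poly_def)
  next
    case 2 then show ?thesis unfolding d using s2 q2 set(2) by (simp add: dlist_def serre_poly_def)
  next
    case 3 then show ?thesis unfolding d using s3 q3 set(3) by (simp add: dlist_def serre_poly_def)
  next
    case 4
    have "sc 4 1 = - p - inverse p - (p ^ 3 + inverse p ^ 3)" "sc 4 3 = - p - inverse p - (p ^ 3 + inverse p ^ 3)"
      by (simp_all add: s4(1,3) q4 algebra_simps del: One_nat_def)
    then show ?thesis unfolding d using 4 s4(2,4) set(4) by (simp add: dlist_def Let_def serre_poly_def)
  qed
qed

text \<open>To be used with x = F_i, e = -K_i^-1 E_i and z = K_i^-2, and with x and e exchanged.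
  Moving e past the n-th member of the chain of x costs the factor c_n and a multiple k_n of the
  previous member. The correction in the chain of x + e removes exactly this, so both chains agree
  modulo \<open>J\<close>, and that of x ends in a Serre element.\<close>

lemma deformed_chain:
  fixes x e y z :: "('b, 'k::field) free_algebra"
  assumes J: "two_sided J" and P: "P \<noteq> 0" and a: "a \<in> {0, -1, -2, -3}"
    and eta: "eta * (1 - inverse P ^ 2) = m"
    and ex: "e * x - (fa_const (P ^ 2) * x * e - fa_const eta * (1 - z)) \<in> J"
    and zx: "z * x - fa_const (P ^ 4) * x * z \<in> J"
    and zy: "z * y - fa_const ((P powi a) ^ 2) * y * z \<in> J"
    and ey: "e * y - fa_const (P powi a) * y * e \<in> J"
    and serre: "dch (\<lambda>n. P powi (a + 2 * int n)) (\<lambda>_. 0) x y (nat (1 - a)) \<in> J"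
  shows "bip (dlist P m a) (x + e) y \<in> J"
proof -
  define c where "c n = P powi (a + 2 * int n)" for n
  have c: "c (Suc n) = P ^ 2 * c n" for n
    using P by (simp add: c_def power_int_add distrib_left)
  define k where "k = rec_nat 0 (\<lambda>n k. P ^ 2 * k - eta * (1 - (c n) ^ 2))"
  have k: "k 0 = 0" "k (Suc n) = P ^ 2 * k n - eta * (1 - (c n) ^ 2)" for n
    by (simp_all add: k_def)
  define Y where "Y = dch c (\<lambda>_. 0) x y"
  have Y: "Y 0 = y" "Y (Suc n) = x * Y n - fa_const (c n) * Y n * x" for n
    by (simp_all add: Y_def dch_Suc)
  note J' = two_sidedD[OF J]
  have A: "z * Y n - fa_const ((c n) ^ 2) * Y n * z \<in> J" for n
  proof (induction n)
    case (Suc n)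
    have "z * Y (Suc n) - fa_const ((c (Suc n)) ^ 2) * Y (Suc n) * z =
      (z * x - fa_const (P ^ 4) * x * z) * Y n + fa_const (P ^ 4) * x * (z * Y n - fa_const ((c n) ^ 2) * Y n * z)
      - fa_const (c n) * (z * Y n - fa_const ((c n) ^ 2) * Y n * z) * x
      - fa_const ((c n) ^ 3) * Y n * (z * x - fa_const (P ^ 4) * x * z)"
      by (simp add: Y c fa_const_pull algebra_simps power2_eq_square power3_eq_cube power4_eq_xxxx)
    also have "\<dots> \<in> J" by (intro J'(2) J'(6) J'(3)[OF zx] J'(4)[OF zx] J'(3)[OF Suc] J'(4)[OF J'(3)[OF Suc]])
    finally show ?case .
  qed (use zy in \<open>simp add: Y c_def\<close>)
  \<comment> \<open>For n = 0 the truncated index makes \<open>Y (n - 1)\<close> equal to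
    \<open>Y 0\<close>, which is harmless because \<open>k 0 = 0\<close>.\<close>
  have B: "e * Y n - (fa_const (c n) * Y n * e + fa_const (k n) * Y (n - 1)) \<in> J" for n
  proof (induction n)
    case (Suc n)
    let ?B = "e * Y n - (fa_const (c n) * Y n * e + fa_const (k n) * Y (n - 1))"
    let ?X = "e * x - (fa_const (P ^ 2) * x * e - fa_const eta * (1 - z))"
    have kk: "fa_const (P ^ 2 * k n) * x * Y (n - 1) - fa_const (c n * k n) * Y (n - 1) * x = fa_const (P ^ 2 * k n) * Y n"
      by (cases n) (simp_all add: k(1) Y(2) c fa_const_pull algebra_simps)
    have "e * Y (Suc n) - (fa_const (c (Suc n)) * Y (Suc n) * e + fa_const (k (Suc n)) * Y n) =
      ?X * Y n + fa_const (P ^ 2) * x * ?B - fa_const (c n) * ?B * x - fa_const ((c n) ^ 2) * Y n * ?X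
      + fa_const eta * (z * Y n - fa_const ((c n) ^ 2) * Y n * z)
      + (fa_const (P ^ 2 * k n) * x * Y (n - 1) - fa_const (c n * k n) * Y (n - 1) * x - fa_const (P ^ 2 * k n) * Y n)"
      by (simp add: Y c k fa_const_pull fa_const_ring algebra_simps power2_eq_square)
    also have "\<dots> \<in> J" unfolding kk
      by (unfold diff_self add_0_right, intro J'(2) J'(6) J'(3)[OF ex] J'(4)[OF ex] J'(3)[OF Suc] J'(4)[OF J'(3)[OF Suc]] J'(3)[OF A])
    finally show ?case by simp
  qed (use ey in \<open>simp add: Y k c_def\<close>)
  define Z where "Z = dch c k (x + e) y"
  have Z: "Z 0 = y" "Z (Suc n) = (x + e) * Z n - fa_const (c n) * Z n * (x + e) - fa_const (k n) * Z (n - 1)" for n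
    by (simp_all add: Z_def dch_Suc k(1))
  have "Z n - Y n \<in> J \<and> Z (n - 1) - Y (n - 1) \<in> J" for n
  proof (induction n)
    case (Suc n)
    have "Z (Suc n) - Y (Suc n) = (x + e) * (Z n - Y n) - fa_const (c n) * (Z n - Y n) * (x + e)
       - fa_const (k n) * (Z (n - 1) - Y (n - 1))
       + (e * Y n - (fa_const (c n) * Y n * e + fa_const (k n) * Y (n - 1)))"
      by (simp add: Z Y algebra_simps)
    also have "\<dots> \<in> J"
      by (intro J'(2) J'(6) J'(3)[OF conjunct1[OF Suc]] J'(3)[OF conjunct2[OF Suc]] J'(4)[OF J'(3)[OF conjunct1[OF Suc]]] B)
    finally show ?case using Suc by simp
  qed (simp add: Z Y J')
  then have "Z (nat (1 - a)) - Y (nat (1 - a)) + Y (nat (1 - a)) \<in> J"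
    using serre by (intro J'(2)) (auto simp: Y_def c_def[abs_def])
  moreover have "Z (nat (1 - a)) = bip (dlist P m a) (x + e) y"
    unfolding Z_def c_def by (rule dch_dlist[OF a P eta]) (simp_all add: k c_def)
  ultimately show ?thesis by simp
qed

text \<open>Multiplies the commutation rule of u and w by v, the inverse of u modulo
  \<open>J\<close>, on both sides; this carries rules for K_i over to K_i^-1.\<close>

lemma conj_inverse_ideal:
  fixes u v w :: "('b, 'k::field) free_algebra"
  assumes J: "two_sided J" and uv: "u * v - 1 \<in> J" and vu: "v * u - 1 \<in> J"
    and uw: "u * w - fa_const c * w * u \<in> J" and c: "c' * c = 1"
  shows "v * w - fa_const c' * w * v \<in> J"
proof -
  note J' = two_sidedD[OF J]
  have "v * w - fa_const c' * w * v = fa_const c' * (v * u - 1) * w * v - v * w * (u * v - 1)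
      - fa_const c' * v * (u * w - fa_const c * w * u) * v"
    using c by (simp add: algebra_simps fa_const_pull)
  also have "\<dots> \<in> J"
    by (intro J'(6) J'(3)[OF uv] J'(4)[OF J'(4)[OF J'(3)[OF vu]]] J'(4)[OF J'(3)[OF uw]])
  finally show ?thesis .
qed

section \<open>Relations among the generators of the quantized enveloping algebra, and the relation
  between B_i and B_j\<close>

context cartan_datum
begin

abbreviation UJ :: "('i uq_gen, 'k) free_algebra set" where "UJ \<equiv> fa_ideal uq_rels"

abbreviation gE where "gE i \<equiv> fa_gen (GE i) :: ('i uq_gen, 'k) free_algebra"
abbreviation gF where "gF i \<equiv> fa_gen (GF i) :: ('i uq_gen, 'k) free_algebra"
abbreviation gK where "gK i \<equiv> fa_gen (GK i) :: ('i uq_gen, 'k) free_algebra"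
abbreviation gKi where "gKi i \<equiv> fa_gen (GKinv i) :: ('i uq_gen, 'k) free_algebra"

lemma two_sided_UJ: "two_sided UJ"
  by (rule two_sided_fa_ideal)

lemmas UJI = two_sidedD[OF two_sided_UJ]

lemma UJ_rels:
  "gK i * gKi i - 1 \<in> UJ" "gKi i * gK i - 1 \<in> UJ"
  "gK i * gK j - gK j * gK i \<in> UJ"
  "gK i * gE j * gKi i - fa_const (q powi ip i j) * gE j \<in> UJ"
  "gK i * gF j * gKi i - fa_const (q powi (- ip i j)) * gF j \<in> UJ"
  "gE i * gF i - gF i * gE i - fa_const (hh i) * (gK i - gKi i) \<in> UJ"
  "i \<noteq> j \<Longrightarrow> gE i * gF j - gF j * gE i \<in> UJ"
  "i \<noteq> j \<Longrightarrow> q_generic.serre_poly (qi i) (N i j) (gE i) (gE j) \<in> UJ"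
  "i \<noteq> j \<Longrightarrow> q_generic.serre_poly (qi i) (N i j) (gF i) (gF j) \<in> UJ"
proof -
  show "gK i * gKi i - 1 \<in> UJ" "gKi i * gK i - 1 \<in> UJ"
    unfolding uq_rels_def by (rule fa_ideal_gen, intro UnI1, rule UN_I[of i], simp, simp only: insert_iff simp_thms)+
  show "gK i * gK j - gK j * gK i \<in> UJ"
    "gK i * gE j * gKi i - fa_const (q powi ip i j) * gE j \<in> UJ"
    "gK i * gF j * gKi i - fa_const (q powi (- ip i j)) * gF j \<in> UJ"
    unfolding uq_rels_def by (rule fa_ideal_gen, rule UnI1, rule UnI2, rule UN_I[of i], simp, rule UN_I[of j], simp, simp only: insert_iff simp_thms)+
  have EF: "gE i * gF j - gF j * gE i -
         (if i = j then fa_const (1 / (qi i - inverse (qi i))) * (gK i - gKi i) else 0) \<in> UJ" for j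
    by (rule fa_ideal_gen, unfold uq_rels_def, rule UnI1, rule UnI2, blast)
  show "gE i * gF i - gF i * gE i - fa_const (hh i) * (gK i - gKi i) \<in> UJ"
    using EF[of i] by (simp add: hh_def)
  show "i \<noteq> j \<Longrightarrow> gE i * gF j - gF j * gE i \<in> UJ"
    using EF[of j] by simp
  show "i \<noteq> j \<Longrightarrow> q_generic.serre_poly (qi i) (N i j) (gE i) (gE j) \<in> UJ"
    "i \<noteq> j \<Longrightarrow> q_generic.serre_poly (qi i) (N i j) (gF i) (gF j) \<in> UJ"
    unfolding uq_rels_def by (rule fa_ideal_gen, rule UnI2, rule UN_I[of i], simp, rule UN_I[of j], simp, simp only: insert_iff simp_thms)+
qed

lemma K_conj:
  assumes "gK i * w * gKi i - fa_const c * w \<in> UJ"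
  shows "gK i * w - fa_const c * w * gK i \<in> UJ"
proof -
  have "gK i * w - fa_const c * w * gK i = (gK i * w * gKi i - fa_const c * w) * gK i - gK i * w * (gKi i * gK i - 1)"
    by (simp add: algebra_simps)
  also have "\<dots> \<in> UJ" by (intro UJI(6) UJI(4)[OF assms] UJI(3)[OF UJ_rels(2)])
  finally show ?thesis .
qed

lemma Ki_E: "gKi i * gE j - fa_const (q powi (- ip i j)) * gE j * gKi i \<in> UJ"
  using q0 by (intro conj_inverse_ideal[OF two_sided_UJ UJ_rels(1,2) K_conj[OF UJ_rels(4)]])
    (simp add: power_int_minus)

lemma Ki_F: "gKi i * gF j - fa_const (q powi (ip i j)) * gF j * gKi i \<in> UJ"
  using q0 by (intro conj_inverse_ideal[OF two_sided_UJ UJ_rels(1,2) K_conj[OF UJ_rels(5)]])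
    (simp add: power_int_minus)

lemma Ki_Ki: "gKi i * gKi j - gKi j * gKi i \<in> UJ"
proof -
  have "gKi i * gK j - fa_const 1 * gK j * gKi i \<in> UJ"
    using UJ_rels(3)[of i j] by (intro conj_inverse_ideal[OF two_sided_UJ UJ_rels(1,2), where c = 1]) auto
  then have "gK j * gKi i - fa_const 1 * gKi i * gK j \<in> UJ"
    using UJI(5) by fastforce
  from conj_inverse_ideal[OF two_sided_UJ UJ_rels(1,2) this, of 1] UJI(5) show ?thesis
    by fastforce
qed

definition ge :: "'i \<Rightarrow> ('i uq_gen, 'k) free_algebra" where "ge i = - (gKi i * gE i)"
definition gz :: "'i \<Rightarrow> ('i uq_gen, 'k) free_algebra" where "gz i = gKi i * gKi i"

lemma ip_diag: "ip i i = d i * 2"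
  by (simp add: ip_def a_diag)

lemma qi_powi: "qi i powi n = q powi (d i * n)"
  by (simp add: qi_def power_int_mult)

lemma qi_power: "qi i ^ n = q powi (d i * int n)"
  using qi_powi[of i "int n"] by simp

lemma e_x: "ge i * gF i - (fa_const (qi i ^ 2) * gF i * ge i - fa_const (hh i) * (1 - gz i)) \<in> UJ"
proof -
  have c: "q powi (ip i i) = qi i ^ 2" by (simp add: ip_diag qi_power)
  have "ge i * gF i - (fa_const (qi i ^ 2) * gF i * ge i - fa_const (hh i) * (1 - gz i)) =
    - (gKi i * (gE i * gF i - gF i * gE i - fa_const (hh i) * (gK i - gKi i)))
    - (gKi i * gF i - fa_const (qi i ^ 2) * gF i * gKi i) * gE i - fa_const (hh i) * (gKi i * gK i - 1)"
    by (simp add: ge_def gz_def algebra_simps fa_const_pull)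
  also have "\<dots> \<in> UJ"
    by (intro UJI(6) UJI(5) UJI(3)[OF UJ_rels(6)] UJI(3)[OF UJ_rels(2)] UJI(4)[OF Ki_F[of i i, unfolded c]])
  finally show ?thesis .
qed

lemma e_y:
  assumes "i \<noteq> j" shows "ge i * gF j - fa_const (q powi ip i j) * gF j * ge i \<in> UJ"
proof -
  have "ge i * gF j - fa_const (q powi ip i j) * gF j * ge i =
    - (gKi i * (gE i * gF j - gF j * gE i)) - (gKi i * gF j - fa_const (q powi ip i j) * gF j * gKi i) * gE i"
    by (simp add: ge_def algebra_simps fa_const_pull)
  also have "\<dots> \<in> UJ"
    by (intro UJI(6) UJI(5) UJI(3)[OF UJ_rels(7)[OF assms]] UJI(4)[OF Ki_F])
  finally show ?thesis .
qed

lemma z_F: "gz i * gF j - fa_const ((q powi ip i j) ^ 2) * gF j * gz i \<in> UJ"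
proof -
  have "gz i * gF j - fa_const ((q powi ip i j) ^ 2) * gF j * gz i =
    gKi i * (gKi i * gF j - fa_const (q powi ip i j) * gF j * gKi i)
    + fa_const (q powi ip i j) * (gKi i * gF j - fa_const (q powi ip i j) * gF j * gKi i) * gKi i"
    by (simp add: gz_def algebra_simps fa_const_pull power2_eq_square)
  also have "\<dots> \<in> UJ"
    by (intro UJI(2) UJI(3)[OF Ki_F] UJI(4)[OF UJI(3)[OF Ki_F]])
  finally show ?thesis .
qed

lemma Ki_e: "gKi i * ge j - fa_const (q powi (- ip i j)) * ge j * gKi i \<in> UJ"
proof -
  have "gKi i * ge j - fa_const (q powi (- ip i j)) * ge j * gKi i =
    - (gKi j * (gKi i * gE j - fa_const (q powi (- ip i j)) * gE j * gKi i)) - (gKi i * gKi j - gKi j * gKi i) * gE j"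
    by (simp add: ge_def algebra_simps fa_const_pull)
  also have "\<dots> \<in> UJ"
    by (intro UJI(6) UJI(5) UJI(3)[OF Ki_E] UJI(4)[OF Ki_Ki])
  finally show ?thesis .
qed

lemma z_e: "gz i * ge j - fa_const ((q powi (- ip i j)) ^ 2) * ge j * gz i \<in> UJ"
proof -
  have "gz i * ge j - fa_const ((q powi (- ip i j)) ^ 2) * ge j * gz i =
    gKi i * (gKi i * ge j - fa_const (q powi (- ip i j)) * ge j * gKi i)
    + fa_const (q powi (- ip i j)) * (gKi i * ge j - fa_const (q powi (- ip i j)) * ge j * gKi i) * gKi i"
    by (simp add: gz_def algebra_simps fa_const_pull power2_eq_square)
  also have "\<dots> \<in> UJ"
    by (intro UJI(2) UJI(3)[OF Ki_e] UJI(4)[OF UJI(3)[OF Ki_e]])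
  finally show ?thesis .
qed

text \<open>The twisted elements \<open>-K\<^sub>i\<^sup>-\<^sup>1 E\<^sub>i\<close> again satisfy the quantum Serre relations, because
  the \<open>K\<close>-factors can be collected on the left at the cost of a common scalar.\<close>

lemma serre_e:
  assumes ij: "i \<noteq> j"
  shows "dch (\<lambda>n. inverse (qi i) powi (a i j + 2 * int n)) (\<lambda>_. 0) (ge i) (ge j) (N i j) \<in> UJ"
proof -
  interpret qq: q_generic "qi i" by (rule qi_generic)
  define c where "c n = inverse (qi i) powi (a i j + 2 * int n)" for n
  define m where "m n = qi i powi (a i j + 2 * int n)" for n
  have mc: "m n * c n = 1" "c n * m n = 1" for n
    using qq.p0 by (simp_all add: m_def c_def power_int_inverse)
  have m_Suc: "m (Suc n) = qi i ^ 2 * m n" for n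
    using qq.p0 by (simp add: m_def power_int_add distrib_left)
  define f where "f = dch c (\<lambda>_. 0) (ge i) (ge j)"
  define g where "g = dch c (\<lambda>_. 0) (gE i) (gE j)"
  have g0: "g 0 = gE j" and gS: "g (Suc n) = gE i * g n - fa_const (c n) * g n * gE i" for n
    by (simp_all add: g_def dch_Suc)
  have f0: "f 0 = ge j" and fS: "f (Suc n) = ge i * f n - fa_const (c n) * f n * ge i" for n
    by (simp_all add: f_def dch_Suc)
  have EK: "gE i * gKi i - fa_const (qi i ^ 2) * gKi i * gE i \<in> UJ"
  proof -
    have "gE i * gKi i - fa_const (qi i ^ 2) * gKi i * gE i =
      - (fa_const (qi i ^ 2) * (gKi i * gE i - fa_const (q powi (- ip i i)) * gE i * gKi i))"
      using q0 by (simp add: algebra_simps fa_const_pull qi_power ip_diag power_int_add [symmetric])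
    also have "\<dots> \<in> UJ" by (intro UJI(5) UJI(3)[OF Ki_E])
    finally show ?thesis .
  qed
  have gK: "g n * gKi i - fa_const (m n) * gKi i * g n \<in> UJ" for n
  proof (induction n)
    case 0
    have "gE j * gKi i - fa_const (m 0) * gKi i * gE j =
      - (fa_const (m 0) * (gKi i * gE j - fa_const (q powi (- ip i j)) * gE j * gKi i))"
      using q0 by (simp add: algebra_simps fa_const_pull m_def ip_def qi_powi power_int_add [symmetric])
    also have "\<dots> \<in> UJ" by (intro UJI(5) UJI(3)[OF Ki_E])
    finally show ?case by (simp add: g0)
  next
    case (Suc n)
    have "g (Suc n) * gKi i - fa_const (m (Suc n)) * gKi i * g (Suc n) =
      gE i * (g n * gKi i - fa_const (m n) * gKi i * g n)
      + fa_const (m n) * (gE i * gKi i - fa_const (qi i ^ 2) * gKi i * gE i) * g n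
      - fa_const (c n) * g n * (gE i * gKi i - fa_const (qi i ^ 2) * gKi i * gE i)
      - fa_const (c n * qi i ^ 2) * (g n * gKi i - fa_const (m n) * gKi i * g n) * gE i"
      by (simp add: gS m_Suc algebra_simps fa_const_pull)
    also have "\<dots> \<in> UJ"
      by (intro UJI(6) UJI(2) UJI(3)[OF Suc] UJI(4)[OF UJI(3)[OF EK]] UJI(3)[OF EK] UJI(4)[OF UJI(3)[OF Suc]])
    finally show ?case .
  qed
  \<comment> \<open>\<open>M\<close> is the collected product of K_j^-1 and n copies of K_i^-1 with
    its scalar. Its commutation with E_i and K_i^-1 is carried along because the next step has to
    move it past them.\<close>
  have "\<exists>M. gE i * M - fa_const (m n) * M * gE i \<in> UJ \<and> M * gKi i - gKi i * M \<in> UJ \<and> f n - M * g n \<in> UJ" for n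
  proof (induction n)
    case 0
    have "gE i * (- gKi j) - fa_const (m 0) * (- gKi j) * gE i =
      fa_const (m 0) * (gKi j * gE i - fa_const (q powi (- ip j i)) * gE i * gKi j)"
      using q0 by (simp add: algebra_simps fa_const_pull m_def ip_sym[of j i] qi_powi power_int_add [symmetric])
        (simp add: ip_def)
    then have "gE i * (- gKi j) - fa_const (m 0) * (- gKi j) * gE i \<in> UJ"
      by (simp only: UJI(3)[OF Ki_E])
    moreover have "(- gKi j) * gKi i - gKi i * (- gKi j) \<in> UJ"
      using Ki_Ki[of i j] by simp
    moreover have "f 0 - (- gKi j) * g 0 \<in> UJ" by (simp add: f0 g0 ge_def UJI)
    ultimately show ?case by blast
  next
    case (Suc n)
    then obtain M where M: "gE i * M - fa_const (m n) * M * gE i \<in> UJ" "M * gKi i - gKi i * M \<in> UJ" "f n - M * g n \<in> UJ"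
      by blast
    let ?M = "fa_const (- m n) * gKi i * M"
    have "gE i * ?M - fa_const (m (Suc n)) * ?M * gE i =
      fa_const (- m n) * (gE i * gKi i - fa_const (qi i ^ 2) * gKi i * gE i) * M
      + fa_const (- m n * qi i ^ 2) * gKi i * (gE i * M - fa_const (m n) * M * gE i)"
      by (simp add: m_Suc algebra_simps fa_const_pull fa_const_uminus)
    also have "\<dots> \<in> UJ" by (intro UJI(2) UJI(4)[OF UJI(3)[OF EK]] UJI(3)[OF M(1)])
    finally have 1: "gE i * ?M - fa_const (m (Suc n)) * ?M * gE i \<in> UJ" .
    have "?M * gKi i - gKi i * ?M = fa_const (- m n) * gKi i * (M * gKi i - gKi i * M)"
      by (simp add: algebra_simps fa_const_pull)
    then have 2: "?M * gKi i - gKi i * ?M \<in> UJ" by (simp only: UJI(3)[OF M(2)])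
    have "f (Suc n) - ?M * g (Suc n) = ge i * (f n - M * g n) - fa_const (c n) * (f n - M * g n) * ge i
      - gKi i * (gE i * M - fa_const (m n) * M * gE i) * g n
      + fa_const (c n) * M * (g n * gKi i - fa_const (m n) * gKi i * g n) * gE i
      + (M * gKi i - gKi i * M) * g n * gE i"
      using mc by (simp add: fS gS ge_def algebra_simps fa_const_pull fa_const_uminus)
    also have "\<dots> \<in> UJ"
      by (intro UJI(6) UJI(2) UJI(3)[OF M(3)] UJI(4)[OF UJI(3)[OF M(3)]] UJI(4)[OF UJI(3)[OF M(1)]]
          UJI(4)[OF UJI(3)[OF gK]] UJI(4)[OF UJI(4)[OF M(2)]])
    finally show ?case using 1 2 by blast
  qed
  then obtain M where "f (N i j) - M * g (N i j) \<in> UJ" by blast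
  moreover have "g (N i j) = qq.serre_poly (N i j) (gE i) (gE j)"
    using qq.serre_dch[OF a_range[OF ij], of "inverse (qi i)" "gE i" "gE j"] by (simp add: N_def g_def c_def[abs_def])
  ultimately have "f (N i j) - M * g (N i j) + M * g (N i j) \<in> UJ"
    using UJ_rels(8)[OF ij] by (intro UJI(2) UJI(3)) auto
  then show ?thesis by (simp add: f_def c_def[abs_def])
qed

definition drel :: "'i \<Rightarrow> 'i \<Rightarrow> ('i, 'k) free_algebra" where
  "drel i j = bip (dlist (qi i) (inverse (qi i)) (a i j)) (fa_gen i) (fa_gen j)"

lemma ev_bip: "ev (bip f x y) = bip f (ev x) (ev y)"
  by (induction f) (auto simp: ev_def fa_hom_linear)

text \<open>The relation is linear in the middle generator, so F_j and -K_j^-1 E_j are treated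
  separately. For the second, -K_i^-1 E_i becomes the leading part, F_i the perturbation, and q_i is
  replaced by its inverse, under which \<open>dlist\<close> is invariant.\<close>

lemma ev_drel:
  assumes ij: "i \<noteq> j" shows "ev (drel i j) \<in> UJ"
proof -
  interpret qq: q_generic "qi i" by (rule qi_generic)
  let ?p = "qi i"
  have r2: "1 - inverse ?p ^ 2 \<noteq> 0" "?p ^ 2 \<noteq> 1"
    using qq.p_power[of 2] qq.p0 by (auto simp: power_inverse)
  have pm: "?p - inverse ?p = ?p * (1 - inverse ?p ^ 2)"
    using qq.p0 by (simp add: power2_eq_square algebra_simps)
  have h: "hh i * (1 - inverse ?p ^ 2) = inverse ?p"
  proof -
    obtain y where y: "y = 1 - inverse ?p ^ 2" by blast
    show ?thesis unfolding hh_def pm using r2(1) unfolding y[symmetric] by (simp add: inverse_eq_divide)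
  qed
  have ipa: "q powi ip i j = ?p powi a i j" by (rule qi_ip)
  have ipa': "q powi (- ip i j) = inverse ?p powi a i j"
    using qi_ip[of i j] by (simp add: power_int_minus power_int_inverse)
  have ipd: "q powi ip i i = ?p ^ 2" "q powi (- ip i i) = inverse ?p ^ 2"
    by (simp_all add: ip_diag qi_power power_int_minus power_inverse flip: qi_power)
       (simp_all add: qi_power)
  have sF: "dch (\<lambda>n. ?p powi (a i j + 2 * int n)) (\<lambda>_. 0) (gF i) (gF j) (nat (1 - a i j)) \<in> UJ"
    using qq.serre_dch[OF a_range[OF ij], of ?p "gF i" "gF j"] UJ_rels(9)[OF ij] by (simp add: N_def)
  have 1: "bip (dlist ?p (inverse ?p) (a i j)) (gF i + ge i) (gF j) \<in> UJ"
    using e_x[of i] e_y[OF ij] z_F[of i i] z_F[of i j]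
    by (intro deformed_chain[OF two_sided_UJ qq.p0 a_range[OF ij] h, where z = "gz i"] sF)
      (simp_all add: ipa ipd flip: power_mult)
  have h': "- (inverse ?p ^ 2 * hh i) * (1 - inverse (inverse ?p) ^ 2) = inverse ?p"
  proof -
    have "inverse ?p ^ 2 * (1 - ?p ^ 2) = - (1 - inverse ?p ^ 2)"
      using qq.p0 by (simp add: algebra_simps power_inverse)
    then have "- (inverse ?p ^ 2 * hh i) * (1 - ?p ^ 2) = hh i * (1 - inverse ?p ^ 2)"
      by (metis (no_types, lifting) minus_mult_commute mult.commute mult.left_commute minus_minus)
    then show ?thesis using h by simp
  qed
  have x_e: "gF i * ge i - (fa_const (inverse ?p ^ 2) * ge i * gF i - fa_const (- (inverse ?p ^ 2 * hh i)) * (1 - gz i)) \<in> UJ"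
  proof -
    have "inverse ?p ^ 2 * ?p ^ 2 = 1" using qq.p0 by (simp add: power_inverse)
    then have "gF i * ge i - (fa_const (inverse ?p ^ 2) * ge i * gF i - fa_const (- (inverse ?p ^ 2 * hh i)) * (1 - gz i)) =
      - (fa_const (inverse ?p ^ 2) * (ge i * gF i - (fa_const (?p ^ 2) * gF i * ge i - fa_const (hh i) * (1 - gz i))))"
      by (simp add: algebra_simps fa_const_pull fa_const_uminus)
    then show ?thesis by (simp only: UJI(5)[OF UJI(3)[OF e_x]])
  qed
  have x_f: "gF i * ge j - fa_const (inverse ?p powi a i j) * ge j * gF i \<in> UJ"
  proof -
    have "inverse ?p powi a i j * ?p powi a i j = 1" using qq.p0 by (simp add: power_int_inverse)
    moreover have "q powi ip j i = ?p powi a i j" using ipa by (simp add: ip_sym[of j i])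
    ultimately have "gF i * ge j - fa_const (inverse ?p powi a i j) * ge j * gF i =
      - (fa_const (inverse ?p powi a i j) * (ge j * gF i - fa_const (q powi ip j i) * gF i * ge j))"
      by (simp add: algebra_simps fa_const_pull)
    then show ?thesis by (simp only: UJI(5)[OF UJI(3)[OF e_y[OF not_sym[OF ij]]]])
  qed
  have sE: "dch (\<lambda>n. inverse ?p powi (a i j + 2 * int n)) (\<lambda>_. 0) (ge i) (ge j) (nat (1 - a i j)) \<in> UJ"
    using serre_e[OF ij] by (simp add: N_def)
  have "bip (dlist (inverse ?p) (inverse ?p) (a i j)) (ge i + gF i) (ge j) \<in> UJ"
    using z_e[of i i] z_e[of i j] qq.p0 x_e x_f
    by (intro deformed_chain[OF two_sided_UJ _ a_range[OF ij] h', where z = "gz i"] sE)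
      (simp_all add: ipa' ipd flip: power_mult)
  then have 2: "bip (dlist ?p (inverse ?p) (a i j)) (gF i + ge i) (ge j) \<in> UJ"
    by (simp add: dlist_inverse add.commute)
  have "ev (fa_gen k) = gF k + ge k" for k by (simp add: ev_def ge_def)
  then have "ev (drel i j) = bip (dlist ?p (inverse ?p) (a i j)) (gF i + ge i) (gF j + ge j)"
    by (simp add: drel_def ev_bip)
  then show ?thesis using UJI(2)[OF 1 2] by (simp add: bip_add)
qed

end

section \<open>Evaluation at \<open>x = c\<close>\<close>

definition prodx :: "('a, 'k::field) free_algebra \<Rightarrow> 'k list \<Rightarrow> ('a, 'k) free_algebra" where
  "prodx x cs = prod_list (map (\<lambda>c. x - fa_const c) cs)"

lemma prodx_simps [simp]:
  "prodx x [] = 1" "prodx x (c # cs) = (x - fa_const c) * prodx x cs"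
  "prodx x (cs @ ds) = prodx x cs * prodx x ds"
  by (simp_all add: prodx_def)

lemma prodx_remainder: "\<exists>Q. prodx x cs = Q * (x - fa_const c) + fa_const (prod_list (map (\<lambda>d. c - d) cs))"
proof (induction cs)
  case (Cons d cs)
  then obtain Q where Q: "prodx x cs = Q * (x - fa_const c) + fa_const (prod_list (map (\<lambda>d. c - d) cs))" by blast
  let ?r = "prod_list (map (\<lambda>d. c - d) cs)"
  have "prodx x (d # cs) = ((x - fa_const d) * Q + fa_const ?r) * (x - fa_const c) + fa_const ((c - d) * ?r)"
    by (simp add: Q algebra_simps fa_const_pull fa_const_ring)
  then show ?case by auto
qed (auto intro: exI[of _ 0])

section \<open>The kernel, its degree filtration, and separation by the left ideals generated by B_i
  - c\<close>

context cartan_datum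
begin

definition ker :: "('i, 'k) free_algebra set" where "ker = {p. ev p \<in> UJ}"

lemma two_sided_ker: "two_sided ker"
  unfolding two_sided_def ker_def by (auto simp: ev_linear ev_def fa_hom_linear intro: UJI)

lemmas kerI = two_sidedD[OF two_sided_ker]

lemma drel_ker: "i \<noteq> j \<Longrightarrow> drel i j \<in> ker"
  by (simp add: ker_def ev_drel)

text \<open>The coefficients of \<open>dlist\<close> that contain m all belong to terms of lower
  degree.\<close>

lemma drel_leading:
  assumes ij: "i \<noteq> j" shows "deglt (N i j + 1) (drel i j - serre_rel i j)"
proof -
  interpret qq: q_generic "qi i" by (rule qi_generic)
  let ?p = "qi i" and ?x = "fa_gen i :: ('i, 'k) free_algebra" and ?y = "fa_gen j :: ('i, 'k) free_algebra"
  have s: "serre_rel i j = bip (dlist ?p 0 (a i j)) ?x ?y"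
    using qq.serre_dch[OF a_range[OF ij], of ?p ?x ?y] dch_dlist[OF a_range[OF ij] qq.p0, of 0 0 "\<lambda>_. 0" ?x ?y]
    by (simp add: serre_rel_def N_def)
  have h: "deglt k (fa_const c * ?x ^ m * ?y * ?x ^ n)" if "m + n + 1 < k" for c m n k
  proof -
    have "homog (0 + 1 * m + 1 + 1 * n) (fa_const c * ?x ^ m * ?y * ?x ^ n)"
      by (intro homog_mult homog_const homog_power homog_gen)
    then show ?thesis using homog_deglt that deglt_mono by fastforce
  qed
  define low where "low = (\<lambda>(m::'k) (b::int). let t1 = ?p + inverse ?p; t2 = ?p ^ 2 + inverse ?p ^ 2; t3 = ?p ^ 3 + inverse ?p ^ 3; k3 = (t2 + 1) ^ 2 * m in
    if b = 0 then [] else if b = -1 then [(m,0::nat,0::nat)]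
    else if b = -2 then [(t1 ^ 2 * m,1,0), (- (t1 ^ 2 * m),0,1)]
    else [(m + k3,2,0), (- (t1 * k3 + t3 * m),1,1), (m + k3,0,2), (m * k3,0,0)])"
  have l: "bip (dlist ?p m (a i j)) ?x ?y - bip (dlist ?p 0 (a i j)) ?x ?y = bip (low m (a i j)) ?x ?y" for m
    using a_range[OF ij] by (auto simp: dlist_def low_def Let_def)
  have "deglt (N i j + 1) (bip (low m (a i j)) ?x ?y)" for m
  proof -
    have "deglt k (bip f ?x ?y)" if "\<forall>(c, m, n)\<in>set f. m + n + 1 < k" for f k
      using that by (induction f) (auto intro!: deglt_add h)
    then show ?thesis using a_range[OF ij] by (auto simp: low_def Let_def N_def simp del: bip_simps)
  qed
  then show ?thesis by (simp add: s drel_def l)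
qed

text \<open>Replacing every Serre relation by its deformation keeps the leading term and moves the
  element into the kernel. Together with \<open>leading_in_serre\<close> this identifies the leading
  terms of \<open>ker\<close> with the Serre ideal.\<close>

lemma serre_lift:
  assumes "s \<in> serre_ideal" shows "\<exists>l. deglt n l \<and> hcomp n s + l \<in> ker"
  using assms
proof (induction rule: serre_induct)
  case zero
  show ?case by (rule exI[of _ 0]) (simp add: fa_linearD[OF fa_linear_comp] kerI)
next
  case (step p i j u c v)
  then obtain l where l: "deglt n l" "hcomp n p + l \<in> ker" by blast
  let ?s = "Poly_Mapping.single (Word u) c * serre_rel i j * mon v"
  let ?d = "length u + (N i j + 1) + length v"
  have h: "homog ?d ?s" by (intro homog_mult homog_single serre_rel_homog)
  show ?case
  proof (cases "n = ?d")
    case False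
    then show ?thesis using l comp_homog[OF h, of n] by (auto simp: fa_linearD[OF fa_linear_comp])
  next
    case True
    let ?l = "Poly_Mapping.single (Word u) c * (drel i j - serre_rel i j) * mon v"
    have "deglt ?d ?l"
      by (intro deglt_mult' deglt_mult drel_leading homog_deglt homog_single step)
    moreover have "hcomp n (p + ?s) + (l + ?l) = (hcomp n p + l) + Poly_Mapping.single (Word u) c * drel i j * mon v"
      using comp_homog[OF h, of n] True by (simp add: fa_linearD[OF fa_linear_comp] algebra_simps)
    moreover have "(hcomp n p + l) + Poly_Mapping.single (Word u) c * drel i j * mon v \<in> ker"
      by (intro kerI(2) l kerI(4) kerI(3) drel_ker step)
    ultimately show ?thesis using deglt_add[of n l ?l] l(1) unfolding True by metis
  qed
qed

text \<open>The preimage in the free algebra of the degree filtration on the coideal subalgebra. Its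
  graded pieces are those of the free algebra modulo the Serre ideal.\<close>

definition filt :: "nat \<Rightarrow> ('i, 'k) free_algebra set" where
  "filt n = {p. \<exists>r. deglt n r \<and> p - r \<in> ker}"

lemma filtI: "deglt n r \<Longrightarrow> p - r \<in> ker \<Longrightarrow> p \<in> filt n"
  by (auto simp: filt_def)

lemma filt_deglt: "deglt n p \<Longrightarrow> p \<in> filt n"
  by (rule filtI) (auto simp: kerI)

lemma filt_mono: "p \<in> filt n \<Longrightarrow> n \<le> m \<Longrightarrow> p \<in> filt m"
  by (auto simp: filt_def intro: deglt_mono)

lemma filt_add: "p \<in> filt n \<Longrightarrow> r \<in> filt n \<Longrightarrow> p + r \<in> filt n"
proof -
  assume "p \<in> filt n" "r \<in> filt n"
  then obtain p' r' where "deglt n p'" "p - p' \<in> ker" "deglt n r'" "r - r' \<in> ker" by (auto simp: filt_def)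
  then have "deglt n (p' + r')" "(p + r) - (p' + r') \<in> ker"
    using kerI(2)[of "p - p'" "r - r'"] by (auto intro: deglt_add simp: algebra_simps)
  then show ?thesis by (rule filtI)
qed

lemma filt_ker: "p \<in> filt n \<Longrightarrow> p - r \<in> ker \<Longrightarrow> r \<in> filt n"
proof -
  assume "p \<in> filt n" "p - r \<in> ker"
  then obtain p' where "deglt n p'" "p - p' \<in> ker" by (auto simp: filt_def)
  then show ?thesis using kerI(6)[of "p - p'" "p - r"] \<open>p - r \<in> ker\<close> by (intro filtI) auto
qed

text \<open>The leading term of u times the generator lies in the Serre ideal, so that of u does by
  \<open>serre_cancel_gen\<close>, and \<open>serre_lift\<close> trades it for terms of lower
  degree.\<close>

lemma filt_cancel_gen:
  assumes u: "deglt (Suc n) u" and ux: "u * fa_gen i \<in> filt (Suc n)"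
  shows "u \<in> filt n"
proof -
  obtain r where r: "deglt (Suc n) r" "u * fa_gen i - r \<in> ker" using ux by (auto simp: filt_def)
  have d: "deglt (Suc (Suc n)) (u * fa_gen i - r)"
    using deglt_mult'[OF u homog_deglt[OF homog_gen[of i]]] deglt_mono[OF r(1), of "Suc (Suc n)"] by (intro deglt_diff) auto
  have "hcomp (Suc n) (u * fa_gen i - r) \<in> serre_ideal"
    using leading_in_serre[OF _ d] r(2) by (simp add: ker_def)
  moreover have "hcomp (Suc n) (u * fa_gen i - r) = hcomp n u * fa_gen i"
  proof -
    have "u * fa_gen i = hcomp n u * fa_gen i + (u - hcomp n u) * fa_gen i" by (simp add: algebra_simps)
    moreover have "hcomp (Suc n) (hcomp n u * fa_gen i) = hcomp n u * fa_gen i"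
      using comp_homog[OF homog_mult[OF homog_comp homog_gen], of "Suc n" n u i] by simp
    moreover have "hcomp (Suc n) ((u - hcomp n u) * fa_gen i) = 0"
      using comp_deglt[OF deglt_mult'[OF deglt_comp_decomp[OF u] homog_deglt[OF homog_gen]]] by simp
    ultimately show ?thesis using comp_deglt[OF r(1)] by (simp add: fa_linearD[OF fa_linear_comp])
  qed
  ultimately have "hcomp n u \<in> serre_ideal" using serre_cancel_gen by simp
  from serre_lift[OF this, of n] obtain l where l: "deglt n l" "hcomp n (hcomp n u) + l \<in> ker" by blast
  have "hcomp n (hcomp n u) = hcomp n u" by (subst comp_homog[OF homog_comp]) simp
  then have "u - (u - hcomp n u - l) \<in> ker" using l(2) by (simp add: add.commute)
  then show ?thesis by (rule filtI[rotated]) (intro deglt_diff deglt_comp_decomp u l)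
qed

lemma deglt_prodx: "deglt (Suc n) u \<Longrightarrow> deglt (Suc (n + length cs)) (u * prodx (fa_gen i) cs)"
proof (induction cs arbitrary: u n)
  case (Cons c cs)
  have "deglt (Suc n + 1) (u * (fa_gen i - fa_const c))"
  proof (rule deglt_mult'[OF Cons.prems])
    have "deglt (Suc 1) (fa_const c)" by (rule deglt_mono[OF homog_deglt[OF homog_const]]) simp
    then show "deglt (Suc 1) (fa_gen i - fa_const c)" by (intro deglt_diff homog_deglt[OF homog_gen])
  qed
  then have "deglt (Suc (Suc n + length cs)) (u * (fa_gen i - fa_const c) * prodx (fa_gen i) cs)"
    by (intro Cons) simp
  then show ?case by (simp add: mult.assoc)
qed simp

lemma filt_cancel_prodx:
  assumes "deglt (Suc n) u" "u * prodx (fa_gen i) cs \<in> filt (n + length cs)"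
  shows "u \<in> filt n"
  using assms
proof (induction cs rule: rev_induct)
  case (snoc c cs)
  let ?w = "u * prodx (fa_gen i) cs"
  have d: "deglt (Suc (n + length cs)) ?w" by (intro deglt_prodx snoc)
  have "?w * fa_gen i = u * prodx (fa_gen i) (cs @ [c]) + fa_const c * ?w"
    by (simp add: algebra_simps fa_const_pull)
  also have "\<dots> \<in> filt (Suc (n + length cs))"
    by (rule filt_add[OF _ filt_deglt[OF deglt_const_mult[OF d]]]) (use snoc.prems(2) in \<open>simp del: prodx_simps\<close>)
  finally have "?w \<in> filt (n + length cs)" using filt_cancel_gen[OF d] by simp
  then show ?case using snoc by simp
qed simp

text \<open>Multiplication by the product raises the degree by \<open>length cs\<close>. A result of
  degree below D therefore forces the degree of u down step by step, modulo the kernel, until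
  nothing is left.\<close>

lemma ker_prodx:
  assumes "u * prodx (fa_gen i) cs \<in> filt D" "D \<le> length cs" "deglt n u"
  shows "u \<in> ker"
  using assms(1,3)
proof (induction n arbitrary: u)
  case 0
  then show ?case using deglt_0 kerI by blast
next
  case (Suc n)
  have "u \<in> filt n"
    by (rule filt_cancel_prodx[OF Suc.prems(2)], rule filt_mono[OF Suc.prems(1)]) (use assms(2) in simp)
  then obtain r where r: "deglt n r" "u - r \<in> ker" by (auto simp: filt_def)
  have "r * prodx (fa_gen i) cs \<in> filt D"
  proof (rule filt_ker[OF Suc.prems(1)])
    show "u * prodx (fa_gen i) cs - r * prodx (fa_gen i) cs \<in> ker"
      using kerI(4)[OF r(2)] by (simp add: left_diff_distrib)
  qed
  then have "r \<in> ker" using Suc.IH r(1) by blast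
  then show ?case using kerI(2)[OF r(2), of r] by simp
qed

definition wset :: "'i \<Rightarrow> 'k \<Rightarrow> ('i, 'k) free_algebra set" where
  "wset i c = {p. \<exists>u. p - u * (fa_gen i - fa_const c) \<in> ker}"

lemma wset_zero: "0 \<in> wset i c"
  unfolding wset_def by (auto intro!: exI[of _ 0] simp: kerI)

lemma wset_add: "p \<in> wset i c \<Longrightarrow> r \<in> wset i c \<Longrightarrow> p + r \<in> wset i c"
proof -
  assume "p \<in> wset i c" "r \<in> wset i c"
  then obtain u v where "p - u * (fa_gen i - fa_const c) \<in> ker" "r - v * (fa_gen i - fa_const c) \<in> ker"
    by (auto simp: wset_def)
  from kerI(2)[OF this] have "(p + r) - (u + v) * (fa_gen i - fa_const c) \<in> ker"
    by (simp add: algebra_simps)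
  then show ?thesis by (auto simp: wset_def)
qed

lemma wset_mult: "p \<in> wset i c \<Longrightarrow> r * p \<in> wset i c"
proof -
  assume "p \<in> wset i c"
  then obtain u where "p - u * (fa_gen i - fa_const c) \<in> ker" by (auto simp: wset_def)
  from kerI(3)[OF this, of r] have "r * p - (r * u) * (fa_gen i - fa_const c) \<in> ker"
    by (simp add: algebra_simps)
  then show ?thesis by (auto simp: wset_def)
qed

lemma wset_uminus: "p \<in> wset i c \<Longrightarrow> - p \<in> wset i c"
  using wset_mult[of p i c "-1"] by simp

lemma wset_diff: "p \<in> wset i c \<Longrightarrow> r \<in> wset i c \<Longrightarrow> p - r \<in> wset i c"
  using wset_add[of p i c "- r"] wset_uminus[of r] by simp

lemma wset_ker: "p \<in> ker \<Longrightarrow> p \<in> wset i c"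
  unfolding wset_def by (auto intro!: exI[of _ 0])

lemma wset_right: "u * (fa_gen i - fa_const c) \<in> wset i c"
  unfolding wset_def by (auto intro!: exI[of _ u] simp: kerI)

text \<open>An element of \<open>\<Inter> (ker + T (x - c n))\<close> is divisible, modulo the kernel, by arbitrarily long
  products of factors \<open>x - c n\<close>, hence vanishes for degree reasons.\<close>

lemma ker_separation:
  fixes c :: "nat \<Rightarrow> 'k"
  assumes inj: "inj c" and p: "\<And>n. n \<ge> n0 \<Longrightarrow> p \<in> wset i (c n)"
  shows "p \<in> ker"
proof -
  let ?x = "fa_gen i :: ('i, 'k) free_algebra"
  define cs where "cs m = map (\<lambda>k. c (n0 + k)) [0..<m]" for m
  have "\<exists>u. p - u * prodx ?x (cs m) \<in> ker" for m
  proof (induction m)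
    case 0
    show ?case by (rule exI[of _ p]) (simp add: cs_def kerI)
  next
    case (Suc m)
    then obtain u where u: "p - u * prodx ?x (cs m) \<in> ker" by blast
    define d where "d = c (n0 + m)"
    obtain v where v: "p - v * (?x - fa_const d) \<in> ker"
      using p[of "n0 + m"] by (auto simp: wset_def d_def)
    define r where "r = prod_list (map (\<lambda>e. d - e) (cs m))"
    have r0: "r \<noteq> 0" using inj by (auto simp: r_def cs_def d_def prod_list_zero_iff inj_eq)
    obtain Q where Q: "prodx ?x (cs m) = Q * (?x - fa_const d) + fa_const r"
      using prodx_remainder[of ?x "cs m" d] by (auto simp: r_def)
    \<comment> \<open>Modulo the kernel, p is both u Q (x - d) + r u and v (x - d). Solving for u
      uses that d differs from all earlier values, which makes r nonzero.\<close>
    let ?u = "fa_const (1 / r) * (v - u * Q)"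
    have "u - ?u * (?x - fa_const d) = fa_const (1 / r) * ((p - v * (?x - fa_const d)) - (p - u * prodx ?x (cs m)))"
      using r0 by (simp add: Q algebra_simps fa_const_pull)
    also have "\<dots> \<in> ker" by (intro kerI(3) kerI(6) u v)
    finally have "(u - ?u * (?x - fa_const d)) * prodx ?x (cs m) \<in> ker" by (rule kerI(4))
    moreover have "prodx ?x (cs (Suc m)) = (?x - fa_const d) * prodx ?x (cs m)"
    proof -
      have c: "(?x - fa_const e) * (?x - fa_const d) = (?x - fa_const d) * (?x - fa_const e)" for e
        by (simp add: algebra_simps fa_const_pull mult.commute[of e])
      have "prodx ?x l * (?x - fa_const d) = (?x - fa_const d) * prodx ?x l" for l
      proof (induction l)
        case (Cons e l)
        have "prodx ?x (e # l) * (?x - fa_const d) = (?x - fa_const e) * (prodx ?x l * (?x - fa_const d))"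
          by (simp only: prodx_simps mult.assoc)
        also have "\<dots> = (?x - fa_const d) * prodx ?x (e # l)"
          unfolding Cons prodx_simps mult.assoc[symmetric] c ..
        finally show ?case .
      qed simp
      then show ?thesis by (simp add: cs_def d_def)
    qed
    ultimately have "(p - u * prodx ?x (cs m)) + (u - ?u * (?x - fa_const d)) * prodx ?x (cs m) \<in> ker"
      using kerI(2)[OF u] by blast
    moreover have "(p - u * prodx ?x (cs m)) + (u - ?u * (?x - fa_const d)) * prodx ?x (cs m) = p - ?u * prodx ?x (cs (Suc m))"
      unfolding \<open>prodx ?x (cs (Suc m)) = _\<close> by (simp only: left_diff_distrib[of u] mult.assoc) simp
    ultimately have "p - ?u * prodx ?x (cs (Suc m)) \<in> ker" by simp
    then show ?case by blast
  qed
  moreover obtain d where d: "deglt d p" using deglt_ex by blast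
  \<comment> \<open>As many factors as the degree bound of p are enough for
    \<open>ker_prodx\<close>.\<close>
  ultimately obtain u where u: "p - u * prodx ?x (cs d) \<in> ker" by blast
  obtain n where "deglt n u" using deglt_ex by blast
  moreover have "u * prodx ?x (cs d) \<in> filt d" using filt_ker[OF filt_deglt[OF d] u] .
  ultimately have "u \<in> ker" by (intro ker_prodx[of u i "cs d" d]) (auto simp: cs_def)
  then show ?thesis using kerI(2)[OF u kerI(4)[of u "prodx ?x (cs d)"]] by simp
qed

end

section \<open>The maps \<open>\<tau>\<^sub>i\<close>\<close>

definition evl :: "('k \<times> nat \<times> nat) list \<Rightarrow> 'k \<Rightarrow> 'k \<Rightarrow> 'k::field" where
  "evl f l r = (\<Sum>(c, m, n)\<leftarrow>f. c * l ^ m * r ^ n)"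

definition evx :: "('k \<times> nat \<times> nat) list \<Rightarrow> ('a, 'k::field) free_algebra \<Rightarrow> 'k \<Rightarrow> ('a, 'k) free_algebra" where
  "evx f x r = (\<Sum>(c, m, n)\<leftarrow>f. fa_const (c * r ^ n) * x ^ m)"

lemma evl_simps [simp]: "evl [] l r = 0" "evl ((c, m, n) # f) l r = c * l ^ m * r ^ n + evl f l r"
  by (simp_all add: evl_def)

lemma evx_simps [simp]: "evx [] x r = 0" "evx ((c, m, n) # f) x r = fa_const (c * r ^ n) * x ^ m + evx f x r"
  by (simp_all add: evx_def)

section \<open>The eigenvalues of B_i and the values of the formulas at pairs of them\<close>

context q_generic
begin

text \<open>Parametrisation of the eigenvalues of \<open>B\<^sub>i\<close>: the deformed Serre polynomial in \<open>L\<close> and \<open>R\<close>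
  vanishes on the pairs \<open>(ell (m + s), ell m)\<close>, where \<open>s\<close> runs through the weights \<open>a, a + 2, \<dots>, -a\<close>.\<close>

definition ell :: "nat \<Rightarrow> 'k" where
  "ell m = (p ^ m + inverse p * inverse p ^ m) / (p - inverse p)"

definition gauss :: "nat \<Rightarrow> 'k" where
  "gauss m = (-1) ^ m * inverse p ^ (m * (m + 1) div 2)"

lemma gauss_nonzero: "gauss m \<noteq> 0"
  using p0 by (simp add: gauss_def)

lemma gauss_Suc: "gauss (Suc m) = - (inverse p ^ Suc m) * gauss m"
proof -
  have "Suc m * (Suc m + 1) div 2 = m * (m + 1) div 2 + Suc m" by simp
  then show ?thesis by (simp add: gauss_def power_add)
qed

text \<open>Up to a nonzero factor the difference of two values is (p^m - p^n)(1 - p^(-m-n-1)). The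
  second factor reflects the symmetry of the expression under m -> -m-1, and it cannot vanish for
  natural indices.\<close>

lemma inj_ell: "inj ell"
proof (rule injI)
  fix m n assume e: "ell m = ell n"
  let ?r = "inverse p"
  have pr: "p ^ k * ?r ^ k = 1" for k using p0 by (simp add: power_mult_distrib[symmetric])
  have e': "p ^ m + ?r * ?r ^ m = p ^ n + ?r * ?r ^ n"
    using e p_diff by (simp add: ell_def)
  have "(p ^ m - p ^ n) * (1 - ?r * ?r ^ m * ?r ^ n) = (p ^ m + ?r * ?r ^ m) - (p ^ n + ?r * ?r ^ n)
     + ?r * (?r ^ n * (1 - p ^ m * ?r ^ m) - ?r ^ m * (1 - p ^ n * ?r ^ n))"
    by (simp add: algebra_simps)
  also have "\<dots> = 0" using e' pr by simp
  finally consider "p ^ m = p ^ n" | "?r ^ (1 + m + n) = 1" by (auto simp: power_add mult.assoc)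
  then show "m = n"
  proof cases
    case 1
    then show ?thesis using p_powi_inj[of "int m" "int n"] by simp
  next
    case 2
    interpret r: q_generic ?r by (rule q_generic_inverse)
    show ?thesis using r.p_power[of "1 + m + n"] 2 by simp
  qed
qed

text \<open>Shifts of the eigenvalue index are natural numbers: \<open>k\<close> stands for \<open>m - 3\<close>.\<close>

definition wts :: "int \<Rightarrow> nat list" where
  "wts b = (if b = 0 then [3] else if b = -1 then [2,4] else if b = -2 then [1,3,5] else [0,2,4,6])"

text \<open>Sum and product of the two eigenvalues at equal distance on either side of a given one:
  they are the coefficients of the quadratic factors of the deformed Serre polynomial.\<close>

lemma ell_shift:
  "ell (k + 1) + ell (k + 3) = (p + inverse p) * ell (k + 2)"
  "ell (k + 1) * ell (k + 3) = ell (k + 2) ^ 2 + inverse p"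
  "ell (k + 1) + ell (k + 5) = (p ^ 2 + inverse p ^ 2) * ell (k + 3)"
  "ell (k + 1) * ell (k + 5) = ell (k + 3) ^ 2 + (p + inverse p) ^ 2 * inverse p"
  "ell k + ell (k + 6) = (p ^ 3 + inverse p ^ 3) * ell (k + 3)"
  "ell k * ell (k + 6) = ell (k + 3) ^ 2 + (p ^ 2 + inverse p ^ 2 + 1) ^ 2 * inverse p"
proof -
  define r where "r = inverse p"
  define u where "u = p ^ k"
  define v where "v = r ^ k"
  define h where "h = inverse (p - r)"
  have pr: "p * r = 1" using p0 by (simp add: r_def)
  have uv: "u * v = 1" using p0 by (simp add: u_def v_def r_def power_mult_distrib[symmetric])
  have h: "h * (p - r) = 1" using p_diff by (simp add: h_def r_def)
  have l: "ell (k + n) = (u * p ^ n + r * v * r ^ n) * h" "ell k = (u + r * v) * h" for n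
    by (simp_all add: ell_def u_def v_def h_def power_add divide_inverse flip: r_def)
  show "ell (k + 1) + ell (k + 3) = (p + inverse p) * ell (k + 2)"
    unfolding l r_def[symmetric] using pr by Groebner_Basis.algebra
  show "ell (k + 1) * ell (k + 3) = ell (k + 2) ^ 2 + inverse p"
    unfolding l r_def[symmetric] using pr uv h by Groebner_Basis.algebra
  show "ell (k + 1) + ell (k + 5) = (p ^ 2 + inverse p ^ 2) * ell (k + 3)"
    unfolding l r_def[symmetric] using pr by Groebner_Basis.algebra
  show "ell (k + 1) * ell (k + 5) = ell (k + 3) ^ 2 + (p + inverse p) ^ 2 * inverse p"
    unfolding l r_def[symmetric] using pr uv h by Groebner_Basis.algebra
  show "ell k + ell (k + 6) = (p ^ 3 + inverse p ^ 3) * ell (k + 3)"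
    unfolding l r_def[symmetric] using pr by Groebner_Basis.algebra
  show "ell k * ell (k + 6) = ell (k + 3) ^ 2 + (p ^ 2 + inverse p ^ 2 + 1) ^ 2 * inverse p"
    unfolding l r_def[symmetric] using pr uv h by Groebner_Basis.algebra
qed

lemma quad_product:
  "(x ^ 2 - fa_const (A * e) * x + fa_const (e ^ 2 + m)) * (x ^ 2 - fa_const (B * e) * x + fa_const (e ^ 2 + k)) =
    evx [(1,4,0), (- (A + B),3,1), (2 + A * B,2,2), (- (A + B),1,3), (1,0,4),
      (m + k,2,0), (- (A * k + B * m),1,1), (m + k,0,2), (m * k,0,0)] x e"
proof -
  have "e * (e * 2) = e * e + e * e" by (simp add: algebra_simps)
  then have "fa_const (e * (e * 2)) * (x * x) = fa_const (e * e) * (x * x) + fa_const (e * e) * (x * x)"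
    by (simp only: fa_const_add distrib_right)
  then show ?thesis
    by (simp add: fa_const_ring algebra_simps fa_const_pull power2_eq_square power3_eq_cube power4_eq_xxxx)
qed

text \<open>Opposite shifts pair up to the quadratics of \<open>ell_shift\<close>; for b = 0 and b =
  -2 there is in addition the linear factor of shift zero.\<close>

lemma dlist_factor:
  assumes b: "b \<in> {0, -1, -2, -3}"
  shows "evx (dlist p (inverse p) b) x (ell (k + 3)) = prodx x (map (\<lambda>s. ell (k + s)) (wts b))"
proof -
  let ?r = "inverse p"
  note s1 = ell_shift(1,2)[of "k + 1"] and s2 = ell_shift(3,4)[of k] and s3 = ell_shift(5,6)[of k]
  have q: "(x - fa_const c) * (x - fa_const c') = x ^ 2 - fa_const (c + c') * x + fa_const (c * c')" for c c'
    by (simp add: algebra_simps fa_const_pull fa_const_ring power2_eq_square)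
  have n: "k + 1 + 1 = k + 2" "k + 1 + 2 = k + 3" "k + 1 + 3 = k + 4" by simp_all
  have Q1: "(x - fa_const (ell (k + 2))) * (x - fa_const (ell (k + 4))) =
      x ^ 2 - fa_const ((p + ?r) * ell (k + 3)) * x + fa_const (ell (k + 3) ^ 2 + ?r)"
    unfolding q s1[unfolded n] ..
  have Q2: "(x - fa_const (ell (k + 1))) * (x - fa_const (ell (k + 5))) =
      x ^ 2 - fa_const ((p ^ 2 + ?r ^ 2) * ell (k + 3)) * x + fa_const (ell (k + 3) ^ 2 + (p + ?r) ^ 2 * ?r)"
    unfolding q s2 ..
  have Q3: "(x - fa_const (ell k)) * (x - fa_const (ell (k + 6))) =
      x ^ 2 - fa_const ((p ^ 3 + ?r ^ 3) * ell (k + 3)) * x + fa_const (ell (k + 3) ^ 2 + (p ^ 2 + ?r ^ 2 + 1) ^ 2 * ?r)"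
    unfolding q s3 ..
  have c: "(x - fa_const e) * (x - fa_const d) = (x - fa_const d) * (x - fa_const e)" for d e
    by (simp add: algebra_simps fa_const_pull mult.commute[of e])
  define e where "e = ell (k + 3)"
  consider "b = 0" | "b = -1" | "b = -2" | "b = -3" using b by blast
  then show ?thesis
  proof cases
    case 1
    then show ?thesis by (simp add: dlist_def wts_def fa_const_uminus)
  next
    case 2
    have "prodx x (map (\<lambda>s. ell (k + s)) (wts b)) = (x - fa_const (ell (k + 2))) * (x - fa_const (ell (k + 4)))"
      by (simp add: 2 wts_def)
    also have "\<dots> = evx (dlist p ?r b) x e"
      unfolding Q1 e_def[symmetric] by (simp add: 2 dlist_def fa_const_ring algebra_simps)
    finally show ?thesis by (simp add: e_def)
  next
    case 3
    have "prodx x (map (\<lambda>s. ell (k + s)) (wts b)) =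
        (x - fa_const (ell (k + 3))) * ((x - fa_const (ell (k + 1))) * (x - fa_const (ell (k + 5))))"
      by (simp add: 3 wts_def mult.assoc[symmetric] c[of "ell (k + 3)" "ell (Suc k)"])
    also have "\<dots> = evx (dlist p ?r b) x e"
      unfolding Q2 e_def[symmetric]
      by (simp add: 3 dlist_def Let_def fa_const_ring algebra_simps fa_const_pull power2_eq_square power3_eq_cube)
    finally show ?thesis by (simp add: e_def)
  next
    case 4
    have "prodx x (map (\<lambda>s. ell (k + s)) (wts b)) =
        ((x - fa_const (ell (k + 2))) * (x - fa_const (ell (k + 4)))) * ((x - fa_const (ell k)) * (x - fa_const (ell (k + 6))))"
    proof -
      have cc: "(x - fa_const e) * ((x - fa_const d) * y) = (x - fa_const d) * ((x - fa_const e) * y)" for d e y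
        by (simp only: mult.assoc[symmetric] c[of e d])
      show ?thesis
        by (simp add: 4 wts_def mult.assoc cc[of "ell k" "ell (Suc (Suc k))"] cc[of "ell k" "ell (k + 4)"])
    qed
    also have "\<dots> = evx (dlist p ?r b) x e"
    proof -
      let ?A = "p + ?r" and ?B = "p ^ 3 + ?r ^ 3" and ?k = "(p ^ 2 + ?r ^ 2 + 1) ^ 2 * ?r"
      have "dlist p ?r (-3) = [(1,4,0), (- (?A + ?B),3,1), (2 + ?A * ?B,2,2), (- (?A + ?B),1,3), (1,0,4),
          (?r + ?k,2,0), (- (?A * ?k + ?B * ?r),1,1), (?r + ?k,0,2), (?r * ?k,0,0)]"
        by (simp add: dlist_def Let_def)
      then show ?thesis using 4 by (simp only: Q1 Q3 quad_product flip: e_def)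
    qed
    finally show ?thesis by (simp add: e_def)
  qed
qed

text \<open>The formula for \<open>tm\<close> as a polynomial in L and R. Its terms are listed in
  the order of \<open>tau_minus_expr\<close>, repeated exponents included, so that the two can be
  matched by plain rewriting.\<close>

definition plist :: "int \<Rightarrow> ('k \<times> nat \<times> nat) list" where
  "plist b = (let w2 = inverse (qint p 2); w = inverse (qint p 3) * inverse (qint p 2) in
    if b = 0 then [(1,0,0)]
    else if b = -1 then [(1,1,0), (- p,0,1)]
    else if b = -2 then [(w2,2,0), (- (w2 * (p * qint p 2)),1,1), (w2 * p ^ 2,0,2), (1,0,0)]
    else [(w,3,0), (- (w * (p * qint p 3)),2,1), (w * (p ^ 2 * qint p 3),1,2), (- (w * p ^ 3),0,3),
      (w * inverse p,1,0), (- (w * (inverse p * p ^ 3)),0,1), (1,1,0), (- p,0,1)])"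

lemma qint_23: "qint p 2 = p + inverse p" "qint p 3 = p ^ 2 + inverse p ^ 2 + 1"
  "inverse (qint p 2) * (p + inverse p) = 1" "inverse (qint p 3) * (p ^ 2 + inverse p ^ 2 + 1) = 1"
proof -
  have pr: "p * inverse p = 1" using p0 by simp
  have q: "qint p n = v" if "v * (p - inverse p) = p powi n - p powi (- n)" for n v
    using that p_diff by (simp add: qint_def field_simps)
  have c: "(p ^ 2 + r ^ 2 + 1) * (p - r) = p ^ 3 - r ^ 3" if "p * r = 1" for r using that by Groebner_Basis.algebra
  show 1: "qint p 2 = p + inverse p" by (rule q) (simp add: power_int_minus power_inverse algebra_simps power2_eq_square)
  show 2: "qint p 3 = p ^ 2 + inverse p ^ 2 + 1" by (rule q) (use c[OF pr] in \<open>simp add: power_int_minus power_inverse\<close>)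
  show "inverse (qint p 2) * (p + inverse p) = 1" "inverse (qint p 3) * (p ^ 2 + inverse p ^ 2 + 1) = 1"
    using qint_nonzero[of 2] qint_nonzero[of 3] unfolding 1[symmetric] 2[symmetric] by simp_all
qed

lemma gauss_ratio:
  "gauss (k + 4) = - (inverse p ^ (k + 3) * inverse p) * gauss (k + 3)"
  "gauss (k + 2) = - (p ^ (k + 3)) * gauss (k + 3)"
  "gauss (k + 5) = (inverse p ^ (k + 3)) ^ 2 * inverse p ^ 3 * gauss (k + 3)"
  "gauss (k + 1) = (p ^ (k + 3)) ^ 2 * inverse p * gauss (k + 3)"
  "gauss (k + 6) = - ((inverse p ^ (k + 3)) ^ 3 * inverse p ^ 6) * gauss (k + 3)"
  "gauss k = - ((p ^ (k + 3)) ^ 3 * inverse p ^ 3) * gauss (k + 3)"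
proof -
  define r where "r = inverse p"
  define u where "u = p ^ k"
  define v where "v = r ^ k"
  have pr: "p * r = 1" using p0 by (simp add: r_def)
  have uv: "u * v = 1" using p0 by (simp add: u_def v_def r_def power_mult_distrib[symmetric])
  have pw: "p ^ (k + n) = u * p ^ n" "r ^ (k + n) = v * r ^ n" for n by (simp_all add: u_def v_def power_add)
  have g: "gauss (k + 1) = - (v * r) * gauss k" "gauss (k + 2) = - (v * r ^ 2) * gauss (k + 1)"
    "gauss (k + 3) = - (v * r ^ 3) * gauss (k + 2)" "gauss (k + 4) = - (v * r ^ 4) * gauss (k + 3)"
    "gauss (k + 5) = - (v * r ^ 5) * gauss (k + 4)" "gauss (k + 6) = - (v * r ^ 6) * gauss (k + 5)"
    using gauss_Suc[of k] gauss_Suc[of "k + 1"] gauss_Suc[of "k + 2"] gauss_Suc[of "k + 3"] gauss_Suc[of "k + 4"] gauss_Suc[of "k + 5"]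
    by (simp_all add: eval_nat_numeral v_def power_add flip: r_def)
  show 4: "gauss (k + 4) = - (inverse p ^ (k + 3) * inverse p) * gauss (k + 3)"
    unfolding g(4) r_def[symmetric] pw by (simp add: eval_nat_numeral)
  show "gauss (k + 5) = (inverse p ^ (k + 3)) ^ 2 * inverse p ^ 3 * gauss (k + 3)"
    unfolding g(5) g(4) r_def[symmetric] pw by (simp add: eval_nat_numeral)
  show "gauss (k + 6) = - ((inverse p ^ (k + 3)) ^ 3 * inverse p ^ 6) * gauss (k + 3)"
    unfolding g(6) g(5) g(4) r_def[symmetric] pw by (simp add: eval_nat_numeral)
  have c: "u ^ n * v ^ n = 1" "p ^ n * r ^ n = 1" for n using uv pr by (simp_all add: power_mult_distrib[symmetric])
  show "gauss (k + 2) = - (p ^ (k + 3)) * gauss (k + 3)"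
    unfolding g(3) r_def[symmetric] pw using uv c(2)[of 3] by Groebner_Basis.algebra
  show "gauss (k + 1) = (p ^ (k + 3)) ^ 2 * inverse p * gauss (k + 3)"
    unfolding g(3) g(2) r_def[symmetric] pw using uv pr by Groebner_Basis.algebra
  show "gauss k = - ((p ^ (k + 3)) ^ 3 * inverse p ^ 3) * gauss (k + 3)"
    unfolding g(3) g(2) g(1) r_def[symmetric] pw using uv pr by Groebner_Basis.algebra
qed

text \<open>This is what makes the formulas conjugations: at a pair of eigenvalues occurring for B_j
  they interpolate the ratios of \<open>gauss\<close>. The second claim exchanges L and R and serves
  the inverse, whose formula is the mirror image.\<close>

lemma plist_gauss:
  assumes b: "b \<in> {0, -1, -2, -3}" and s: "s \<in> set (wts b)"
  shows "evl (plist b) (ell (k + s)) (ell (k + 3)) * gauss (k + 3) = gauss (k + s)"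
    and "evl (plist b) (ell (k + 3)) (ell (k + s)) * gauss (k + s) = gauss (k + 3)"
proof -
  define r where "r = inverse p"
  define u where "u = p ^ (k + 3)"
  define v where "v = r ^ (k + 3)"
  define h where "h = inverse (p - r)"
  define w2 where "w2 = inverse (p + r)"
  define w3 where "w3 = inverse (p ^ 2 + r ^ 2 + 1)"
  have pr: "p * r = 1" using p0 by (simp add: r_def)
  have uv: "u * v = 1" using p0 by (simp add: u_def v_def r_def power_mult_distrib[symmetric])
  have h: "h * (p - r) = 1" using p_diff by (simp add: h_def r_def)
  have w2: "w2 * (p + r) = 1" and w3: "w3 * (p ^ 2 + r ^ 2 + 1) = 1"
    using qint_23 by (simp_all add: w2_def w3_def r_def)
  have l3: "ell (k + 3) = (u + r * v) * h"
    by (simp add: ell_def u_def v_def h_def divide_inverse flip: r_def)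
  have r3: "p ^ 3 * r ^ 3 = 1" "p ^ 2 * r ^ 2 = 1" using pr by (simp_all add: power_mult_distrib[symmetric])
  have uvk: "p ^ k = u * r ^ 3" "r ^ k = v * p ^ 3"
    using r3 by (simp_all add: u_def v_def power_add mult.assoc mult.commute[of "r ^ 3"])
  have lk: "ell (k + n) = (u * r ^ 3 * p ^ n + r * (v * p ^ 3) * r ^ n) * h" for n
    by (simp add: ell_def h_def power_add divide_inverse uvk[symmetric] flip: r_def)
  have l: "ell (k + 2) = (u * r + v) * h" "ell (k + 4) = (u * p + r ^ 2 * v) * h"
    "ell (k + 1) = (u * r ^ 2 + p * v) * h" "ell (k + 5) = (u * p ^ 2 + r ^ 3 * v) * h"
    "ell k = (u * r ^ 3 + p ^ 2 * v) * h" "ell (k + 6) = (u * p ^ 3 + r ^ 4 * v) * h"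
    unfolding lk lk[of 0, simplified] using pr by Groebner_Basis.algebra+
  note gr = gauss_ratio[of k, folded r_def, folded u_def v_def]
  have E1: "evl (plist (-1)) A R = A - p * R" for A R by (simp add: plist_def)
  \<comment> \<open>The factored forms keep the algebra small: every linear factor has a short value
    at a pair of eigenvalues.\<close>
  have E2: "evl (plist (-2)) A R = w2 * (A - p ^ 2 * R) * (A - R) + 1" for A R
  proof -
    have "evl (plist (-2)) A R = w2 * A ^ 2 - w2 * (p * (p + r)) * A * R + w2 * p ^ 2 * R ^ 2 + 1"
      using qint_23(1) by (simp add: plist_def Let_def w2_def r_def)
    also have "\<dots> = w2 * (A - p ^ 2 * R) * (A - R) + 1" using pr by Groebner_Basis.algebra
    finally show ?thesis .
  qed
  have E3: "evl (plist (-3)) A R = w3 * w2 * (A - p ^ 3 * R) * ((A - p * R) * (A - r * R) + r) + (A - p * R)" for A R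
  proof -
    have "evl (plist (-3)) A R = w3 * w2 * (A ^ 3 - p * (p ^ 2 + r ^ 2 + 1) * A ^ 2 * R + p ^ 2 * (p ^ 2 + r ^ 2 + 1) * A * R ^ 2
      - p ^ 3 * R ^ 3 + r * A - r * p ^ 3 * R) + A - p * R"
      using qint_23(1,2) by (simp add: plist_def Let_def w2_def w3_def r_def algebra_simps)
    moreover have "A ^ 3 - p * (p ^ 2 + r ^ 2 + 1) * A ^ 2 * R + p ^ 2 * (p ^ 2 + r ^ 2 + 1) * A * R ^ 2
      - p ^ 3 * R ^ 3 + r * A - r * p ^ 3 * R = (A - p ^ 3 * R) * ((A - p * R) * (A - r * R) + r)"
      using pr by Groebner_Basis.algebra
    ultimately show ?thesis by (simp only: mult.assoc add_diff_eq)
  qed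
  \<comment> \<open>At the extreme shifts the first linear factor is divisible by [2] or [3],
    cancelling \<open>w2\<close> or \<open>w3\<close>. For b = -3 the quadratic factor is then
    divisible by [2].\<close>
  have fin_m2: "evl (plist (-2)) A R = z" if "A - p ^ 2 * R = - G * (p + r)" "A - R = Y" "1 - G * Y = z" for A R G Y z
    unfolding E2 that(1,2) that(3)[symmetric] using w2 by Groebner_Basis.algebra
  have fin_m1: "evl (plist (-3)) A R = z" if "A - p * R = z" "A - r * R = Y" "z * Y + r = 0" for A R Y z
    unfolding E3 that(1,2) that(3) by simp
  have fin_m3: "evl (plist (-3)) A R = z" if "A - p ^ 3 * R = - G * (p ^ 2 + r ^ 2 + 1)" "A - p * R = Y" "A - r * R = V"
    "Y * V + r = (p + r) * U" "Y - G * U = z" for A R G Y V U z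
  proof -
    have "w3 * w2 * (- G * (p ^ 2 + r ^ 2 + 1)) * ((p + r) * U) + Y = z"
      unfolding that(5)[symmetric] using w2 w3 by Groebner_Basis.algebra
    then show ?thesis unfolding E3 that(1,2,3,4) .
  qed
  let ?E = "\<lambda>s t. evl (plist b) (ell (k + s)) (ell (k + t))"
  have fin1: "?E s 3 = x \<Longrightarrow> gauss (k + s) = x * gauss (k + 3) \<Longrightarrow> ?E s 3 * gauss (k + 3) = gauss (k + s)" for s x
    by simp
  have fin2: "?E 3 s * gauss (k + s) = gauss (k + 3)"
    if "?E 3 s = y" "gauss (k + s) = x * gauss (k + 3)" "y * x = 1" for s x y
  proof -
    have "?E 3 s * gauss (k + s) = (y * x) * gauss (k + 3)" using that(1,2) by (simp only: mult.assoc)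
    then show ?thesis using that(3) by simp
  qed
  have main: "evl (plist b) (ell (k + s)) (ell (k + 3)) * gauss (k + 3) = gauss (k + s) \<and>
    evl (plist b) (ell (k + 3)) (ell (k + s)) * gauss (k + s) = gauss (k + 3)"
  proof -
    consider "b = 0" "s = 3" | "b = -1" "s = 2" | "b = -1" "s = 4" | "b = -2" "s = 1" | "b = -2" "s = 3" | "b = -2" "s = 5"
      | "b = -3" "s = 0" | "b = -3" "s = 2" | "b = -3" "s = 4" | "b = -3" "s = 6"
      using b s by (auto simp: wts_def split: if_splits)
    then show ?thesis
    proof cases
      case 1 then show ?thesis by (simp add: plist_def)
    next
      case 2
      have "?E 2 3 = - u" unfolding 2(1) E1 l l3 using h pr by Groebner_Basis.algebra
      moreover have "?E 3 2 = - v" unfolding 2(1) E1 l l3 using h pr by Groebner_Basis.algebra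
      ultimately show ?thesis using fin1[of 2 "- u"] fin2[of 2 "- v" "- u"] gr(2) uv 2 by (simp add: mult.commute)
    next
      case 3
      have "?E 4 3 = - (v * r)" unfolding 3(1) E1 l l3 using h pr by Groebner_Basis.algebra
      moreover have "?E 3 4 = - (u * p)" unfolding 3(1) E1 l l3 using h pr by Groebner_Basis.algebra
      moreover have "- (u * p) * - (v * r) = 1" using uv pr by Groebner_Basis.algebra
      ultimately show ?thesis using fin1[of 4 "- (v * r)"] fin2[of 4 "- (u * p)" "- (v * r)"] gr(1) 3 by simp
    next
      case 4
      have "?E 1 3 = u ^ 2 * r"
      proof -
        have f0: "ell (k + 1) - p ^ 2 * ell (k + 3) = - (u) * (p + r)" unfolding l l3 using h pr by Groebner_Basis.algebra
        have f1: "ell (k + 1) - ell (k + 3) = v - u * r" unfolding l l3 using h pr by Groebner_Basis.algebra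
        have f2: "1 - (u) * (v - u * r) = u ^ 2 * r" unfolding l l3 using uv pr by Groebner_Basis.algebra
        show ?thesis unfolding 4(1) by (rule fin_m2[OF f0 f1 f2])
      qed
      moreover have "?E 3 1 = v ^ 2 * p"
      proof -
        have f0: "ell (k + 3) - p ^ 2 * ell (k + 1) = - (v * p) * (p + r)" unfolding l l3 using h pr by Groebner_Basis.algebra
        have f1: "ell (k + 3) - ell (k + 1) = u * r - v" unfolding l l3 using h pr by Groebner_Basis.algebra
        have f2: "1 - (v * p) * (u * r - v) = v ^ 2 * p" unfolding l l3 using uv pr by Groebner_Basis.algebra
        show ?thesis unfolding 4(1) by (rule fin_m2[OF f0 f1 f2])
      qed
      moreover have "(v ^ 2 * p) * (u ^ 2 * r) = 1" using uv pr by Groebner_Basis.algebra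
      ultimately show ?thesis using fin1[of 1 "u ^ 2 * r"] fin2[of 1 "v ^ 2 * p" "u ^ 2 * r"] gr(4) 4 by simp
    next
      case 5
      have "?E 3 3 = 1" unfolding 5(1) E2 by simp
      then show ?thesis using 5 by simp
    next
      case 6
      have "?E 5 3 = v ^ 2 * r ^ 3"
      proof -
        have f0: "ell (k + 5) - p ^ 2 * ell (k + 3) = - (v * r) * (p + r)" unfolding l l3 using h pr by Groebner_Basis.algebra
        have f1: "ell (k + 5) - ell (k + 3) = u * p - v * r ^ 2" unfolding l l3 using h pr by Groebner_Basis.algebra
        have f2: "1 - (v * r) * (u * p - v * r ^ 2) = v ^ 2 * r ^ 3" unfolding l l3 using uv pr by Groebner_Basis.algebra
        show ?thesis unfolding 6(1) by (rule fin_m2[OF f0 f1 f2])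
      qed
      moreover have "?E 3 5 = u ^ 2 * p ^ 3"
      proof -
        have f0: "ell (k + 3) - p ^ 2 * ell (k + 5) = - (u * p ^ 2) * (p + r)" unfolding l l3 using h pr by Groebner_Basis.algebra
        have f1: "ell (k + 3) - ell (k + 5) = v * r ^ 2 - u * p" unfolding l l3 using h pr by Groebner_Basis.algebra
        have f2: "1 - (u * p ^ 2) * (v * r ^ 2 - u * p) = u ^ 2 * p ^ 3" unfolding l l3 using uv pr by Groebner_Basis.algebra
        show ?thesis unfolding 6(1) by (rule fin_m2[OF f0 f1 f2])
      qed
      moreover have "(u ^ 2 * p ^ 3) * (v ^ 2 * r ^ 3) = 1" using uv pr by Groebner_Basis.algebra
      ultimately show ?thesis using fin1[of 5 "v ^ 2 * r ^ 3"] fin2[of 5 "u ^ 2 * p ^ 3" "v ^ 2 * r ^ 3"] gr(3) 6 by simp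
    next
      case 7
      have "evl (plist b) (ell k) (ell (k + 3)) = - (u ^ 3 * r ^ 3)"
      proof -
        have f0: "ell k - p ^ 3 * ell (k + 3) = - (u) * (p ^ 2 + r ^ 2 + 1)" unfolding l l3 using h pr by Groebner_Basis.algebra
        have f1: "ell k - p * ell (k + 3) = v * p - u * r * (p + r)" unfolding l l3 using h pr by Groebner_Basis.algebra
        have f2: "ell k - r * ell (k + 3) = v * (p + r) - u * r ^ 2" unfolding l l3 using h pr by Groebner_Basis.algebra
        have f3: "(v * p - u * r * (p + r)) * (v * (p + r) - u * r ^ 2) + r = (p + r) * (v ^ 2 * p - r * (p + r) + u ^ 2 * r ^ 3)" unfolding l l3 using uv pr by Groebner_Basis.algebra
        have f4: "v * p - u * r * (p + r) - (u) * (v ^ 2 * p - r * (p + r) + u ^ 2 * r ^ 3) = - (u ^ 3 * r ^ 3)" unfolding l l3 using uv pr by Groebner_Basis.algebra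
        show ?thesis unfolding 7(1) by (rule fin_m3[OF f0 f1 f2 f3 f4])
      qed
      moreover have "evl (plist b) (ell (k + 3)) (ell k) = - (v ^ 3 * p ^ 3)"
      proof -
        have f0: "ell (k + 3) - p ^ 3 * ell k = - (v * p ^ 2) * (p ^ 2 + r ^ 2 + 1)" unfolding l l3 using h pr by Groebner_Basis.algebra
        have f1: "ell (k + 3) - p * ell k = u * r - v * p * (p + r)" unfolding l l3 using h pr by Groebner_Basis.algebra
        have f2: "ell (k + 3) - r * ell k = u * r ^ 2 * (p + r) - v" unfolding l l3 using h pr by Groebner_Basis.algebra
        have f3: "(u * r - v * p * (p + r)) * (u * r ^ 2 * (p + r) - v) + r = (p + r) * (v ^ 2 * p - r * (p + r) + u ^ 2 * r ^ 3)" unfolding l l3 using uv pr by Groebner_Basis.algebra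
        have f4: "u * r - v * p * (p + r) - (v * p ^ 2) * (v ^ 2 * p - r * (p + r) + u ^ 2 * r ^ 3) = - (v ^ 3 * p ^ 3)" unfolding l l3 using uv pr by Groebner_Basis.algebra
        show ?thesis unfolding 7(1) by (rule fin_m3[OF f0 f1 f2 f3 f4])
      qed
      moreover have "- (v ^ 3 * p ^ 3) * - (u ^ 3 * r ^ 3) = 1" using uv pr by Groebner_Basis.algebra
      ultimately show ?thesis using fin1[of 0 "- (u ^ 3 * r ^ 3)"] fin2[of 0 "- (v ^ 3 * p ^ 3)" "- (u ^ 3 * r ^ 3)"] gr(6) 7 by simp
    next
      case 8
      have "?E 2 3 = - u"
      proof -
        have f0: "ell (k + 2) - p * ell (k + 3) = - u" unfolding l l3 using h pr by Groebner_Basis.algebra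
        have f1: "ell (k + 2) - r * ell (k + 3) = r * v" unfolding l l3 using h pr by Groebner_Basis.algebra
        have f2: "- u * (r * v) + r = 0" unfolding l l3 using uv pr by Groebner_Basis.algebra
        show ?thesis unfolding 8(1) by (rule fin_m1[OF f0 f1 f2])
      qed
      moreover have "?E 3 2 = - v"
      proof -
        have f0: "ell (k + 3) - p * ell (k + 2) = - v" unfolding l l3 using h pr by Groebner_Basis.algebra
        have f1: "ell (k + 3) - r * ell (k + 2) = u * r" unfolding l l3 using h pr by Groebner_Basis.algebra
        have f2: "- v * (u * r) + r = 0" unfolding l l3 using uv pr by Groebner_Basis.algebra
        show ?thesis unfolding 8(1) by (rule fin_m1[OF f0 f1 f2])
      qed
      ultimately show ?thesis using fin1[of 2 "- u"] fin2[of 2 "- v" "- u"] gr(2) uv 8 by (simp add: mult.commute)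
    next
      case 9
      have "?E 4 3 = - (v * r)"
      proof -
        have f0: "ell (k + 4) - p * ell (k + 3) = - (v * r)" unfolding l l3 using h pr by Groebner_Basis.algebra
        have f1: "ell (k + 4) - r * ell (k + 3) = u" unfolding l l3 using h pr by Groebner_Basis.algebra
        have f2: "- (v * r) * (u) + r = 0" unfolding l l3 using uv pr by Groebner_Basis.algebra
        show ?thesis unfolding 9(1) by (rule fin_m1[OF f0 f1 f2])
      qed
      moreover have "?E 3 4 = - (u * p)"
      proof -
        have f0: "ell (k + 3) - p * ell (k + 4) = - (u * p)" unfolding l l3 using h pr by Groebner_Basis.algebra
        have f1: "ell (k + 3) - r * ell (k + 4) = v * r ^ 2" unfolding l l3 using h pr by Groebner_Basis.algebra
        have f2: "- (u * p) * (v * r ^ 2) + r = 0" unfolding l l3 using uv pr by Groebner_Basis.algebra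
        show ?thesis unfolding 9(1) by (rule fin_m1[OF f0 f1 f2])
      qed
      moreover have "- (u * p) * - (v * r) = 1" using uv pr by Groebner_Basis.algebra
      ultimately show ?thesis using fin1[of 4 "- (v * r)"] fin2[of 4 "- (u * p)" "- (v * r)"] gr(1) 9 by simp
    next
      case 10
      have "?E 6 3 = - (v ^ 3 * r ^ 6)"
      proof -
        have f0: "ell (k + 6) - p ^ 3 * ell (k + 3) = - (v * r) * (p ^ 2 + r ^ 2 + 1)" unfolding l l3 using h pr by Groebner_Basis.algebra
        have f1: "ell (k + 6) - p * ell (k + 3) = u * p ^ 2 - v * r ^ 2 * (p + r)" unfolding l l3 using h pr by Groebner_Basis.algebra
        have f2: "ell (k + 6) - r * ell (k + 3) = u * p * (p + r) - v * r ^ 3" unfolding l l3 using h pr by Groebner_Basis.algebra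
        have f3: "(u * p ^ 2 - v * r ^ 2 * (p + r)) * (u * p * (p + r) - v * r ^ 3) + r = (p + r) * (u ^ 2 * p ^ 3 - r * (p + r) + v ^ 2 * r ^ 5)" unfolding l l3 using uv pr by Groebner_Basis.algebra
        have f4: "u * p ^ 2 - v * r ^ 2 * (p + r) - (v * r) * (u ^ 2 * p ^ 3 - r * (p + r) + v ^ 2 * r ^ 5) = - (v ^ 3 * r ^ 6)" unfolding l l3 using uv pr by Groebner_Basis.algebra
        show ?thesis unfolding 10(1) by (rule fin_m3[OF f0 f1 f2 f3 f4])
      qed
      moreover have "?E 3 6 = - (u ^ 3 * p ^ 6)"
      proof -
        have f0: "ell (k + 3) - p ^ 3 * ell (k + 6) = - (u * p ^ 3) * (p ^ 2 + r ^ 2 + 1)" unfolding l l3 using h pr by Groebner_Basis.algebra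
        have f1: "ell (k + 3) - p * ell (k + 6) = v * r ^ 2 - u * p ^ 2 * (p + r)" unfolding l l3 using h pr by Groebner_Basis.algebra
        have f2: "ell (k + 3) - r * ell (k + 6) = v * r ^ 3 * (p + r) - u * p" unfolding l l3 using h pr by Groebner_Basis.algebra
        have f3: "(v * r ^ 2 - u * p ^ 2 * (p + r)) * (v * r ^ 3 * (p + r) - u * p) + r = (p + r) * (u ^ 2 * p ^ 3 - r * (p + r) + v ^ 2 * r ^ 5)" unfolding l l3 using uv pr by Groebner_Basis.algebra
        have f4: "v * r ^ 2 - u * p ^ 2 * (p + r) - (u * p ^ 3) * (u ^ 2 * p ^ 3 - r * (p + r) + v ^ 2 * r ^ 5) = - (u ^ 3 * p ^ 6)" unfolding l l3 using uv pr by Groebner_Basis.algebra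
        show ?thesis unfolding 10(1) by (rule fin_m3[OF f0 f1 f2 f3 f4])
      qed
      moreover have "- (u ^ 3 * p ^ 6) * - (v ^ 3 * r ^ 6) = 1" using uv pr by Groebner_Basis.algebra
      ultimately show ?thesis using fin1[of 6 "- (v ^ 3 * r ^ 6)"] fin2[of 6 "- (u ^ 3 * p ^ 6)" "- (v ^ 3 * r ^ 6)"] gr(5) 10 by simp
    qed
  qed
  then show "evl (plist b) (ell (k + s)) (ell (k + 3)) * gauss (k + 3) = gauss (k + s)"
    "evl (plist b) (ell (k + 3)) (ell (k + s)) * gauss (k + s) = gauss (k + 3)" by auto
qed

end

section \<open>Eigenvectors of B_i in the quotients by the left ideals \<open>W i n\<close>, and
  conjugation by diagonal operators\<close>

context cartan_datum
begin

abbreviation ell_i :: "'i \<Rightarrow> nat \<Rightarrow> 'k" where "ell_i i \<equiv> q_generic.ell (qi i)"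

abbreviation W :: "'i \<Rightarrow> nat \<Rightarrow> ('i, 'k) free_algebra set" where "W i n \<equiv> wset i (ell_i i n)"

definition eig :: "'i \<Rightarrow> nat \<Rightarrow> nat \<Rightarrow> ('i, 'k) free_algebra set" where
  "eig i n m = {u. (fa_gen i - fa_const (ell_i i m)) * u \<in> W i n}"

definition diag :: "'i \<Rightarrow> ('i, 'k) free_algebra \<Rightarrow> (nat \<Rightarrow> 'k) \<Rightarrow> bool" where
  "diag i y f \<longleftrightarrow> (\<forall>n m u. u \<in> eig i n m \<longrightarrow> y * u - fa_const (f m) * u \<in> W i n)"

lemma diagD: "diag i y f \<Longrightarrow> u \<in> eig i n m \<Longrightarrow> y * u - fa_const (f m) * u \<in> W i n"
  by (simp add: diag_def)

lemma diag_const: "diag i (fa_const c) (\<lambda>_. c)"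
  by (simp add: diag_def wset_zero)

lemma diag_gen: "diag i (fa_gen i) (ell_i i)"
  by (simp add: diag_def eig_def left_diff_distrib)

lemma diag_add: "diag i y f \<Longrightarrow> diag i z g \<Longrightarrow> diag i (y + z) (\<lambda>m. f m + g m)"
  unfolding diag_def
proof (intro allI impI)
  fix n m u assume "\<forall>n m u. u \<in> eig i n m \<longrightarrow> y * u - fa_const (f m) * u \<in> W i n"
    "\<forall>n m u. u \<in> eig i n m \<longrightarrow> z * u - fa_const (g m) * u \<in> W i n" "u \<in> eig i n m"
  then have "(y * u - fa_const (f m) * u) + (z * u - fa_const (g m) * u) \<in> W i n" by (intro wset_add) auto
  then show "(y + z) * u - fa_const (f m + g m) * u \<in> W i n" by (simp add: algebra_simps fa_const_add)
qed

lemma diag_mult: "diag i y f \<Longrightarrow> diag i z g \<Longrightarrow> diag i (y * z) (\<lambda>m. f m * g m)"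
  unfolding diag_def
proof (intro allI impI)
  fix n m u assume "\<forall>n m u. u \<in> eig i n m \<longrightarrow> y * u - fa_const (f m) * u \<in> W i n"
    "\<forall>n m u. u \<in> eig i n m \<longrightarrow> z * u - fa_const (g m) * u \<in> W i n" "u \<in> eig i n m"
  then have "y * (z * u - fa_const (g m) * u) + fa_const (g m) * (y * u - fa_const (f m) * u) \<in> W i n"
    by (intro wset_add wset_mult) auto
  then show "y * z * u - fa_const (f m * g m) * u \<in> W i n"
    by (simp add: algebra_simps fa_const_pull mult.commute)
qed

lemma diag_power: "diag i y f \<Longrightarrow> diag i (y ^ k) (\<lambda>m. f m ^ k)"
  using diag_const[of i 1] by (induction k) (auto intro: diag_mult)

lemma diag_diff: "diag i y f \<Longrightarrow> diag i z g \<Longrightarrow> diag i (y - z) (\<lambda>m. f m - g m)"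
  using diag_add[OF _ diag_mult[OF diag_const[of i "-1"]], of y f z g] by (simp add: fa_const_uminus)

lemma diag_prodx: "diag i (prodx (fa_gen i) cs) (\<lambda>m. prod_list (map (\<lambda>c. ell_i i m - c) cs))"
proof (induction cs)
  case Nil
  show ?case using diag_const[of i 1] by simp
next
  case (Cons c cs)
  show ?case using diag_mult[OF diag_diff[OF diag_gen diag_const[of i c]] Cons] by simp
qed

lemma diag_evx: "diag i (evx f (fa_gen i) r) (\<lambda>m. evl f (ell_i i m) r)"
proof (induction f)
  case Nil
  show ?case using diag_const[of i 0] by simp
next
  case (Cons t f)
  obtain c k n where t: "t = (c, k, n)" by (cases t)
  show ?case
    using diag_add[OF diag_mult[OF diag_const[of i "c * r ^ n"] diag_power[OF diag_gen, where k = k]] Cons]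
    by (simp add: t mult_ac)
qed

lemma inj_ell_i: "ell_i i m = ell_i i n \<longleftrightarrow> m = n"
  using q_generic.inj_ell[OF qi_generic[of i]] by (auto dest: injD)

text \<open>Polynomial interpolation in B_i: its eigenvalues are distinct, so a polynomial in it can
  take any prescribed values on finitely many of them.\<close>

lemma diag_interpolate:
  assumes "finite A"
  shows "\<exists>y f. diag i y f \<and> (\<forall>m\<in>A. f m = \<gamma> m)"
  using assms
proof induction
  case empty
  show ?case using diag_const by blast
next
  case (insert m0 A)
  then obtain y f where y: "diag i y f" "\<forall>m\<in>A. f m = \<gamma> m" by blast
  obtain l where l: "set l = A" using finite_list[OF insert(1)] by blast
  define hf where "hf m = prod_list (map (\<lambda>c. ell_i i m - c) (map (ell_i i) l))" for m
  have hf: "hf m0 \<noteq> 0" "\<And>m. m \<in> A \<Longrightarrow> hf m = 0"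
    using insert(2) l by (auto simp: hf_def prod_list_zero_iff inj_ell_i)
  have "diag i (y + fa_const ((\<gamma> m0 - f m0) / hf m0) * prodx (fa_gen i) (map (ell_i i) l)) (\<lambda>m. f m + (\<gamma> m0 - f m0) / hf m0 * hf m)"
    unfolding hf_def by (intro diag_add diag_mult diag_const diag_prodx y)
  moreover have "\<forall>m\<in>insert m0 A. f m + (\<gamma> m0 - f m0) / hf m0 * hf m = \<gamma> m"
    using hf y(2) by auto
  ultimately show ?case by blast
qed

lemma eig_const_mult: "u \<in> eig i n m \<Longrightarrow> fa_const c * u \<in> eig i n m"
  using wset_mult[of "(fa_gen i - fa_const (ell_i i m)) * u" i "ell_i i n" "fa_const c"]
  by (simp add: eig_def fa_const_pull)

text \<open>The entries of the lists below are pairs of an eigenvalue index and an eigenvector.\<close>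

definition wsum :: "(nat \<Rightarrow> 'k) \<Rightarrow> (nat \<times> ('i, 'k) free_algebra) list \<Rightarrow> ('i, 'k) free_algebra" where
  "wsum \<gamma> L = (\<Sum>(m, u)\<leftarrow>L. fa_const (\<gamma> m) * u)"

lemma wsum_simps [simp]: "wsum \<gamma> [] = 0" "wsum \<gamma> ((m, u) # L) = fa_const (\<gamma> m) * u + wsum \<gamma> L"
  "wsum \<gamma> (L @ L') = wsum \<gamma> L + wsum \<gamma> L'"
  by (simp_all add: wsum_def)

definition eigs :: "'i \<Rightarrow> nat \<Rightarrow> nat \<Rightarrow> (nat \<times> ('i, 'k) free_algebra) list \<Rightarrow> bool" where
  "eigs i n k L \<longleftrightarrow> (\<forall>(m, u)\<in>set L. k \<le> m \<and> u \<in> eig i n m)"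

lemma eigs_simps [simp]: "eigs i n k []" "eigs i n k ((m, u) # L) \<longleftrightarrow> k \<le> m \<and> u \<in> eig i n m \<and> eigs i n k L"
  "eigs i n k (L @ L') \<longleftrightarrow> eigs i n k L \<and> eigs i n k L'"
  by (auto simp: eigs_def)

lemma eigs_mono: "eigs i n k L \<Longrightarrow> k' \<le> k \<Longrightarrow> eigs i n k' L"
  by (fastforce simp: eigs_def)

lemma wsum_scale: "wsum \<gamma> (map (\<lambda>(m, u). (m, fa_const (c m) * u)) L) = wsum (\<lambda>m. \<gamma> m * c m) L"
  by (induction L) (auto simp: fa_const_pull)

lemma wsum_uminus: "wsum (\<lambda>m. - \<gamma> m) L = - wsum \<gamma> L"
  by (induction L) (auto simp: fa_const_uminus)

lemma eigs_scale: "eigs i n k L \<Longrightarrow> eigs i n k (map (\<lambda>(m, u). (m, fa_const (c m) * u)) L)"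
  by (induction L) (auto simp: eig_const_mult)

lemma wsum_diag:
  assumes "diag i y f" "eigs i n k L"
  shows "y * wsum \<gamma> L - wsum (\<lambda>m. f m * \<gamma> m) L \<in> W i n"
  using assms(2)
proof (induction L)
  case (Cons t L)
  obtain m u where t: "t = (m, u)" by (cases t)
  have "y * wsum \<gamma> (t # L) - wsum (\<lambda>m. f m * \<gamma> m) (t # L) =
     fa_const (\<gamma> m) * (y * u - fa_const (f m) * u) + (y * wsum \<gamma> L - wsum (\<lambda>m. f m * \<gamma> m) L)"
    by (simp add: t algebra_simps fa_const_pull mult.commute)
  also have "\<dots> \<in> W i n"
    using Cons t by (intro wset_add wset_mult diagD[OF assms(1)]) auto
  finally show ?case .
qed (simp add: wset_zero)

text \<open>A relation between eigenvectors survives rescaling by any function of the index, because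
  an interpolating polynomial in B_i can be applied to it. This takes the place of a well-defined
  diagonal operator on the quotient.\<close>

lemma wsum_weight:
  assumes L: "eigs i n k L" and z: "wsum \<gamma> L \<in> W i n"
  shows "wsum (\<lambda>m. \<delta> m * \<gamma> m) L \<in> W i n"
proof -
  obtain y f where y: "diag i y f" "\<forall>m\<in>fst ` set L. f m = \<delta> m"
    using diag_interpolate[of "fst ` set L" i \<delta>] by auto
  have e: "wsum (\<lambda>m. f m * \<gamma> m) L = wsum (\<lambda>m. \<delta> m * \<gamma> m) L"
    unfolding wsum_def using y(2) by (intro arg_cong[where f = sum_list] map_cong) force+
  have "y * wsum \<gamma> L - (y * wsum \<gamma> L - wsum (\<lambda>m. f m * \<gamma> m) L) \<in> W i n"
    by (intro wset_diff wset_mult z wsum_diag[OF y(1) L])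
  then show ?thesis by (simp add: e)
qed

text \<open>A vector killed by a product of distinct factors B_i - l_m is a sum of eigenvectors.
  Multiplying by all factors but one and normalising gives one component, and the remainder is
  killed by the shorter product.\<close>

lemma eig_decompose:
  assumes "prodx (fa_gen i) (map (ell_i i) ms) * v \<in> W i n" "distinct ms"
  shows "\<exists>L. eigs i n 0 L \<and> fst ` set L \<subseteq> set ms \<and> v - wsum (\<lambda>_. 1) L \<in> W i n"
  using assms
proof (induction ms arbitrary: v)
  case Nil
  then show ?case by (intro exI[of _ "[]"]) auto
next
  case (Cons m ms)
  let ?P = "prodx (fa_gen i) (map (ell_i i) ms)"
  define c where "c = prod_list (map (\<lambda>d. ell_i i m - d) (map (ell_i i) ms))"
  have c0: "c \<noteq> 0" using Cons.prems(2) by (auto simp: c_def prod_list_zero_iff inj_ell_i)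
  define w where "w = fa_const (1 / c) * (?P * v)"
  have Pv: "?P * v \<in> eig i n m"
    using Cons.prems(1) by (simp add: eig_def mult.assoc)
  then have w: "w \<in> eig i n m" unfolding w_def by (rule eig_const_mult)
  have "?P * (v - w) = - (?P * w - fa_const c * w)"
    using c0 by (simp add: w_def right_diff_distrib fa_const_pull)
  also have "\<dots> \<in> W i n"
    using diagD[OF diag_prodx[of i "map (ell_i i) ms"] w] by (intro wset_uminus) (simp add: c_def)
  finally obtain L where L: "eigs i n 0 L" "fst ` set L \<subseteq> set ms" "v - w - wsum (\<lambda>_. 1) L \<in> W i n"
    using Cons.IH[of "v - w"] Cons.prems(2) by auto
  then show ?case using w by (intro exI[of _ "(m, w) # L"]) (auto simp: algebra_simps)
qed

text \<open>B_i commutes with itself and so does not shift the index; the diagonal Cartan entry is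
  therefore replaced by 0 here and in \<open>rlist\<close>, \<open>phim\<close>.\<close>

definition wlist :: "'i \<Rightarrow> 'i \<Rightarrow> nat list" where
  "wlist i j = q_generic.wts (if j = i then 0 else a i j)"

definition rlist :: "'i \<Rightarrow> 'i \<Rightarrow> ('k \<times> nat \<times> nat) list" where
  "rlist i j = dlist (qi i) (inverse (qi i)) (if j = i then 0 else a i j)"

lemma rlist_ker: "bip (rlist i j) (fa_gen i) (fa_gen j) \<in> ker"
  using drel_ker[of i j] by (cases "j = i") (simp_all add: rlist_def drel_def dlist_def fa_const_uminus kerI)

lemma power_eig: "u \<in> eig i n m \<Longrightarrow> fa_gen i ^ k * u - fa_const (ell_i i m ^ k) * u \<in> W i n"
  by (rule diagD[OF diag_power[OF diag_gen]])

text \<open>Against an eigenvector on its right, every right multiplication by B_i becomes the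
  eigenvalue, which leaves a polynomial in left multiplication alone.\<close>

lemma bip_eig:
  assumes u: "u \<in> eig i n m"
  shows "bip f (fa_gen i) y * u - evx f (fa_gen i) (ell_i i m) * (y * u) \<in> W i n"
proof (induction f)
  case (Cons t f)
  obtain c k l where t: "t = (c, k, l)" by (cases t)
  have "bip (t # f) (fa_gen i) y * u - evx (t # f) (fa_gen i) (ell_i i m) * (y * u) =
     (fa_const c * fa_gen i ^ k * y) * (fa_gen i ^ l * u - fa_const (ell_i i m ^ l) * u)
     + (bip f (fa_gen i) y * u - evx f (fa_gen i) (ell_i i m) * (y * u))"
    by (simp add: t algebra_simps fa_const_pull)
  also have "\<dots> \<in> W i n" by (intro wset_add wset_mult power_eig u Cons)
  finally show ?case .
qed (simp add: wset_zero)

text \<open>By \<open>bip_eig\<close> and \<open>dlist_factor\<close> the deformed Serre relation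
  says that B_j u is killed by a product of distinct linear factors in B_i.\<close>

lemma gen_eig_decompose:
  assumes u: "u \<in> eig i n (k + 3)"
  shows "\<exists>L. eigs i n k L \<and> fst ` set L \<subseteq> (+) k ` set (wlist i j) \<and> fa_gen j * u - wsum (\<lambda>_. 1) L \<in> W i n"
proof -
  interpret qq: q_generic "qi i" by (rule qi_generic)
  let ?x = "fa_gen i :: ('i, 'k) free_algebra"
  have "(if j = i then 0 else a i j) \<in> {0, -1, -2, -3}" using a_range[of i j] by auto
  from qq.dlist_factor[OF this, of ?x k]
  have e: "evx (rlist i j) ?x (ell_i i (k + 3)) = prodx ?x (map (ell_i i) (map ((+) k) (wlist i j)))"
    by (simp add: rlist_def wlist_def comp_def)
  have "bip (rlist i j) ?x (fa_gen j) * u - (bip (rlist i j) ?x (fa_gen j) * u - evx (rlist i j) ?x (ell_i i (k + 3)) * (fa_gen j * u)) \<in> W i n"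
    by (intro wset_diff bip_eig u wset_ker kerI(4) rlist_ker)
  then have "prodx ?x (map (ell_i i) (map ((+) k) (wlist i j))) * (fa_gen j * u) \<in> W i n"
    by (simp add: e)
  moreover have "distinct (map ((+) k) (wlist i j))"
    by (simp add: distinct_map wlist_def qq.wts_def)
  ultimately obtain L where L: "eigs i n 0 L" "fst ` set L \<subseteq> set (map ((+) k) (wlist i j))" "fa_gen j * u - wsum (\<lambda>_. 1) L \<in> W i n"
    using eig_decompose by blast
  have "eigs i n k L" using L(1,2) by (fastforce simp: eigs_def)
  then show ?thesis using L by auto
qed

text \<open>A family of bimodule polynomials \<open>\<phi> j\<close> defining an endomorphism of the free algebra that acts, in
  each of the modules \<open>T / W i n\<close>, as conjugation by the diagonal operator with eigenvalues \<open>g\<close>.\<close>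

definition gaussian :: "'i \<Rightarrow> ('i \<Rightarrow> ('k \<times> nat \<times> nat) list) \<Rightarrow> (nat \<Rightarrow> 'k) \<Rightarrow> bool" where
  "gaussian i \<phi> g \<longleftrightarrow> (\<forall>m. g m \<noteq> 0) \<and>
     (\<forall>j k s. s \<in> set (wlist i j) \<longrightarrow> evl (\<phi> j) (ell_i i (k + s)) (ell_i i (k + 3)) * g (k + 3) = g (k + s))"

definition tauh :: "'i \<Rightarrow> ('i \<Rightarrow> ('k \<times> nat \<times> nat) list) \<Rightarrow> ('i, 'k) free_algebra \<Rightarrow> ('i, 'k) free_algebra" where
  "tauh i \<phi> = fa_hom (\<lambda>j. bip (\<phi> j) (fa_gen i) (fa_gen j))"

text \<open>Let D be the diagonal operator with entries g and v the image of 1, an eigenvector of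
  index n. Then D p D^-1 v = D p v / g(n), so the components of p v are reweighted by g(m) / g(n).
  The number k bounds the indices from below.\<close>

definition conjrel :: "'i \<Rightarrow> (nat \<Rightarrow> 'k) \<Rightarrow> nat \<Rightarrow> nat \<Rightarrow> ('i, 'k) free_algebra \<Rightarrow> ('i, 'k) free_algebra \<Rightarrow> bool" where
  "conjrel i g n k p p' \<longleftrightarrow> (\<exists>L. eigs i n k L \<and> p - wsum (\<lambda>_. 1) L \<in> W i n \<and> p' - wsum (\<lambda>m. g m / g n) L \<in> W i n)"

lemma conjrel_add:
  assumes "conjrel i g n k p p'" "conjrel i g n k r r'" shows "conjrel i g n k (p + r) (p' + r')"
proof -
  obtain L L' where L: "eigs i n k L" "p - wsum (\<lambda>_. 1) L \<in> W i n" "p' - wsum (\<lambda>m. g m / g n) L \<in> W i n"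
    "eigs i n k L'" "r - wsum (\<lambda>_. 1) L' \<in> W i n" "r' - wsum (\<lambda>m. g m / g n) L' \<in> W i n"
    using assms unfolding conjrel_def by blast
  have "(p + r) - wsum (\<lambda>_. 1) (L @ L') \<in> W i n" "(p' + r') - wsum (\<lambda>m. g m / g n) (L @ L') \<in> W i n"
    using wset_add[OF L(2,5)] wset_add[OF L(3,6)] by (simp_all add: algebra_simps)
  moreover have "eigs i n k (L @ L')" using L by simp
  ultimately show ?thesis unfolding conjrel_def by blast
qed

lemma conjrel_const:
  assumes "conjrel i g n k p p'" shows "conjrel i g n k (fa_const c * p) (fa_const c * p')"
proof -
  obtain L where L: "eigs i n k L" "p - wsum (\<lambda>_. 1) L \<in> W i n" "p' - wsum (\<lambda>m. g m / g n) L \<in> W i n"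
    using assms unfolding conjrel_def by blast
  let ?L = "map (\<lambda>(m, u). (m, fa_const c * u)) L"
  have s: "wsum \<gamma> ?L = fa_const c * wsum \<gamma> L" for \<gamma>
    by (induction L) (auto simp: distrib_left fa_const_pull mult.commute)
  have "eigs i n k ?L" using eigs_scale[OF L(1), of "\<lambda>_. c"] .
  moreover have "fa_const c * p - wsum (\<lambda>_. 1) ?L \<in> W i n" "fa_const c * p' - wsum (\<lambda>m. g m / g n) ?L \<in> W i n"
    using wset_mult[OF L(2), of "fa_const c"] wset_mult[OF L(3), of "fa_const c"] by (simp_all only: s right_diff_distrib)
  ultimately show ?thesis unfolding conjrel_def by blast
qed

lemma conjrel_mono: "conjrel i g n k p p' \<Longrightarrow> k' \<le> k \<Longrightarrow> conjrel i g n k' p p'"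
  unfolding conjrel_def by (meson eigs_mono)

lemma conjrel_cong: "conjrel i g n k p p' \<Longrightarrow> r - p \<in> W i n \<Longrightarrow> r' - p' \<in> W i n \<Longrightarrow> conjrel i g n k r r'"
  unfolding conjrel_def
proof (elim exE conjE, intro exI conjI)
  fix L assume "p - wsum (\<lambda>_. 1) L \<in> W i n" "r - p \<in> W i n" "p' - wsum (\<lambda>m. g m / g n) L \<in> W i n" "r' - p' \<in> W i n"
  then show "r - wsum (\<lambda>_. 1) L \<in> W i n" "r' - wsum (\<lambda>m. g m / g n) L \<in> W i n"
    using wset_add[of "r - p" i "ell_i i n" "p - wsum (\<lambda>_. 1) L"]
      wset_add[of "r' - p'" i "ell_i i n" "p' - wsum (\<lambda>m. g m / g n) L"] by simp_all
qed

text \<open>On the component of B_j u of index m' the polynomial acts by g(m') / g(m), turning the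
  weight g(m) / g(n) of u into g(m') / g(n). The loss of 3 is the largest possible downward
  shift.\<close>

lemma conjrel_step:
  assumes g: "gaussian i \<phi> g" and k: "k \<ge> 3" and c: "conjrel i g n k p p'"
  shows "conjrel i g n (k - 3) (fa_gen j * p) (bip (\<phi> j) (fa_gen i) (fa_gen j) * p')"
proof -
  let ?x = "fa_gen i" and ?y = "fa_gen j"
  let ?t = "bip (\<phi> j) ?x ?y"
  have one: "conjrel i g n (k - 3) (?y * u) (?t * (fa_const (g m / g n) * u))" if u: "u \<in> eig i n m" and m: "m \<ge> k" for u m
  proof -
    define l where "l = m - 3"
    have ml: "m = l + 3" "k - 3 \<le> l" using k m by (auto simp: l_def)
    obtain L where L: "eigs i n l L" "fst ` set L \<subseteq> (+) l ` set (wlist i j)" "?y * u - wsum (\<lambda>_. 1) L \<in> W i n"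
      using gen_eig_decompose[of u i n l j] u ml by blast
    let ?e = "\<lambda>m'. evl (\<phi> j) (ell_i i m') (ell_i i m)"
    have w: "wsum (\<lambda>m'. g m / g n * ?e m') L = wsum (\<lambda>m'. g m' / g n) L"
      unfolding wsum_def
    proof (intro arg_cong[where f = sum_list] map_cong HOL.refl)
      fix t assume t: "t \<in> set L"
      obtain m' v where tv: "t = (m', v)" by (cases t)
      then obtain s where s: "m' = l + s" "s \<in> set (wlist i j)" using t L(2) by force
      have "?e m' * g m = g m'" using g s by (simp add: gaussian_def ml)
      then have "g m / g n * ?e m' = g m' / g n" by (metis mult.commute times_divide_eq_right)
      then show "(case t of (m', u) \<Rightarrow> fa_const (g m / g n * ?e m') * u) = (case t of (m, u) \<Rightarrow> fa_const (g m / g n) * u)"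
        by (simp only: tv prod.case)
    qed
    let ?Y = "evx (\<phi> j) ?x (ell_i i m)"
    have "(?t * u - ?Y * (?y * u)) + (?Y * (?y * u - wsum (\<lambda>_. 1) L)) + (?Y * wsum (\<lambda>_. 1) L - wsum (\<lambda>m'. ?e m' * 1) L) \<in> W i n"
      by (intro wset_add wset_mult L(3) bip_eig u wsum_diag[OF diag_evx L(1)])
    then have "fa_const (g m / g n) * (?t * u - wsum ?e L) \<in> W i n"
      by (intro wset_mult) (simp add: algebra_simps)
    moreover have "fa_const (g m / g n) * wsum ?e L = wsum (\<lambda>m'. g m / g n * ?e m') L"
      by (induction L) (auto simp: distrib_left fa_const_pull)
    ultimately have "fa_const (g m / g n) * (?t * u) - wsum (\<lambda>m'. g m' / g n) L \<in> W i n"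
      by (simp only: right_diff_distrib w)
    then have "?t * (fa_const (g m / g n) * u) - wsum (\<lambda>m'. g m' / g n) L \<in> W i n"
      by (simp only: fa_const_left)
    then show ?thesis unfolding conjrel_def using L(1,3) eigs_mono[OF L(1) ml(2)] by blast
  qed
  obtain L where L: "eigs i n k L" "p - wsum (\<lambda>_. 1) L \<in> W i n" "p' - wsum (\<lambda>m. g m / g n) L \<in> W i n"
    using c unfolding conjrel_def by blast
  have "conjrel i g n (k - 3) (?y * wsum (\<lambda>_. 1) L) (?t * wsum (\<lambda>m. g m / g n) L)"
    using L(1)
  proof (induction L)
    case Nil
    show ?case unfolding conjrel_def by (intro exI[of _ "[]"]) (simp add: wset_zero)
  next
    case (Cons t L)
    obtain m u where t: "t = (m, u)" by (cases t)
    show ?case using conjrel_add[OF one[of u m] Cons.IH] Cons.prems by (simp add: t distrib_left)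
  qed
  moreover have "?y * p - ?y * wsum (\<lambda>_. 1) L \<in> W i n" "?t * p' - ?t * wsum (\<lambda>m. g m / g n) L \<in> W i n"
    using wset_mult[OF L(2), of ?y] wset_mult[OF L(3), of ?t] by (simp_all add: right_diff_distrib)
  ultimately show ?thesis by (rule conjrel_cong)
qed

lemma conjrel_one:
  assumes "gaussian i \<phi> g" shows "conjrel i g n n 1 1"
proof -
  have "1 \<in> eig i n n" using wset_right[of 1 i "ell_i i n"] by (simp add: eig_def)
  then show ?thesis using assms
    unfolding conjrel_def by (intro exI[of _ "[(n, 1)]"]) (simp add: wset_zero gaussian_def)
qed

lemma conjrel_word:
  assumes g: "gaussian i \<phi> g" and n: "3 * length w \<le> n"
  shows "conjrel i g n (n - 3 * length w) (mon w) (tauh i \<phi> (mon w))"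
  using n
proof (induction w)
  case Nil
  show ?case using conjrel_one[OF g] by (simp add: single_Word_Nil tauh_def)
next
  case (Cons j w)
  have "conjrel i g n (n - 3 * length w - 3) (fa_gen j * mon w) (bip (\<phi> j) (fa_gen i) (fa_gen j) * tauh i \<phi> (mon w))"
    using Cons by (intro conjrel_step[OF g]) auto
  moreover have "tauh i \<phi> (fa_gen j * mon w) = bip (\<phi> j) (fa_gen i) (fa_gen j) * tauh i \<phi> (mon w)"
    by (simp add: tauh_def fa_hom_gen_mult)
  ultimately show ?case by (simp add: fa_gen_mult_single add.commute)
qed

lemma conjrel_tauh:
  assumes g: "gaussian i \<phi> g"
  shows "\<exists>n0. \<forall>n\<ge>n0. conjrel i g n 0 p (tauh i \<phi> p)"
proof (induction p rule: fa_single_induct)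
  case (single w c)
  have "conjrel i g n 0 (Poly_Mapping.single (Word w) c) (tauh i \<phi> (Poly_Mapping.single (Word w) c))" if "n \<ge> 3 * length w" for n
  proof -
    have "conjrel i g n 0 (fa_const c * mon w) (fa_const c * tauh i \<phi> (mon w))"
      by (rule conjrel_const[OF conjrel_mono[OF conjrel_word[OF g that]]]) simp
    moreover have "fa_const c * tauh i \<phi> (mon w) = tauh i \<phi> (fa_const c * mon w)"
      by (simp add: tauh_def fa_hom_linear)
    ultimately show ?thesis by (simp add: fa_const_mult_single)
  qed
  then show ?case by blast
next
  case (add p r)
  then obtain n0 n1 where "\<forall>n\<ge>n0. conjrel i g n 0 p (tauh i \<phi> p)" "\<forall>n\<ge>n1. conjrel i g n 0 r (tauh i \<phi> r)" by blast
  then have "\<forall>n\<ge>max n0 n1. conjrel i g n 0 (p + r) (tauh i \<phi> (p + r))"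
    by (auto simp: tauh_def fa_hom_linear intro: conjrel_add)
  then show ?case by blast
qed

lemma ker_sep:
  assumes "\<And>n. n \<ge> n0 \<Longrightarrow> p \<in> W i n" shows "p \<in> ker"
  by (rule ker_separation[OF q_generic.inj_ell[OF qi_generic[of i]] assms])

text \<open>If p is zero in the quotient, its eigencomponents add up to zero, hence so do the
  reweighted ones, which represent the image of p.\<close>

lemma tauh_ker:
  assumes g: "gaussian i \<phi> g" and p: "p \<in> ker"
  shows "tauh i \<phi> p \<in> ker"
proof -
  obtain n0 where n0: "\<forall>n\<ge>n0. conjrel i g n 0 p (tauh i \<phi> p)" using conjrel_tauh[OF g] by blast
  show ?thesis
  proof (rule ker_sep)
    fix n assume "n \<ge> n0"
    then obtain L where L: "eigs i n 0 L" "p - wsum (\<lambda>_. 1) L \<in> W i n" "tauh i \<phi> p - wsum (\<lambda>m. g m / g n) L \<in> W i n"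
      using n0 unfolding conjrel_def by blast
    have "p - (p - wsum (\<lambda>_. 1) L) \<in> W i n" by (intro wset_diff wset_ker p L)
    then have "wsum (\<lambda>_. 1) L \<in> W i n" by simp
    from wsum_weight[OF L(1) this, of "\<lambda>m. g m / g n"] wset_add[OF L(3)] show "tauh i \<phi> p \<in> W i n"
      by fastforce
  qed
qed

lemma tauh_inverse:
  assumes g: "gaussian i \<phi> g" and g': "gaussian i \<phi>' (\<lambda>m. 1 / g m)"
  shows "tauh i \<phi>' (tauh i \<phi> p) - p \<in> ker"
proof -
  obtain n0 where n0: "\<forall>n\<ge>n0. conjrel i g n 0 p (tauh i \<phi> p)" using conjrel_tauh[OF g] by blast
  obtain n1 where n1: "\<forall>n\<ge>n1. conjrel i (\<lambda>m. 1 / g m) n 0 (tauh i \<phi> p) (tauh i \<phi>' (tauh i \<phi> p))"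
    using conjrel_tauh[OF g'] by blast
  show ?thesis
  proof (rule ker_sep)
    fix n assume "n \<ge> max n0 n1"
    then obtain L L' where L: "eigs i n 0 L" "p - wsum (\<lambda>_. 1) L \<in> W i n" "tauh i \<phi> p - wsum (\<lambda>m. g m / g n) L \<in> W i n"
      and L': "eigs i n 0 L'" "tauh i \<phi> p - wsum (\<lambda>_. 1) L' \<in> W i n"
        "tauh i \<phi>' (tauh i \<phi> p) - wsum (\<lambda>m. (1 / g m) / (1 / g n)) L' \<in> W i n"
      using n0 n1 unfolding conjrel_def by (metis max.bounded_iff)
    have nz: "g m \<noteq> 0" for m using g by (simp add: gaussian_def)
    \<comment> \<open>The image of p has two decompositions: the reweighted one of p, and its own,
      \<open>L'\<close>. Their difference is a vanishing sum of eigenvectors; rescaling it by g(n) /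
      g(m) compares p with the twofold image.\<close>
    let ?M = "map (\<lambda>(m, u). (m, fa_const (g m / g n) * u)) L"
    let ?M' = "map (\<lambda>(m, u). (m, fa_const (-1) * u)) L'"
    have "(tauh i \<phi> p - wsum (\<lambda>_. 1) L') - (tauh i \<phi> p - wsum (\<lambda>m. g m / g n) L) \<in> W i n"
      by (intro wset_diff L L')
    then have "wsum (\<lambda>_. 1) (?M @ ?M') \<in> W i n"
      by (simp add: wsum_scale wsum_uminus)
    moreover have "eigs i n 0 (?M @ ?M')" using L(1) L'(1) by (simp add: eigs_scale)
    ultimately have "wsum (\<lambda>m. g n / g m * 1) (?M @ ?M') \<in> W i n"
      by (intro wsum_weight) auto
    then have "wsum (\<lambda>_. 1) L - wsum (\<lambda>m. (1 / g m) / (1 / g n)) L' \<in> W i n"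
      using nz by (simp add: wsum_scale wsum_uminus)
    from wset_diff[OF wset_diff[OF L'(3) L(2)] this] show "tauh i \<phi>' (tauh i \<phi> p) - p \<in> W i n"
      by (simp add: algebra_simps)
  qed
qed

text \<open>Conjugation by a function of \<open>B\<^sub>i\<close> fixes whatever commutes with \<open>B\<^sub>i\<close>.\<close>

lemma tauh_fix:
  assumes g: "gaussian i \<phi> g" and c: "fa_gen i * p - p * fa_gen i \<in> ker"
  shows "tauh i \<phi> p - p \<in> ker"
proof -
  obtain n0 where n0: "\<forall>n\<ge>n0. conjrel i g n 0 p (tauh i \<phi> p)" using conjrel_tauh[OF g] by blast
  show ?thesis
  proof (rule ker_sep)
    fix n assume "n \<ge> n0"
    then obtain L where L: "eigs i n 0 L" "p - wsum (\<lambda>_. 1) L \<in> W i n" "tauh i \<phi> p - wsum (\<lambda>m. g m / g n) L \<in> W i n"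
      using n0 unfolding conjrel_def by blast
    have nz: "g m \<noteq> 0" for m using g by (simp add: gaussian_def)
    \<comment> \<open>Commuting with B_i makes p an eigenvector of index n, so that its weight g(n)
      / g(n) is 1.\<close>
    have "(fa_gen i - fa_const (ell_i i n)) * p = p * (fa_gen i - fa_const (ell_i i n)) + (fa_gen i * p - p * fa_gen i)"
      by (simp add: algebra_simps fa_const_pull)
    also have "\<dots> \<in> W i n" by (intro wset_add wset_right wset_ker c)
    finally have "p \<in> eig i n n" by (simp add: eig_def)
    then have "eigs i n 0 ((n, fa_const (-1) * p) # L)" using L(1) by (simp add: eig_const_mult)
    moreover have "wsum (\<lambda>_. 1) ((n, fa_const (-1) * p) # L) \<in> W i n"
      using wset_uminus[OF L(2)] by (simp add: fa_const_uminus)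
    ultimately have "wsum (\<lambda>m. g m / g n * 1) ((n, fa_const (-1) * p) # L) \<in> W i n"
      by (rule wsum_weight)
    then have "wsum (\<lambda>m. g m / g n) L - p \<in> W i n" using nz by (simp add: fa_const_uminus)
    from wset_add[OF L(3) this] show "tauh i \<phi> p - p \<in> W i n" by simp
  qed
qed

definition flip :: "('k \<times> nat \<times> nat) list \<Rightarrow> ('k \<times> nat \<times> nat) list" where
  "flip = map (\<lambda>(c, m, n). (c, n, m))"

lemma evl_flip: "evl (flip f) l r = evl f r l"
  by (induction f) (auto simp: flip_def mult_ac)

definition phim :: "'i \<Rightarrow> 'i \<Rightarrow> ('k \<times> nat \<times> nat) list" where
  "phim i j = q_generic.plist (qi i) (if j = i then 0 else a i j)"

text \<open>The formulas of the inverse arise from those of \<open>phim\<close> by exchanging left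
  and right multiplication.\<close>

definition phip :: "'i \<Rightarrow> 'i \<Rightarrow> ('k \<times> nat \<times> nat) list" where
  "phip i j = flip (phim i j)"

lemma gaussian_phim: "gaussian i (phim i) (q_generic.gauss (qi i))"
proof -
  interpret qq: q_generic "qi i" by (rule qi_generic)
  have "(if j = i then 0 else a i j) \<in> {0, -1, -2, -3}" for j using a_range[of i j] by auto
  then show ?thesis unfolding gaussian_def phim_def wlist_def
    using qq.plist_gauss(1) qq.gauss_nonzero by blast
qed

lemma gaussian_phip: "gaussian i (phip i) (\<lambda>m. 1 / q_generic.gauss (qi i) m)"
proof -
  interpret qq: q_generic "qi i" by (rule qi_generic)
  have "(if j = i then 0 else a i j) \<in> {0, -1, -2, -3}" for j using a_range[of i j] by auto
  then show ?thesis unfolding gaussian_def phip_def evl_flip wlist_def phim_def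
    using qq.plist_gauss(2) qq.gauss_nonzero by (simp add: divide_simps mult.commute)
qed

definition tm :: "'i \<Rightarrow> ('i, 'k) free_algebra \<Rightarrow> ('i, 'k) free_algebra" where "tm i = tauh i (phim i)"
definition tp :: "'i \<Rightarrow> ('i, 'k) free_algebra \<Rightarrow> ('i, 'k) free_algebra" where "tp i = tauh i (phip i)"

lemma tm_ker: "p \<in> ker \<Longrightarrow> tm i p \<in> ker" and tp_ker: "p \<in> ker \<Longrightarrow> tp i p \<in> ker"
  unfolding tm_def tp_def by (erule tauh_ker[OF gaussian_phim] tauh_ker[OF gaussian_phip])+

lemma tp_tm: "tp i (tm i p) - p \<in> ker"
  unfolding tm_def tp_def by (rule tauh_inverse[OF gaussian_phim gaussian_phip])

lemma tm_tp: "tm i (tp i p) - p \<in> ker"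
  unfolding tm_def tp_def by (rule tauh_inverse[OF gaussian_phip]) (use gaussian_phim[of i] in simp)

lemma tm_fix: "fa_gen i * p - p * fa_gen i \<in> ker \<Longrightarrow> tm i p - p \<in> ker"
  unfolding tm_def by (rule tauh_fix[OF gaussian_phim])

end

section \<open>Comparing polynomials in left and right multiplication by their coefficients\<close>

definition coef :: "('k \<times> nat \<times> nat) list \<Rightarrow> nat \<Rightarrow> nat \<Rightarrow> 'k::field" where
  "coef f m n = (\<Sum>(c, k, l)\<leftarrow>f. if k = m \<and> l = n then c else 0)"

lemma bip_coef:
  assumes "finite S" "set (map snd f) \<subseteq> S"
  shows "bip f x y = (\<Sum>(m, n)\<in>S. fa_const (coef f m n) * (x ^ m * y * x ^ n))"
  using assms(2)
proof (induction f)
  case (Cons t f)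
  obtain c k l where t: "t = (c, k, l)" by (cases t)
  have "(\<Sum>(m, n)\<in>S. fa_const (coef (t # f) m n) * (x ^ m * y * x ^ n)) =
    (\<Sum>z\<in>S. if z = (k, l) then fa_const c * (x ^ k * y * x ^ l) else 0) + (\<Sum>(m, n)\<in>S. fa_const (coef f m n) * (x ^ m * y * x ^ n))"
    unfolding sum.distrib[symmetric]
    by (intro sum.cong HOL.refl) (auto simp: coef_def t fa_const_add distrib_right split: if_splits)
  also have "(\<Sum>z\<in>S. if z = (k, l) then fa_const c * (x ^ k * y * x ^ l) else 0) = fa_const c * (x ^ k * y * x ^ l)"
    using Cons.prems assms(1) by (simp add: t sum.delta')
  finally show ?case using Cons by (simp add: t mult.assoc)
qed (simp add: coef_def)

text \<open>Turns an identity between noncommutative expressions into finitely many scalar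
  identities, one for each pair of exponents, which Groebner bases decide.\<close>

lemma bip_cong:
  assumes "\<forall>(m, n)\<in>set (map snd (f @ g)). coef f m n = coef g m n"
  shows "bip f x y = bip g x y"
proof -
  let ?S = "set (map snd (f @ g))"
  have "(\<Sum>(m, n)\<in>?S. fa_const (coef f m n) * (x ^ m * y * x ^ n)) = (\<Sum>(m, n)\<in>?S. fa_const (coef g m n) * (x ^ m * y * x ^ n))"
  proof (rule sum.cong)
    fix z assume "z \<in> ?S"
    moreover obtain m n where "z = (m, n)" by (cases z)
    ultimately show "(case z of (m, n) \<Rightarrow> fa_const (coef f m n) * (x ^ m * y * x ^ n)) =
        (case z of (m, n) \<Rightarrow> fa_const (coef g m n) * (x ^ m * y * x ^ n))"
      using assms by fastforce
  qed simp
  then show ?thesis using bip_coef[of ?S f x y] bip_coef[of ?S g x y] by simp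
qed

definition lscale :: "'k \<Rightarrow> ('k::field \<times> nat \<times> nat) list \<Rightarrow> ('k \<times> nat \<times> nat) list" where
  "lscale b = map (\<lambda>(c, m, n). (b * c, m, n))"

definition lshift :: "('k::field \<times> nat \<times> nat) list \<Rightarrow> ('k \<times> nat \<times> nat) list" where
  "lshift = map (\<lambda>(c, m, n). (c, Suc m, n))"

definition rshift :: "('k::field \<times> nat \<times> nat) list \<Rightarrow> ('k \<times> nat \<times> nat) list" where
  "rshift = map (\<lambda>(c, m, n). (c, m, Suc n))"

lemma bip_append: "bip (f @ g) x y = bip f x y + bip g x y"
  by (simp add: bip_def)

lemma bip_lscale: "bip (lscale b f) x y = fa_const b * bip f x y"
  by (induction f) (auto simp: lscale_def distrib_left fa_const_mult mult.assoc)

lemma bip_lshift: "bip (lshift f) x y = x * bip f x y"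
  by (induction f) (auto simp: lshift_def distrib_left fa_const_pull mult.assoc)

lemma bip_rshift: "bip (rshift f) x y = bip f x y * x"
  by (induction f) (auto simp: rshift_def distrib_right mult.assoc power_commutes)

section \<open>The braid relations\<close>

text \<open>Facts on subsystems of rank two and three. By \<open>short\<close>, q_i = q whenever a
  double or triple bond starts at i, in agreement with the formulas for a = -2 and a = -3, which are
  written in q.\<close>

locale braid_datum = cartan_datum a d q
  for a :: "'i \<Rightarrow> 'i \<Rightarrow> int" and d :: "'i \<Rightarrow> int" and q :: "'k::field" +
  fixes m :: "'i \<Rightarrow> 'i \<Rightarrow> nat"
  assumes a_pairs: "i \<noteq> j \<Longrightarrow> (a i j, a j i) \<in> {(0,0), (-1,-1), (-1,-2), (-2,-1), (-1,-3), (-3,-1)}"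
    and short: "i \<noteq> j \<Longrightarrow> a i j < -1 \<Longrightarrow> d i = 1"
    and no_triangle: "i \<noteq> j \<Longrightarrow> j \<noteq> k \<Longrightarrow> i \<noteq> k \<Longrightarrow> a i j = 0 \<or> a j k = 0 \<or> a i k = 0"
    and m: "i \<noteq> j \<Longrightarrow> m i j = (if a i j * a j i = 0 then 2 else if a i j * a j i = 1 then 3 else if a i j * a j i = 2 then 4 else 6)"
begin

definition eqv :: "('i, 'k) free_algebra \<Rightarrow> ('i, 'k) free_algebra \<Rightarrow> bool" (infix \<open>\<approx>\<close> 50) where
  "p \<approx> r \<longleftrightarrow> p - r \<in> ker"

lemma eqv_refl [simp]: "p \<approx> p"
  by (simp add: eqv_def kerI)

lemma eqv_sym: "p \<approx> r \<Longrightarrow> r \<approx> p"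
  unfolding eqv_def using kerI(5) by fastforce

lemma eqv_trans [trans]: "p \<approx> r \<Longrightarrow> r \<approx> s \<Longrightarrow> p \<approx> s"
  unfolding eqv_def using kerI(2)[of "p - r" "r - s"] by simp

lemma eqv_eq_trans [trans]: "p = r \<Longrightarrow> r \<approx> s \<Longrightarrow> p \<approx> s" "p \<approx> r \<Longrightarrow> r = s \<Longrightarrow> p \<approx> s"
  by simp_all

lemma eqv_add: "p \<approx> p' \<Longrightarrow> r \<approx> r' \<Longrightarrow> p + r \<approx> p' + r'"
  unfolding eqv_def using kerI(2)[of "p - p'" "r - r'"] by (simp add: algebra_simps)

lemma eqv_diff: "p \<approx> p' \<Longrightarrow> r \<approx> r' \<Longrightarrow> p - r \<approx> p' - r'"
  unfolding eqv_def using kerI(6)[of "p - p'" "r - r'"] by (simp add: algebra_simps)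

lemma eqv_mult: "p \<approx> p' \<Longrightarrow> r \<approx> r' \<Longrightarrow> p * r \<approx> p' * r'"
  unfolding eqv_def using kerI(2)[OF kerI(4)[of "p - p'" r] kerI(3)[of "r - r'" p']] by (simp add: algebra_simps)

lemma tm_hom: "tm i = fa_hom (\<lambda>j. bip (phim i j) (fa_gen i) (fa_gen j))"
  and tp_hom: "tp i = fa_hom (\<lambda>j. bip (phip i j) (fa_gen i) (fa_gen j))"
  by (simp_all add: tm_def tp_def tauh_def)

lemma tm_eqv: "p \<approx> r \<Longrightarrow> tm i p \<approx> tm i r"
  unfolding eqv_def using tm_ker[of "p - r" i] by (simp add: tm_hom fa_hom_linear)

lemma tm_tp_eqv: "tm i (tp i p) \<approx> p" and tp_tm_eqv: "tp i (tm i p) \<approx> p"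
  by (simp_all add: eqv_def tm_tp tp_tm)

lemma tp_eqv: "p \<approx> r \<Longrightarrow> tp i p \<approx> tp i r"
  unfolding eqv_def using tp_ker[of "p - r" i] by (simp add: tp_hom fa_hom_linear)

lemma tm_gen: "tm i (fa_gen j) = bip (phim i j) (fa_gen i) (fa_gen j)"
  and tp_gen: "tp i (fa_gen j) = bip (phip i j) (fa_gen i) (fa_gen j)"
  by (simp_all add: tm_hom tp_hom)

lemma tm_self: "tm i (fa_gen i) = fa_gen i"
  using q_generic.plist_def[OF qi_generic[of i]] by (simp add: tm_gen phim_def Let_def)

lemma tm_zero: "a i j = 0 \<Longrightarrow> tm i (fa_gen j) = fa_gen j"
  using q_generic.plist_def[OF qi_generic[of i]] by (simp add: tm_gen phim_def Let_def)

lemma tm_one: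
  assumes "i \<noteq> j" "a i j = -1"
  shows "tm i (fa_gen j) = fa_gen i * fa_gen j - fa_const (qi i) * (fa_gen j * fa_gen i)"
    "tp i (fa_gen j) = fa_gen j * fa_gen i - fa_const (qi i) * (fa_gen i * fa_gen j)"
  using q_generic.plist_def[OF qi_generic[of i]] assms
  by (simp_all add: tm_gen tp_gen phip_def phim_def flip_def Let_def fa_const_uminus mult.assoc)

lemma key_2:
  assumes "i \<noteq> j" "a i j * a j i = 0" shows "tm j (fa_gen i) \<approx> fa_gen i"
  using a_pairs[OF assms(1)] assms(2) by (auto simp: tm_zero)

text \<open>Since q_i = q_j here, the formulas for \<open>tm i (fa_gen j)\<close> and
  \<open>tp j (fa_gen i)\<close> are literally the same.\<close>

lemma key_3:
  assumes "i \<noteq> j" "a i j * a j i = 1" shows "tm j (tm i (fa_gen j)) \<approx> fa_gen i"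
proof -
  have a1: "a i j = -1" "a j i = -1" using a_pairs[OF assms(1)] assms(2) by auto
  then have "d i = d j" using a_sym[of i j] by simp
  then have "tm i (fa_gen j) = tp j (fa_gen i)"
    using assms(1) a1 by (simp add: tm_one qi_def)
  then show ?thesis using tm_tp_eqv by simp
qed

lemma tm_bip: "tm i (bip f p r) = bip f (tm i p) (tm i r)"
  and tp_bip: "tp i (bip f p r) = bip f (tp i p) (tp i r)"
  by (induction f) (auto simp: tm_hom tp_hom fa_hom_linear)

lemma eqv_drel: "i \<noteq> j \<Longrightarrow> p = r + c * drel i j * e \<Longrightarrow> p \<approx> r"
  unfolding eqv_def by (simp add: kerI(3) kerI(4) drel_ker)

text \<open>In the next lemmas \<open>w = yx - Q xy\<close> is the image of \<open>x\<close> under \<open>\<tau>\<^sub>l\<close>; the relation between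
  \<open>y\<close> and \<open>x\<close> says that \<open>wy = Q yw + x\<close> modulo the kernel.\<close>

lemma long_relation:
  assumes ls: "l \<noteq> s" "a l s = -1"
  shows "(fa_gen l * fa_gen s - fa_const (qi l) * (fa_gen s * fa_gen l)) * fa_gen l
    - fa_const (qi l) * (fa_gen l * (fa_gen l * fa_gen s - fa_const (qi l) * (fa_gen s * fa_gen l))) \<approx> fa_gen s"
proof -
  let ?x = "fa_gen s :: ('i, 'k) free_algebra" and ?y = "fa_gen l :: ('i, 'k) free_algebra"
  let ?Q = "qi l"
  have Q0: "?Q \<noteq> 0" using q_generic.p0[OF qi_generic] .
  let ?w = "?y * ?x - fa_const ?Q * (?x * ?y)"
  have "?w * ?y - fa_const ?Q * (?y * ?w) = bip [(1,1,1), (- ?Q,0,2), (- ?Q,2,0), (?Q * ?Q,1,1)] ?y ?x"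
    by (simp add: algebra_simps fa_const_pull power2_eq_square fa_const_uminus)
  \<comment> \<open>The deformation term 1/Q of the relation, multiplied by -Q, is -1; the entry
    \<open>(1,0,0)\<close>, which is x itself, compensates it.\<close>
  also have "\<dots> = bip ([(1,0,0)] @ lscale (- ?Q) (dlist ?Q (inverse ?Q) (-1))) ?y ?x"
    by (rule bip_cong) (use Q0 in \<open>simp add: coef_def dlist_def lscale_def algebra_simps\<close>)
  also have "\<dots> = ?x + fa_const (- ?Q) * drel l s * 1"
    unfolding bip_append bip_lscale drel_def ls(2) by simp
  finally show ?thesis by (rule eqv_drel[OF ls(1)])
qed

section \<open>Rank two with a multiple bond: s stands for the short and l for the long simple
  root\<close>

context
  fixes s l :: 'i and P w2 w3 r :: 'k
  assumes sl: "s \<noteq> l" and P: "P = qi s" and ls1: "a l s = -1"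
    and r: "r = inverse P" and w2: "w2 = inverse (qint P 2)" and w3: "w3 = inverse (qint P 3)"
begin

lemma Pr_rels: "P * r = 1" "w2 * (P + r) = 1" "w3 * (P ^ 2 + r ^ 2 + 1) = 1"
  using q_generic.p0[OF qi_generic[of s]] q_generic.qint_23(3,4)[OF qi_generic[of s]]
  by (simp_all add: P r w2 w3)

abbreviation "gx \<equiv> fa_gen s :: ('i, 'k) free_algebra"
abbreviation "gy \<equiv> fa_gen l :: ('i, 'k) free_algebra"

lemma tlx: "tm l gx = gy * gx - fa_const (qi l) * (gx * gy)" "tp l gx = gx * gy - fa_const (qi l) * (gy * gx)"
  using sl ls1 by (simp_all add: tm_one)

lemma tsy: "tm s gy = bip (q_generic.plist P (a s l)) gx gy" "tp s gy = bip (flip (q_generic.plist P (a s l))) gx gy"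
  using sl by (simp_all add: tm_gen tp_gen phim_def phip_def P)

lemma tstlx:
  "tm s (tm l gx) = bip (rshift (q_generic.plist P (a s l)) @ lscale (- qi l) (lshift (q_generic.plist P (a s l)))) gx gy"
  "tp s (tp l gx) = bip (lshift (flip (q_generic.plist P (a s l))) @ lscale (- qi l) (rshift (flip (q_generic.plist P (a s l))))) gx gy"
proof -
  have "tm s (tm l gx) = tm s gy * gx - fa_const (qi l) * (gx * tm s gy)"
    unfolding tlx by (simp add: tm_hom fa_hom_linear) (simp add: tm_self[unfolded tm_gen] tm_gen)
  then show "tm s (tm l gx) = bip (rshift (q_generic.plist P (a s l)) @ lscale (- qi l) (lshift (q_generic.plist P (a s l)))) gx gy"
    unfolding tsy bip_append bip_lscale bip_lshift bip_rshift by (simp add: fa_const_uminus)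
  have ts: "tp s gx = gx"
    using q_generic.plist_def[OF qi_generic[of s]] by (simp add: tp_gen phip_def phim_def flip_def Let_def)
  have "tp s (tp l gx) = gx * tp s gy - fa_const (qi l) * (tp s gy * gx)"
    unfolding tlx by (simp add: tp_hom fa_hom_linear) (simp add: ts[unfolded tp_gen] tp_gen)
  then show "tp s (tp l gx) = bip (lshift (flip (q_generic.plist P (a s l))) @ lscale (- qi l) (rshift (flip (q_generic.plist P (a s l))))) gx gy"
    unfolding tsy bip_append bip_lscale bip_lshift bip_rshift by (simp add: fa_const_uminus)
qed

lemma plist2: "q_generic.plist P (-2) = [(w2,2,0), (- P,1,1), (w2 * P ^ 2,0,2), (1,0,0)]"
proof -
  interpret qq: q_generic P unfolding P by (rule qi_generic)
  have "w2 * (P * qint P 2) = P" using qq.qint_nonzero[of 2] by (simp add: w2)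
  then show ?thesis by (simp add: qq.plist_def Let_def flip: w2)
qed

lemma plist3: "q_generic.plist P (-3) = [(w2 * w3,3,0), (- (w2 * P),2,1), (w2 * P ^ 2,1,2), (- (w2 * w3 * P ^ 3),0,3),
      (w2 * w3 * r,1,0), (- (w2 * w3 * P ^ 2),0,1), (1,1,0), (- P,0,1)]"
proof -
  interpret qq: q_generic P unfolding P by (rule qi_generic)
  have "w3 * w2 * (P * qint P 3) = w2 * P" "w3 * w2 * (P ^ 2 * qint P 3) = w2 * P ^ 2" "r * P ^ 3 = P ^ 2"
    using qq.qint_nonzero[of 3] qq.p0 by (simp_all add: w3 r eval_nat_numeral)
  then show ?thesis by (simp add: qq.plist_def Let_def mult_ac flip: w2 w3 r)
qed

text \<open>In the first relation a multiple of the deformed Serre relation, chosen to cancel the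
  cubic terms, leaves the formula of the inverse. In the second, w = \<open>tm l gx\<close> is
  substituted for B_s, and \<open>long_relation\<close> lowers the degree in w.\<close>

lemma B2_relations:
  assumes sl2: "a s l = -2"
  shows "tm s (tm l gx) \<approx> tp l gx" "tm l (tm s gy) \<approx> tp s gy"
proof -
  note c = Pr_rels
  have "d s = 1" using short[OF sl] sl2 by simp
  moreover from this have "d l = 2" using a_sym[of s l] sl2 ls1 by simp
  ultimately have ql: "qi l = P ^ 2" by (simp add: P qi_def)
  have "tm s (tm l gx) = bip ([(1,1,0), (- (P ^ 2),0,1)] @ lscale (- (P ^ 2 * w2)) (dlist P r (-2))) gx gy"
    unfolding tstlx(1) sl2 plist2 ql
    apply (rule bip_cong)
    apply (simp add: coef_def lscale_def lshift_def rshift_def dlist_def Let_def flip: r)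
    apply (intro conjI; (use c in Groebner_Basis.algebra))
    done
  also have "\<dots> = tp l gx + fa_const (- (P ^ 2 * w2)) * drel s l * 1"
    by (simp add: bip_append bip_lscale drel_def sl2 tlx(2) ql fa_const_uminus mult.assoc flip: P r)
  finally show "tm s (tm l gx) \<approx> tp l gx" by (rule eqv_drel[OF sl])
  define w where "w = tm l gx"
  have w: "w * gy - fa_const (P ^ 2) * (gy * w) \<approx> gx"
    using long_relation[OF not_sym[OF sl] ls1] by (simp add: w_def tlx ql)
  have "tm l (tm s gy) = bip (q_generic.plist P (-2)) w gy"
    using tm_self[of l] by (simp add: tsy tm_bip sl2 w_def)
  \<comment> \<open>The middle coefficient P is split as w2 P^2 + w2, so that w B_l - P^2 B_l w can
    be factored out twice.\<close>
  also have "\<dots> = bip [(w2,2,0), (- (w2 * P ^ 2),1,1), (- w2,1,1), (w2 * P ^ 2,0,2), (1,0,0)] w gy"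
    unfolding plist2
    apply (rule bip_cong)
    apply (simp add: coef_def)
    apply (use c in Groebner_Basis.algebra)
    done
  also have "\<dots> = fa_const w2 * (w * (w * gy - fa_const (P ^ 2) * (gy * w)) - (w * gy - fa_const (P ^ 2) * (gy * w)) * w) + gy"
    by (simp add: algebra_simps fa_const_pull power2_eq_square fa_const_uminus)
  also have "\<dots> \<approx> fa_const w2 * (w * gx - gx * w) + gy"
    by (intro eqv_add eqv_mult eqv_diff w eqv_refl)
  also have "\<dots> = bip (lscale w2 [(1,0,2), (- (P ^ 2),1,1), (-1,1,1), (P ^ 2,2,0)] @ [(1,0,0)]) gx gy"
    unfolding bip_append bip_lscale w_def tlx ql by (simp add: algebra_simps fa_const_pull power2_eq_square fa_const_uminus)
  also have "\<dots> = tp s gy"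
    unfolding tsy sl2 plist2
    apply (rule bip_cong)
    apply (simp add: coef_def lscale_def flip_def)
    apply (use c in Groebner_Basis.algebra)
    done
  finally show "tm l (tm s gy) \<approx> tp s gy" .
qed

text \<open>The remainder, quadratic in B_s, of \<open>tm s (tm l gx)\<close> after its quartic
  terms are removed by the deformed Serre relation.\<close>

definition vlist :: "('k \<times> nat \<times> nat) list" where
  "vlist = [(w2,2,0), (- (w2 * (P ^ 2 * (P + r))),1,1), (w2 * P ^ 4,0,2), (w2 * (P * (P ^ 2 + r ^ 2 + 1)),0,0)]"

text \<open>The products of two operators and of their inverses leave mirror images of one quadratic
  expression, and \<open>tm l\<close> carries one to the other: after substituting w =
  \<open>tm l gx\<close>, each occurrence of w B_l - q_l B_l w becomes B_s by
  \<open>long_relation\<close>.\<close>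

lemma G2_relations:
  assumes sl3: "a s l = -3"
  shows "tm s (tm l gx) \<approx> bip vlist gx gy" "tp s (tp l gx) \<approx> bip (flip vlist) gx gy"
    "tm l (bip vlist gx gy) \<approx> bip (flip vlist) gx gy" "qi l = P ^ 3"
proof -
  note c = Pr_rels
  have "d s = 1" using short[OF sl] sl3 by simp
  moreover from this have "d l = 3" using a_sym[of s l] sl3 ls1 by simp
  ultimately show ql: "qi l = P ^ 3" by (simp add: P qi_def)
  have "tm s (tm l gx) = bip (vlist @ lscale (- (P ^ 3 * w2 * w3)) (dlist P r (-3))) gx gy"
    unfolding tstlx(1) sl3 plist3 ql vlist_def
    apply (rule bip_cong)
    apply (simp add: coef_def lscale_def lshift_def rshift_def dlist_def Let_def flip: r)
    apply (intro conjI; (use c in Groebner_Basis.algebra))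
    done
  also have "\<dots> = bip vlist gx gy + fa_const (- (P ^ 3 * w2 * w3)) * drel s l * 1"
    by (simp only: bip_append bip_lscale drel_def sl3 P[symmetric] r[symmetric] mult_1_right)
  finally show "tm s (tm l gx) \<approx> bip vlist gx gy" by (rule eqv_drel[OF sl])
  have "tp s (tp l gx) = bip (flip vlist @ lscale (- (P ^ 3 * w2 * w3)) (dlist P r (-3))) gx gy"
    unfolding tstlx(2) sl3 plist3 ql vlist_def
    apply (rule bip_cong)
    apply (simp add: coef_def lscale_def lshift_def rshift_def flip_def dlist_def Let_def flip: r)
    apply (intro conjI; (use c in Groebner_Basis.algebra))
    done
  also have "\<dots> = bip (flip vlist) gx gy + fa_const (- (P ^ 3 * w2 * w3)) * drel s l * 1"
    by (simp only: bip_append bip_lscale drel_def sl3 P[symmetric] r[symmetric] mult_1_right)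
  finally show "tp s (tp l gx) \<approx> bip (flip vlist) gx gy" by (rule eqv_drel[OF sl])
  define w where "w = tm l gx"
  have w: "w * gy - fa_const (P ^ 3) * (gy * w) \<approx> gx"
    using long_relation[OF not_sym[OF sl] ls1] by (simp add: w_def tlx ql)
  let ?g = "w2 * (P * (P ^ 2 + r ^ 2 + 1))"
  have "tm l (bip vlist gx gy) = bip vlist w gy"
    using tm_self[of l] by (simp add: tm_bip w_def)
  also have "\<dots> = bip [(w2,2,0), (- (w2 * P ^ 3),1,1), (- (w2 * P),1,1), (w2 * P ^ 4,0,2), (?g,0,0)] w gy"
    unfolding vlist_def
    apply (rule bip_cong)
    apply (simp add: coef_def)
    apply (use c in Groebner_Basis.algebra)
    done
  also have "\<dots> = fa_const w2 * (w * (w * gy - fa_const (P ^ 3) * (gy * w)) - fa_const P * ((w * gy - fa_const (P ^ 3) * (gy * w)) * w)) + fa_const ?g * gy"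
    by (simp add: algebra_simps fa_const_pull power2_eq_square power3_eq_cube power4_eq_xxxx fa_const_uminus)
  also have "\<dots> \<approx> fa_const w2 * (w * gx - fa_const P * (gx * w)) + fa_const ?g * gy"
    by (intro eqv_add eqv_mult eqv_diff w eqv_refl)
  also have "\<dots> = bip (lscale w2 [(1,0,2), (- (P ^ 3),1,1), (- P,1,1), (P ^ 4,2,0)] @ [(?g,0,0)]) gx gy"
    unfolding bip_append bip_lscale w_def tlx ql
    by (simp add: algebra_simps fa_const_pull power2_eq_square power3_eq_cube power4_eq_xxxx fa_const_uminus)
  also have "\<dots> = bip (flip vlist) gx gy"
    unfolding vlist_def
    apply (rule bip_cong)
    apply (simp add: coef_def lscale_def flip_def)
    apply (use c in Groebner_Basis.algebra)
    done
  finally show "tm l (bip vlist gx gy) \<approx> bip (flip vlist) gx gy" .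
qed

text \<open>Solves the quadratic expression, and its mirror image, for B_l. The action of a fivefold
  product on B_l can then be read off from other elements, where it is easier to find.\<close>

lemma G2_recover:
  assumes ql: "qi l = P ^ 3"
  shows "fa_const (P * (P ^ 2 + r ^ 2 + 1)) * gy =
      fa_const (P + r) * bip vlist gx gy - gx * tp l gx + fa_const P * (tp l gx * gx)" (is ?A)
    "fa_const (P * (P ^ 2 + r ^ 2 + 1)) * gy =
      fa_const (P + r) * bip (flip vlist) gx gy - tm l gx * gx + fa_const P * (gx * tm l gx)" (is ?B)
proof -
  note c = Pr_rels
  have e: "gx * tp l gx = bip [(1,2,0), (- (P ^ 3),1,1)] gx gy" "tp l gx * gx = bip [(1,1,1), (- (P ^ 3),0,2)] gx gy"
    "tm l gx * gx = bip [(1,0,2), (- (P ^ 3),1,1)] gx gy" "gx * tm l gx = bip [(1,1,1), (- (P ^ 3),2,0)] gx gy"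
    unfolding tlx ql by (simp_all add: algebra_simps fa_const_pull power2_eq_square fa_const_uminus)
  have n: "u - bip f gx gy = u + bip (lscale (-1) f) gx gy" for u f
    by (simp add: bip_lscale fa_const_uminus)
  have "bip [(P * (P ^ 2 + r ^ 2 + 1),0,0)] gx gy = bip (lscale (P + r) vlist @ lscale (-1) [(1,2,0), (- (P ^ 3),1,1)] @ lscale P [(1,1,1), (- (P ^ 3),0,2)]) gx gy"
    unfolding vlist_def
    apply (rule bip_cong)
    apply (simp add: coef_def lscale_def)
    apply (intro conjI; (use c in Groebner_Basis.algebra))
    done
  then show ?A unfolding e n by (simp add: bip_append bip_lscale add.assoc)
  have "bip [(P * (P ^ 2 + r ^ 2 + 1),0,0)] gx gy = bip (lscale (P + r) (flip vlist) @ lscale (-1) [(1,0,2), (- (P ^ 3),1,1)] @ lscale P [(1,1,1), (- (P ^ 3),2,0)]) gx gy"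
    unfolding vlist_def
    apply (rule bip_cong)
    apply (simp add: coef_def lscale_def flip_def)
    apply (intro conjI; (use c in Groebner_Basis.algebra))
    done
  then show ?B unfolding e n by (simp add: bip_append bip_lscale add.assoc)
qed

text \<open>On B_s the three innermost factors amount to \<open>tp s (tp l gx)\<close>, which the
  two outer factors undo.\<close>

lemma G2_fix:
  assumes sl3: "a s l = -3"
  shows "tm l (tm s (tm l (tm s (tm l gx)))) \<approx> gx" "tm s (tm l (tm s (tm l (tm s gy)))) \<approx> gy"
proof -
  note g = G2_relations[OF sl3]
  let ?V = "bip vlist gx gy" and ?V' = "bip (flip vlist) gx gy"
  have 1: "tm l (tm s (tm l gx)) \<approx> tp s (tp l gx)"
  proof -
    have "tm l (tm s (tm l gx)) \<approx> tm l ?V" by (intro tm_eqv g)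
    also have "tm l ?V \<approx> ?V'" by (rule g)
    also have "?V' \<approx> tp s (tp l gx)" by (rule eqv_sym[OF g(2)])
    finally show ?thesis .
  qed
  have "tm l (tm s (tm l (tm s (tm l gx)))) \<approx> tm l (tm s (tp s (tp l gx)))" by (intro tm_eqv 1)
  also have "tm l (tm s (tp s (tp l gx))) \<approx> tm l (tp l gx)" by (intro tm_eqv tm_tp_eqv)
  also have "tm l (tp l gx) \<approx> gx" by (rule tm_tp_eqv)
  finally show D: "tm l (tm s (tm l (tm s (tm l gx)))) \<approx> gx" .
  define D' where "D' p = tm s (tm l (tm s (tm l (tm s p))))" for p
  have D'_hom: "D' (p + t) = D' p + D' t" "D' (p - t) = D' p - D' t" "D' (p * t) = D' p * D' t" "D' (fa_const c) = fa_const c" for p t c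
    by (simp_all add: D'_def tm_hom fa_hom_linear)
  have D'x: "D' gx \<approx> tp l gx"
  proof -
    have "D' gx \<approx> tp l (tm l (D' gx))" by (rule eqv_sym[OF tp_tm_eqv])
    also have "tm l (D' gx) = tm l (tm s (tm l (tm s (tm l gx))))" by (simp add: D'_def tm_self)
    finally show ?thesis using eqv_trans[OF _ tp_eqv[OF D]] by simp
  qed
  have D'w: "D' (tm l gx) \<approx> gx"
    using tm_eqv[OF D, of s] by (simp add: D'_def tm_self)
  have "?V' \<approx> tp s (tp l gx)" by (rule eqv_sym[OF g(2)])
  then have "D' ?V' \<approx> D' (tp s (tp l gx))" unfolding D'_def by (intro tm_eqv)
  also have "\<dots> \<approx> tm s (tm l (tm s (tm l (tp l gx))))" unfolding D'_def by (intro tm_eqv tm_tp_eqv)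
  also have "\<dots> \<approx> tm s (tm l (tm s gx))" by (intro tm_eqv tm_tp_eqv)
  also have "\<dots> = tm s (tm l gx)" by (simp add: tm_self)
  also have "\<dots> \<approx> ?V" by (rule g)
  finally have D'V: "D' ?V' \<approx> ?V" .
  let ?c = "P * (P ^ 2 + r ^ 2 + 1)"
  have "fa_const ?c * D' gy = D' (fa_const ?c * gy)" by (simp add: D'_hom)
  \<comment> \<open>Applying \<open>D'\<close> to the second expression for B_l in
    \<open>G2_recover\<close> gives, term by term, the first one.\<close>
  also have "\<dots> = fa_const (P + r) * D' ?V' - D' (tm l gx) * D' gx + fa_const P * (D' gx * D' (tm l gx))"
    unfolding G2_recover(2)[OF g(4)] D'_hom ..
  also have "\<dots> \<approx> fa_const (P + r) * ?V - gx * tp l gx + fa_const P * (tp l gx * gx)"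
    by (intro eqv_add eqv_diff eqv_mult eqv_refl D'V D'x D'w)
  also have "\<dots> = fa_const ?c * gy" by (rule G2_recover(1)[OF g(4), symmetric])
  finally have "fa_const (w3 * r) * (fa_const ?c * D' gy) \<approx> fa_const (w3 * r) * (fa_const ?c * gy)"
    by (rule eqv_mult[OF eqv_refl])
  moreover have "w3 * r * ?c = 1" using Pr_rels by Groebner_Basis.algebra
  ultimately show "tm s (tm l (tm s (tm l (tm s gy)))) \<approx> gy"
    by (simp only: fa_const_pull(4) fa_const_1 mult_1_left D'_def)
qed

end

lemma key_4:
  assumes ij: "i \<noteq> j" and m: "a i j * a j i = 2" shows "tm j (tm i (tm j (fa_gen i))) \<approx> fa_gen i"
proof -
  consider "a i j = -2" "a j i = -1" | "a i j = -1" "a j i = -2"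
    using a_pairs[OF ij] m by auto
  then show ?thesis
  proof cases
    case 1
    from tm_eqv[OF B2_relations(1)[OF ij HOL.refl 1(2) HOL.refl HOL.refl HOL.refl 1(1)], of j]
    show ?thesis by (rule eqv_trans) (rule tm_tp_eqv)
  next
    case 2
    from tm_eqv[OF B2_relations(2)[OF not_sym[OF ij] HOL.refl 2(1) HOL.refl HOL.refl HOL.refl 2(2)], of j]
    show ?thesis by (rule eqv_trans) (rule tm_tp_eqv)
  qed
qed

lemma key_6:
  assumes ij: "i \<noteq> j" and m: "a i j * a j i = 3" shows "tm j (tm i (tm j (tm i (tm j (fa_gen i))))) \<approx> fa_gen i"
proof -
  consider "a i j = -3" "a j i = -1" | "a i j = -1" "a j i = -3"
    using a_pairs[OF ij] m by auto
  then show ?thesis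
  proof cases
    case 1
    show ?thesis by (rule G2_fix(1)[OF ij HOL.refl 1(2) HOL.refl HOL.refl HOL.refl 1(1)])
  next
    case 2
    show ?thesis by (rule G2_fix(2)[OF not_sym[OF ij] HOL.refl 2(1) HOL.refl HOL.refl HOL.refl 2(2)])
  qed
qed

section \<open>Alternating products and the braid relation on all generators\<close>

fun talt :: "nat \<Rightarrow> 'i \<Rightarrow> 'i \<Rightarrow> ('i, 'k) free_algebra \<Rightarrow> ('i, 'k) free_algebra" where
  "talt 0 i j p = p"
| "talt (Suc n) i j p = tm i (talt n j i p)"

lemma talt_eqv: "p \<approx> r \<Longrightarrow> talt n i j p \<approx> talt n i j r"
  by (induction n arbitrary: i j) (auto intro: tm_eqv)

lemma talt_hom: "talt n i j (p * r) = talt n i j p * talt n i j r" "talt n i j (p + r) = talt n i j p + talt n i j r"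
  "talt n i j (p - r) = talt n i j p - talt n i j r" "talt n i j (fa_const c) = fa_const c"
  by (induction n arbitrary: i j) (auto simp: tm_hom fa_hom_linear)

lemma talt_last: "talt (Suc n) i j p = talt n i j (tm (if even n then i else j) p)"
  by (induction n arbitrary: i j) auto

text \<open>The parity selects the generator fixed by the innermost factor of the alternating
  product of length \<open>m i j\<close> that starts with j; this factor is the one left
  out.\<close>

lemma talt_key:
  assumes ij: "i \<noteq> j"
  shows "talt (m i j - 1) j i (fa_gen (if even (m i j) then i else j)) \<approx> fa_gen i"
proof -
  consider "a i j * a j i = 0" "m i j - 1 = Suc 0" "even (m i j)"
    | "a i j * a j i = 1" "m i j - 1 = Suc (Suc 0)" "odd (m i j)"
    | "a i j * a j i = 2" "m i j - 1 = Suc (Suc (Suc 0))" "even (m i j)"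
    | "a i j * a j i = 3" "m i j - 1 = Suc (Suc (Suc (Suc (Suc 0))))" "even (m i j)"
    using a_pairs[OF ij] m[OF ij] by auto
  then show ?thesis
    by cases (use key_2[OF ij] key_3[OF ij] key_4[OF ij] key_6[OF ij] in simp_all)
qed

lemma m_pos: "i \<noteq> j \<Longrightarrow> m i j > 0"
  by (simp add: m)

text \<open>If \<open>F = \<tau>\<^sub>j \<tau>\<^sub>i \<cdots>\<close> with \<open>m i j - 1\<close> factors maps \<open>B\<^sub>e\<close> to \<open>B\<^sub>i\<close> and \<open>u\<close> commutes with \<open>B\<^sub>e\<close>, then \<open>F u\<close>
  commutes with \<open>B\<^sub>i\<close>, so both sides of the braid relation map \<open>u\<close> to \<open>F u\<close>.\<close>

lemma braid_commuting:
  assumes ij: "i \<noteq> j" and e: "e = (if even (m i j) then i else j)" and u: "fa_gen e * u \<approx> u * fa_gen e"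
  shows "talt (m i j) i j u \<approx> talt (m i j) j i u"
proof -
  obtain n where n: "m i j = Suc n" using m_pos[OF ij] by (cases "m i j") auto
  let ?F = "talt n j i"
  have k: "?F (fa_gen e) \<approx> fa_gen i"
    using talt_key[OF ij] by (simp add: n e)
  have "fa_gen i * ?F u \<approx> ?F (fa_gen e) * ?F u" by (intro eqv_mult eqv_refl eqv_sym[OF k])
  also have "\<dots> = ?F (fa_gen e * u)" by (simp add: talt_hom)
  also have "\<dots> \<approx> ?F (u * fa_gen e)" by (intro talt_eqv u)
  also have "\<dots> = ?F u * ?F (fa_gen e)" by (simp add: talt_hom)
  also have "\<dots> \<approx> ?F u * fa_gen i" by (intro eqv_mult eqv_refl k)
  finally have "tm i (?F u) \<approx> ?F u" unfolding eqv_def by (rule tm_fix)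
  moreover have "talt (m i j) j i u \<approx> ?F u"
  proof -
    have "tm e u \<approx> u" using u unfolding eqv_def by (rule tm_fix)
    moreover have "talt (m i j) j i u = ?F (tm e u)"
      using talt_last[of n j i u] by (auto simp: n e)
    ultimately show ?thesis by (simp add: talt_eqv)
  qed
  ultimately show ?thesis by (simp add: n) (blast intro: eqv_trans eqv_sym)
qed

lemma m_sym: "i \<noteq> j \<Longrightarrow> m i j = m j i"
  by (simp add: m mult.commute)

lemma gen_commute:
  assumes "a i j = 0" "i \<noteq> j" shows "fa_gen i * fa_gen j \<approx> fa_gen j * fa_gen i"
  using drel_ker[OF assms(2)] assms(1) by (simp add: eqv_def drel_def dlist_def fa_const_uminus)

lemma a_zero_sym: "a i j = 0 \<Longrightarrow> a j i = 0"
  using a_sym[of i j] d_pos[of j] by auto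

text \<open>If x and x' commute, so do left and right multiplications by them. This settles the case
  of orthogonal i and j with a generator adjacent to both.\<close>

lemma bip_commute:
  assumes "x * x' \<approx> x' * x"
  shows "bip f x (bip g x' y) \<approx> bip g x' (bip f x y)"
proof -
  have pw: "x ^ k * x' ^ l \<approx> x' ^ l * x ^ k" for k l
  proof -
    have 1: "x * x' ^ l \<approx> x' ^ l * x" for l
    proof (induction l)
      case (Suc l)
      have "x * x' ^ Suc l \<approx> x' * x * x' ^ l" using eqv_mult[OF assms eqv_refl[of "x' ^ l"]] by (simp add: mult.assoc)
      also have "\<dots> \<approx> x' * (x' ^ l * x)" using eqv_mult[OF eqv_refl[of x'] Suc] by (simp add: mult.assoc)
      finally show ?case by (simp add: mult.assoc)
    qed simp
    show ?thesis
    proof (induction k)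
      case (Suc k)
      have "x ^ Suc k * x' ^ l \<approx> x * (x' ^ l * x ^ k)" using eqv_mult[OF eqv_refl[of x] Suc] by (simp add: mult.assoc)
      also have "\<dots> \<approx> x' ^ l * x * x ^ k" using eqv_mult[OF 1 eqv_refl[of "x ^ k"], of l] by (simp add: mult.assoc)
      finally show ?case by (simp add: mult.assoc)
    qed simp
  qed
  have zero: "bip f x (0::('i, 'k) free_algebra) = 0" for f x by (induction f) auto
  have single: "fa_const c * x ^ k * bip g x' y * x ^ l \<approx> bip g x' (fa_const c * x ^ k * y * x ^ l)" for c k l
  proof (induction g)
    case (Cons t g)
    obtain b k' l' where t: "t = (b, k', l')" by (cases t)
    have "fa_const c * x ^ k * bip (t # g) x' y * x ^ l =
       fa_const (c * b) * ((x ^ k * x' ^ k') * y * (x' ^ l' * x ^ l)) + fa_const c * x ^ k * bip g x' y * x ^ l"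
      by (simp add: t algebra_simps fa_const_pull)
    also have "\<dots> \<approx> fa_const (c * b) * ((x' ^ k' * x ^ k) * y * (x ^ l * x' ^ l')) + bip g x' (fa_const c * x ^ k * y * x ^ l)"
      by (intro eqv_add eqv_mult eqv_refl Cons pw eqv_sym[OF pw])
    also have "\<dots> = bip (t # g) x' (fa_const c * x ^ k * y * x ^ l)"
      by (simp add: t algebra_simps fa_const_pull)
    finally show ?case .
  qed simp
  show ?thesis
  proof (induction f)
    case (Cons t f)
    obtain b k l where t: "t = (b, k, l)" by (cases t)
    show ?case using eqv_add[OF single[of b k l] Cons] by (simp add: t bip_add)
  qed (simp add: zero)
qed

lemma braid_gen:
  assumes ij: "i \<noteq> j"
  shows "talt (m i j) i j (fa_gen k) \<approx> talt (m i j) j i (fa_gen k)"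
proof -
  have main: "talt (m i j) i j (fa_gen k) \<approx> talt (m i j) j i (fa_gen k)"
    if "i \<noteq> j" "fa_gen (if even (m i j) then i else j) * fa_gen k \<approx> fa_gen k * fa_gen (if even (m i j) then i else j)" for i j
    by (rule braid_commuting[OF that(1) HOL.refl that(2)])
  have com: "fa_gen i * fa_gen k \<approx> fa_gen k * fa_gen i" if "i = k \<or> a i k = 0" for i
    using that gen_commute[of i k] by (cases "i = k") auto
  have one: "talt (m i j) i j (fa_gen k) \<approx> talt (m i j) j i (fa_gen k)"
    if "i = k \<or> a i k = 0" "i \<noteq> j" for i j
  proof (cases "even (m i j)")
    case True
    then show ?thesis using main[OF that(2)] com[OF that(1)] by simp
  next
    \<comment> \<open>For odd length \<open>main\<close> asks for an element commuting with the
      second generator, so it is applied to the exchanged pair.\<close>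
    case False
    then have "talt (m j i) j i (fa_gen k) \<approx> talt (m j i) i j (fa_gen k)"
      using main[OF not_sym[OF that(2)]] com[OF that(1)] m_sym[OF that(2)] by simp
    then show ?thesis using m_sym[OF that(2)] eqv_sym by simp
  qed
  consider "i = k \<or> a i k = 0" | "j = k \<or> a j k = 0" | "i \<noteq> k" "a i k \<noteq> 0" "j \<noteq> k" "a j k \<noteq> 0" by blast
  then show ?thesis
  proof cases
    case 1
    then show ?thesis using one ij by blast
  next
    case 2
    then show ?thesis using one[of j i] ij m_sym[OF ij] eqv_sym by simp
  next
    case 3
    then have a0: "a i j = 0" using no_triangle[OF ij 3(3,1)] by blast
    then have a0': "a j i = 0" by (rule a_zero_sym)
    have m2: "m i j = Suc (Suc 0)" using m[OF ij] a0 by simp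
    have z: "tm i (fa_gen j) = fa_gen j" "tm j (fa_gen i) = fa_gen i" using a0 a0' by (simp_all add: tm_zero)
    have e: "tm i (tm j (fa_gen k)) = bip (phim j k) (fa_gen j) (bip (phim i k) (fa_gen i) (fa_gen k))"
      "tm j (tm i (fa_gen k)) = bip (phim i k) (fa_gen i) (bip (phim j k) (fa_gen j) (fa_gen k))"
      by (simp_all add: tm_gen[of _ k] tm_bip z)
    have "tm i (tm j (fa_gen k)) \<approx> tm j (tm i (fa_gen k))"
      unfolding e by (rule bip_commute[OF gen_commute[OF a0' not_sym[OF ij]]])
    then show ?thesis by (simp add: m2)
  qed
qed

lemma braid_relation:
  assumes ij: "i \<noteq> j" shows "talt (m i j) i j p \<approx> talt (m i j) j i p"
proof (induction p rule: fa_left_induct)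
  case (gen x p)
  show ?case unfolding talt_hom by (intro eqv_mult braid_gen ij gen)
qed (simp_all add: talt_hom eqv_add)

end

section \<open>Root data\<close>

locale simple_system =
  fixes \<Phi> :: "'v::euclidean_space set" and \<alpha> :: "'i::finite \<Rightarrow> 'v"
  assumes irr: "irreducible_root_system \<Phi>" and simple: "simple_roots \<Phi> \<alpha>"
    and norm: "\<And>\<beta>. short_root \<Phi> \<beta> \<Longrightarrow> \<beta> \<bullet> \<beta> = 2"
begin

lemma rs: "root_system \<Phi>" and nonempty: "\<Phi> \<noteq> {}"
  using irr by (auto simp: irreducible_root_system_def)

lemma root_nz: "\<beta> \<in> \<Phi> \<Longrightarrow> \<beta> \<noteq> 0" "\<beta> \<in> \<Phi> \<Longrightarrow> \<beta> \<bullet> \<beta> > 0"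
  using rs by (auto simp: root_system_def)

lemma root_refl: "\<beta> \<in> \<Phi> \<Longrightarrow> \<gamma> \<in> \<Phi> \<Longrightarrow> reflection \<beta> \<gamma> \<in> \<Phi>"
  using rs by (auto simp: root_system_def)

lemma root_int: "\<beta> \<in> \<Phi> \<Longrightarrow> \<gamma> \<in> \<Phi> \<Longrightarrow> 2 * (\<beta> \<bullet> \<gamma>) / (\<beta> \<bullet> \<beta>) \<in> \<int>"
  using rs by (auto simp: root_system_def)

lemma alpha_root: "\<alpha> i \<in> \<Phi>"
  using simple by (auto simp: simple_roots_def)

lemma lin_indep:
  assumes "(\<Sum>k\<in>UNIV. w k *\<^sub>R \<alpha> k) = 0" shows "w k = 0"
proof -
  have inj: "inj \<alpha>" and ind: "independent (range \<alpha>)" using simple by (auto simp: simple_roots_def)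
  have "(\<Sum>v\<in>range \<alpha>. w (inv_into UNIV \<alpha> v) *\<^sub>R v) = 0"
    using assms inj by (subst sum.reindex) auto
  from independentD[OF ind _ _ this, of "\<alpha> k"] inj show ?thesis by simp
qed

lemma lin_indep2:
  assumes "i \<noteq> j" "x *\<^sub>R \<alpha> i + y *\<^sub>R \<alpha> j = 0" shows "x = 0 \<and> y = 0"
proof -
  let ?w = "\<lambda>k. (if k = i then x else 0) + (if k = j then y else 0)"
  have "(\<Sum>k\<in>UNIV. ?w k *\<^sub>R \<alpha> k) = x *\<^sub>R \<alpha> i + y *\<^sub>R \<alpha> j"
    by (simp add: scaleR_add_left sum.distrib if_distrib[of "\<lambda>c. c *\<^sub>R _"] cong: if_cong)
  then have "?w k = 0" for k using lin_indep[of ?w] assms(2) by simp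
  from this[of i] this[of j] assms(1) show ?thesis by auto
qed

lemma lin_indep3:
  assumes "i \<noteq> j" "i \<noteq> k" "j \<noteq> k" "x *\<^sub>R \<alpha> i + y *\<^sub>R \<alpha> j + z *\<^sub>R \<alpha> k = 0" shows "x = 0"
proof -
  let ?w = "\<lambda>l. (if l = i then x else 0) + (if l = j then y else 0) + (if l = k then z else 0)"
  have "(\<Sum>l\<in>UNIV. ?w l *\<^sub>R \<alpha> l) = x *\<^sub>R \<alpha> i + y *\<^sub>R \<alpha> j + z *\<^sub>R \<alpha> k"
    by (simp add: scaleR_add_left sum.distrib if_distrib[of "\<lambda>c. c *\<^sub>R _"] cong: if_cong)
  then have "?w l = 0" for l using lin_indep[of ?w] assms(4) by simp
  from this[of i] show ?thesis using assms by simp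
qed

abbreviation "ca \<equiv> cartan \<alpha>"

lemma cartan_real: "real_of_int (ca i j) = 2 * (\<alpha> i \<bullet> \<alpha> j) / (\<alpha> i \<bullet> \<alpha> i)"
  using root_int[OF alpha_root alpha_root, of i j] by (auto simp: cartan_def elim!: Ints_cases)

lemma inner_cartan: "\<alpha> i \<bullet> \<alpha> j = real_of_int (ca i j) * (\<alpha> i \<bullet> \<alpha> i) / 2"
  using root_nz[OF alpha_root, of i] by (simp add: cartan_real)

lemma cartan_diag: "ca i i = 2"
  using root_nz[OF alpha_root, of i] by (simp add: cartan_def)

text \<open>The coefficients of the root \<open>reflection (\<alpha> i) (\<alpha> j)\<close> all
  have the same sign; that of \<open>\<alpha> j\<close> is 1 and that of \<open>\<alpha> i\<close>
  is \<open>- ca i j\<close>.\<close>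

lemma cartan_nonpos:
  assumes "i \<noteq> j" shows "ca i j \<le> 0"
proof -
  have "reflection (\<alpha> i) (\<alpha> j) = \<alpha> j - real_of_int (ca i j) *\<^sub>R \<alpha> i"
    by (simp add: reflection_def cartan_real)
  moreover have "reflection (\<alpha> i) (\<alpha> j) \<in> \<Phi>" by (intro root_refl alpha_root)
  ultimately obtain c :: "'i \<Rightarrow> int" where c: "\<alpha> j - real_of_int (ca i j) *\<^sub>R \<alpha> i = (\<Sum>k\<in>UNIV. of_int (c k) *\<^sub>R \<alpha> k)"
      "(\<forall>k. 0 \<le> c k) \<or> (\<forall>k. c k \<le> 0)"
    using simple unfolding simple_roots_def by metis
  let ?w = "\<lambda>k. real_of_int (c k) - (if k = j then 1 else 0) + (if k = i then real_of_int (ca i j) else 0)"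
  have "(\<Sum>k\<in>UNIV. ?w k *\<^sub>R \<alpha> k) = (\<Sum>k\<in>UNIV. of_int (c k) *\<^sub>R \<alpha> k) - \<alpha> j + real_of_int (ca i j) *\<^sub>R \<alpha> i"
    by (simp add: scaleR_add_left scaleR_diff_left sum.distrib sum_subtractf if_distrib[of "\<lambda>c. c *\<^sub>R _"] cong: if_cong)
  then have z: "?w k = 0" for k using lin_indep[of ?w] c(1) by (simp add: algebra_simps)
  have "c j = 1" "c i = - ca i j" using z[of j] z[of i] assms by auto
  then show ?thesis using c(2) by (metis neg_0_le_iff_le not_one_le_zero)
qed

lemma cartan_zero: "ca i j = 0 \<longleftrightarrow> ca j i = 0"
  using inner_cartan[of i j] inner_cartan[of j i] root_nz[OF alpha_root] by (auto simp: inner_commute)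

lemma cauchy_strict:
  fixes u v :: 'v
  assumes "\<And>t. u \<noteq> t *\<^sub>R v" "v \<noteq> 0" shows "(u \<bullet> v)\<^sup>2 < (u \<bullet> u) * (v \<bullet> v)"
proof -
  have v: "v \<bullet> v > 0" using assms(2) by simp
  define t where "t = (u \<bullet> v) / (v \<bullet> v)"
  have "0 < (u - t *\<^sub>R v) \<bullet> (u - t *\<^sub>R v)" using assms(1)[of t] by simp
  also have "\<dots> = u \<bullet> u - 2 * t * (u \<bullet> v) + t * t * (v \<bullet> v)"
    by (simp add: inner_diff_left inner_diff_right inner_commute algebra_simps)
  also have "\<dots> = u \<bullet> u - (u \<bullet> v)\<^sup>2 / (v \<bullet> v)"
    using v by (simp add: t_def power2_eq_square field_simps)
  finally show ?thesis using v by (simp add: field_simps)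
qed

lemma cartan_prod_real:
  "real_of_int (ca i j * ca j i) * ((\<alpha> i \<bullet> \<alpha> i) * (\<alpha> j \<bullet> \<alpha> j)) = 4 * (\<alpha> i \<bullet> \<alpha> j)\<^sup>2"
proof -
  have "2 * u / b * (2 * u / c) * (b * c) = 4 * u\<^sup>2" if "b > 0" "c > 0" for u b c :: real
    using that by (simp add: power2_eq_square)
  from this[OF root_nz(2)[OF alpha_root] root_nz(2)[OF alpha_root]] show ?thesis
    by (simp only: of_int_mult cartan_real inner_commute[of "\<alpha> j" "\<alpha> i"])
qed

text \<open>By the strict Cauchy-Schwarz inequality the product of the two entries is less than 4;
  both are nonpositive and vanish together.\<close>

lemma cartan_pairs:
  assumes "i \<noteq> j"
  shows "(ca i j, ca j i) \<in> {(0,0), (-1,-1), (-1,-2), (-2,-1), (-1,-3), (-3,-1)}"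
proof -
  let ?A = "ca i j" and ?B = "ca j i"
  have "\<alpha> i \<noteq> t *\<^sub>R \<alpha> j" for t using lin_indep2[OF assms, of 1 "- t"] by auto
  then have "(\<alpha> i \<bullet> \<alpha> j)\<^sup>2 < (\<alpha> i \<bullet> \<alpha> i) * (\<alpha> j \<bullet> \<alpha> j)" by (intro cauchy_strict root_nz alpha_root)
  then have "real_of_int (?A * ?B) * ((\<alpha> i \<bullet> \<alpha> i) * (\<alpha> j \<bullet> \<alpha> j)) < 4 * ((\<alpha> i \<bullet> \<alpha> i) * (\<alpha> j \<bullet> \<alpha> j))"
    unfolding cartan_prod_real by simp
  moreover have "0 < (\<alpha> i \<bullet> \<alpha> i) * (\<alpha> j \<bullet> \<alpha> j)" by (intro mult_pos_pos root_nz alpha_root)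
  ultimately have "real_of_int (?A * ?B) < 4" by (metis mult_less_cancel_right_pos)
  then have AB: "?A * ?B < 4" by linarith
  have le: "?A \<le> 0" "?B \<le> 0" using cartan_nonpos assms by auto
  show ?thesis
  proof (cases "?A = 0")
    case True
    then show ?thesis using cartan_zero[of i j] by simp
  next
    case False
    then have n: "?A \<le> -1" "?B \<le> -1" using le cartan_zero[of i j] by auto
    have "- ?A \<le> ?A * ?B" "- ?B \<le> ?A * ?B"
      using mult_left_mono_neg[of ?B "-1" ?A] mult_right_mono_neg[of ?A "-1" ?B] n by auto
    then have "?A \<in> {-1,-2,-3}" "?B \<in> {-1,-2,-3}" using n AB by auto
    then show ?thesis using AB by auto
  qed
qed

text \<open>For nonproportional roots the Cartan integers A and B satisfy 0 < A B < 4, and the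
  squared lengths have the ratio B / A.\<close>

lemma ratio:
  assumes b: "\<beta> \<in> \<Phi>" and g: "\<gamma> \<in> \<Phi>" and n: "\<beta> \<bullet> \<gamma> \<noteq> 0"
  shows "\<exists>t\<in>{1, 2, 3, 1/2, 1/3}. \<beta> \<bullet> \<beta> = t * (\<gamma> \<bullet> \<gamma>)"
proof (cases "\<exists>t. \<beta> = t *\<^sub>R \<gamma>")
  case True
  then obtain t where t: "\<beta> = t *\<^sub>R \<gamma>" by blast
  then have "t = 1 \<or> t = -1" using rs b g unfolding root_system_def by blast
  then show ?thesis using t by auto
next
  case False
  have pos: "\<beta> \<bullet> \<beta> > 0" "\<gamma> \<bullet> \<gamma> > 0" using root_nz b g by auto
  obtain A where A: "2 * (\<beta> \<bullet> \<gamma>) / (\<beta> \<bullet> \<beta>) = real_of_int A" using root_int[OF b g] by (auto elim: Ints_cases)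
  obtain B where B: "2 * (\<gamma> \<bullet> \<beta>) / (\<gamma> \<bullet> \<gamma>) = real_of_int B" using root_int[OF g b] by (auto elim: Ints_cases)
  have A': "2 * (\<beta> \<bullet> \<gamma>) = A * (\<beta> \<bullet> \<beta>)" and B': "2 * (\<beta> \<bullet> \<gamma>) = B * (\<gamma> \<bullet> \<gamma>)"
    using A B pos by (auto simp: field_simps inner_commute)
  have "(\<beta> \<bullet> \<gamma>)\<^sup>2 < (\<beta> \<bullet> \<beta>) * (\<gamma> \<bullet> \<gamma>)" using False root_nz(1)[OF g] by (intro cauchy_strict) auto
  then have "(2 * (\<beta> \<bullet> \<gamma>)) * (2 * (\<beta> \<bullet> \<gamma>)) < 4 * ((\<beta> \<bullet> \<beta>) * (\<gamma> \<bullet> \<gamma>))" by (simp add: power2_eq_square)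
  also have "(2 * (\<beta> \<bullet> \<gamma>)) * (2 * (\<beta> \<bullet> \<gamma>)) = real_of_int (A * B) * ((\<beta> \<bullet> \<beta>) * (\<gamma> \<bullet> \<gamma>))"
    by (subst A', subst B') simp
  finally have "real_of_int (A * B) < 4" using pos by (metis mult_less_cancel_right_pos mult_pos_pos)
  then have AB: "A * B < 4" by linarith
  have AB0: "A * (\<beta> \<bullet> \<beta>) = B * (\<gamma> \<bullet> \<gamma>)" using A' B' by simp
  have nz: "A \<noteq> 0" "B \<noteq> 0" using A' B' n by auto
  have "0 < (real_of_int A * (\<beta> \<bullet> \<beta>)) * (real_of_int B * (\<gamma> \<bullet> \<gamma>))"
    using A' B' n by (metis mult_pos_pos not_real_square_gt_zero zero_less_numeral mult_eq_0_iff zero_neq_numeral)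
  then have "0 < real_of_int (A * B) * ((\<beta> \<bullet> \<beta>) * (\<gamma> \<bullet> \<gamma>))" by (simp add: mult_ac)
  then have "0 < real_of_int (A * B)" using mult_pos_pos[OF pos] zero_less_mult_pos2 by blast
  then have pAB: "0 < A * B" by (simp only: of_int_0_less_iff)
  have main: "\<exists>t\<in>{1, 2, 3, 1/2, 1/3}. \<beta> \<bullet> \<beta> = t * (\<gamma> \<bullet> \<gamma>)"
    if "C > 0" "D > 0" "C * D < 4" "real_of_int C * (\<beta> \<bullet> \<beta>) = real_of_int D * (\<gamma> \<bullet> \<gamma>)" for C D :: int
  proof -
    have "C \<le> C * D" "D \<le> C * D" using that by (auto simp: mult_le_cancel_left1 mult_le_cancel_right1)
    then have "C < 4" "D < 4" using that(3) by linarith+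
    then have "C = 1 \<or> C = 2 \<or> C = 3" "D = 1 \<or> D = 2 \<or> D = 3" using that(1,2) by presburger+
    then show ?thesis using that(3,4) by auto
  qed
  show ?thesis
  proof (cases "A > 0")
    case True
    then show ?thesis using main[of A B] pAB AB AB0 by (simp add: zero_less_mult_iff)
  next
    case False
    then have "- A > 0" "- B > 0" using pAB nz by (auto simp: zero_less_mult_iff)
    then show ?thesis using main[of "- A" "- B"] AB AB0 by simp
  qed
qed

lemma reflection_norm: "\<beta> \<noteq> 0 \<Longrightarrow> reflection \<beta> v \<bullet> reflection \<beta> v = v \<bullet> v"
  by (simp add: reflection_def inner_diff_left inner_diff_right inner_commute field_simps)

text \<open>Let A consist of the roots that are not orthogonal to every root of the given length.
  Reflecting such a root of that length in an element of A keeps its length, so A is orthogonal to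
  its complement, and irreducibility makes the complement empty.\<close>

lemma length_class:
  assumes b: "\<beta> \<in> \<Phi>" and g: "\<gamma> \<in> \<Phi>"
  shows "\<exists>\<delta>\<in>\<Phi>. \<delta> \<bullet> \<delta> = \<beta> \<bullet> \<beta> \<and> \<delta> \<bullet> \<gamma> \<noteq> 0"
proof (rule ccontr)
  assume no: "\<not> ?thesis"
  define D where "D = {\<delta>\<in>\<Phi>. \<delta> \<bullet> \<delta> = \<beta> \<bullet> \<beta>}"
  define A where "A = {\<epsilon>\<in>\<Phi>. \<exists>\<delta>\<in>D. \<delta> \<bullet> \<epsilon> \<noteq> 0}"
  have "\<beta> \<in> A" using b root_nz(2)[OF b] by (auto simp: A_def D_def)
  then have "A \<noteq> {}" by blast
  moreover have "\<Phi> - A \<noteq> {}" using g no by (auto simp: A_def D_def)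
  moreover have "\<forall>\<epsilon>\<in>A. \<forall>\<zeta>\<in>\<Phi> - A. \<epsilon> \<bullet> \<zeta> = 0"
  proof (intro ballI)
    fix \<epsilon> \<zeta> assume e: "\<epsilon> \<in> A" "\<zeta> \<in> \<Phi> - A"
    obtain \<delta> where d: "\<delta> \<in> D" "\<delta> \<bullet> \<epsilon> \<noteq> 0" "\<epsilon> \<in> \<Phi>" using e(1) unfolding A_def by blast
    have "reflection \<epsilon> \<delta> \<in> D"
      using d root_refl[of \<epsilon> \<delta>] reflection_norm[OF root_nz(1)[OF d(3)], of \<delta>] by (simp add: D_def)
    then have "reflection \<epsilon> \<delta> \<bullet> \<zeta> = 0" "\<delta> \<bullet> \<zeta> = 0" using e(2) d(1) by (auto simp: A_def)
    then have "2 * (\<epsilon> \<bullet> \<delta>) / (\<epsilon> \<bullet> \<epsilon>) * (\<epsilon> \<bullet> \<zeta>) = 0" by (simp add: reflection_def inner_diff_left)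
    then show "\<epsilon> \<bullet> \<zeta> = 0" using d(2) root_nz(2)[OF d(3)] by (auto simp: inner_commute)
  qed
  moreover have "A \<union> (\<Phi> - A) = \<Phi>" by (auto simp: A_def)
  ultimately have "A \<noteq> {} \<and> \<Phi> - A \<noteq> {} \<and> A \<union> (\<Phi> - A) = \<Phi> \<and> (\<forall>\<epsilon>\<in>A. \<forall>\<zeta>\<in>\<Phi> - A. \<epsilon> \<bullet> \<zeta> = 0)"
    by simp
  then have "\<exists>A B. A \<noteq> {} \<and> B \<noteq> {} \<and> A \<union> B = \<Phi> \<and> (\<forall>\<epsilon>\<in>A. \<forall>\<zeta>\<in>B. \<epsilon> \<bullet> \<zeta> = 0)" by (intro exI)
  then show False using irr unfolding irreducible_root_system_def by simp
qed

text \<open>By \<open>length_class\<close> some root as long as \<open>\<alpha> i\<close> is not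
  orthogonal to a shortest root; \<open>ratio\<close> then leaves only the factors 1, 2 and
  3.\<close>

lemma alpha_length: "\<alpha> i \<bullet> \<alpha> i \<in> {2, 4, 6}"
proof -
  obtain \<beta> where b: "\<beta> \<in> \<Phi>" "\<And>\<gamma>. \<gamma> \<in> \<Phi> \<Longrightarrow> \<beta> \<bullet> \<beta> \<le> \<gamma> \<bullet> \<gamma>"
  proof -
    have fin: "finite ((\<lambda>\<gamma>. \<gamma> \<bullet> \<gamma>) ` \<Phi>)" "(\<lambda>\<gamma>. \<gamma> \<bullet> \<gamma>) ` \<Phi> \<noteq> {}"
      using rs nonempty by (auto simp: root_system_def)
    from Min_in[OF fin] obtain \<beta> where "\<beta> \<in> \<Phi>" "\<beta> \<bullet> \<beta> = Min ((\<lambda>\<gamma>. \<gamma> \<bullet> \<gamma>) ` \<Phi>)" by auto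
    then show thesis using that Min_le[OF fin(1)] by auto
  qed
  then have "short_root \<Phi> \<beta>" by (auto simp: short_root_def)
  then have 2: "\<beta> \<bullet> \<beta> = 2" by (rule norm)
  obtain \<delta> where d: "\<delta> \<in> \<Phi>" "\<delta> \<bullet> \<delta> = \<alpha> i \<bullet> \<alpha> i" "\<delta> \<bullet> \<beta> \<noteq> 0"
    using length_class[OF alpha_root b(1)] by blast
  obtain t where t: "t \<in> {1, 2, 3, 1/2, 1/3}" "\<alpha> i \<bullet> \<alpha> i = t * 2"
    using ratio[OF d(1) b(1) d(3)] unfolding d(2) 2 by blast
  moreover have "2 \<le> \<alpha> i \<bullet> \<alpha> i" using b(2)[OF alpha_root[of i]] 2 by simp
  ultimately show ?thesis by auto
qed

definition dd :: "'i \<Rightarrow> int" where "dd i = \<lfloor>(\<alpha> i \<bullet> \<alpha> i) / 2\<rfloor>"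

lemma dd_real: "real_of_int (dd i) = (\<alpha> i \<bullet> \<alpha> i) / 2" and dd_cases: "dd i \<in> {1, 2, 3}"
  using alpha_length[of i] by (auto simp: dd_def)

lemma dd_sym: "dd i * ca i j = dd j * ca j i"
proof -
  have "real_of_int (dd i * ca i j) = real_of_int (dd j * ca j i)"
    using inner_cartan[of i j] inner_cartan[of j i] by (simp add: dd_real inner_commute mult.commute)
  then show ?thesis by linarith
qed

lemma pairing_dd: "pairing \<alpha> i j = dd i * ca i j"
proof -
  have "\<alpha> i \<bullet> \<alpha> j = real_of_int (dd i * ca i j)" using inner_cartan[of i j] by (simp add: dd_real)
  then show ?thesis unfolding pairing_def by (metis floor_of_int)
qed

text \<open>Three unit vectors along pairwise nonorthogonal simple roots have inner products at most
  -1/2, so their sum would be zero, against linear independence.\<close>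

lemma no_triangle:
  assumes "i \<noteq> j" "j \<noteq> k" "i \<noteq> k"
  shows "ca i j = 0 \<or> ca j k = 0 \<or> ca i k = 0"
proof (rule ccontr)
  assume no: "\<not> ?thesis"
  have square3: "(u + v + w) \<bullet> (u + v + w) = u \<bullet> u + v \<bullet> v + w \<bullet> w + 2 * (u \<bullet> v) + 2 * (v \<bullet> w) + 2 * (u \<bullet> w)"
    for u v w :: 'v
    by (simp add: inner_add_left inner_add_right inner_commute)
  let ?n = "\<lambda>i. (1 / norm (\<alpha> i)) *\<^sub>R \<alpha> i"
  have n0: "norm (\<alpha> i) > 0" for i using root_nz(1)[OF alpha_root] by simp
  have nn: "?n i \<bullet> ?n i = 1" for i using n0[of i] by (simp add: norm_eq_sqrt_inner)
  have half: "?n i \<bullet> ?n j \<le> - (1 / 2)" if "i \<noteq> j" "ca i j \<noteq> 0" for i j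
  proof -
    have pos: "\<alpha> i \<bullet> \<alpha> i > 0" "\<alpha> j \<bullet> \<alpha> j > 0" using root_nz(2)[OF alpha_root] by auto
    have "ca i j * ca j i \<ge> 1" using cartan_pairs[OF that(1)] that(2) by auto
    then have "1 * ((\<alpha> i \<bullet> \<alpha> i) * (\<alpha> j \<bullet> \<alpha> j)) \<le> real_of_int (ca i j * ca j i) * ((\<alpha> i \<bullet> \<alpha> i) * (\<alpha> j \<bullet> \<alpha> j))"
      using pos by (intro mult_right_mono) (auto simp del: of_int_mult)
    then have "(norm (\<alpha> i) * norm (\<alpha> j))\<^sup>2 \<le> (2 * (\<alpha> i \<bullet> \<alpha> j))\<^sup>2"
      unfolding cartan_prod_real by (simp add: power_mult_distrib dot_square_norm[symmetric])
    then have "norm (\<alpha> i) * norm (\<alpha> j) \<le> \<bar>2 * (\<alpha> i \<bullet> \<alpha> j)\<bar>"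
      unfolding abs_le_square_iff[symmetric] by simp
    moreover have "\<alpha> i \<bullet> \<alpha> j \<le> 0"
      unfolding inner_cartan[of i j] using cartan_nonpos[OF that(1)] pos(1)
      by (simp add: mult_nonpos_nonneg)
    ultimately have "norm (\<alpha> i) * norm (\<alpha> j) \<le> - 2 * (\<alpha> i \<bullet> \<alpha> j)" by simp
    then show ?thesis using n0[of i] n0[of j] by (simp add: field_simps)
  qed
  have "?n i \<bullet> ?n j \<le> - (1 / 2)" "?n j \<bullet> ?n k \<le> - (1 / 2)" "?n i \<bullet> ?n k \<le> - (1 / 2)"
    using no assms half by auto
  moreover have "(?n i + ?n j + ?n k) \<bullet> (?n i + ?n j + ?n k) = ?n i \<bullet> ?n i + ?n j \<bullet> ?n j + ?n k \<bullet> ?n k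
     + 2 * (?n i \<bullet> ?n j) + 2 * (?n j \<bullet> ?n k) + 2 * (?n i \<bullet> ?n k)"
    by (rule square3)
  ultimately have "(?n i + ?n j + ?n k) \<bullet> (?n i + ?n j + ?n k) \<le> 0" unfolding nn by linarith
  then have "?n i + ?n j + ?n k = 0" by (metis inner_gt_zero_iff not_less)
  from lin_indep3[OF assms(1,3,2) this] n0[of i] show False by simp
qed

section \<open>Coxeter orders\<close>

lemma reflection_bij: "\<beta> \<noteq> 0 \<Longrightarrow> reflection \<beta> \<in> Bij UNIV"
proof -
  assume b: "\<beta> \<noteq> 0"
  have "reflection \<beta> (reflection \<beta> v) = v" for v
    using b by (simp add: reflection_def inner_diff_right field_simps)
  then show ?thesis by (auto simp: Bij_def intro!: bij_betw_byWitness[where f' = "reflection \<beta>"])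
qed

lemma weyl_group: "group (weyl_group \<Phi>)"
  and refl_weyl: "\<beta> \<in> \<Phi> \<Longrightarrow> reflection \<beta> \<in> carrier (weyl_group \<Phi>)"
proof -
  have sub: "reflection ` \<Phi> \<subseteq> carrier (BijGroup UNIV)"
    using reflection_bij root_nz(1) by (auto simp: BijGroup_def)
  show "group (weyl_group \<Phi>)"
    unfolding weyl_group_def
    by (intro subgroup.subgroup_is_group group.generate_is_subgroup group_BijGroup sub)
  show "\<beta> \<in> \<Phi> \<Longrightarrow> reflection \<beta> \<in> carrier (weyl_group \<Phi>)"
    by (simp add: weyl_group_def generate.incl)
qed

lemma weyl_carrier_Bij: "f \<in> carrier (weyl_group \<Phi>) \<Longrightarrow> f \<in> Bij UNIV"
proof -
  have sub: "reflection ` \<Phi> \<subseteq> carrier (BijGroup UNIV)"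
    using reflection_bij root_nz(1) by (auto simp: BijGroup_def)
  show "f \<in> carrier (weyl_group \<Phi>) \<Longrightarrow> f \<in> Bij UNIV"
    using group.generate_incl[OF group_BijGroup sub] by (auto simp: weyl_group_def BijGroup_def)
qed

lemma weyl_mult:
  assumes "f \<in> carrier (weyl_group \<Phi>)" "g \<in> carrier (weyl_group \<Phi>)"
  shows "f \<otimes>\<^bsub>weyl_group \<Phi>\<^esub> g = f \<circ> g"
  using assms[THEN weyl_carrier_Bij] by (simp add: weyl_group_def BijGroup_def compose_def fun_eq_iff)

lemma weyl_one: "\<one>\<^bsub>weyl_group \<Phi>\<^esub> = id"
  by (simp add: weyl_group_def BijGroup_def fun_eq_iff)

lemma weyl_pow:
  assumes "f \<in> carrier (weyl_group \<Phi>)" shows "f [^]\<^bsub>weyl_group \<Phi>\<^esub> (n::nat) = f ^^ n"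
proof -
  interpret W: group "weyl_group \<Phi>" by (rule weyl_group)
  show ?thesis
    using assms by (induction n) (simp_all add: weyl_one weyl_mult id_def[symmetric] funpow_swap1 fun_eq_iff)
qed

lemma ord_eqI:
  assumes f: "f \<in> carrier (weyl_group \<Phi>)" and n: "f ^^ n = id" "n > 0"
    and less: "\<And>k. 0 < k \<Longrightarrow> k < n \<Longrightarrow> f ^^ k \<noteq> id"
  shows "group.ord (weyl_group \<Phi>) f = n"
proof -
  interpret W: group "weyl_group \<Phi>" by (rule weyl_group)
  have "W.ord f dvd n" using W.pow_eq_id[OF f, of n] n by (simp add: weyl_pow[OF f] weyl_one)
  moreover have "f ^^ W.ord f = id" using W.pow_ord_eq_1[OF f] by (simp add: weyl_pow[OF f] weyl_one)
  ultimately show ?thesis using less[of "W.ord f"] n by (metis dvd_imp_le dvd_pos_nat linorder_neqE_nat not_less)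
qed

text \<open>The product of the two reflections moves v only along the two simple roots. In the
  coordinates x, y of \<open>g v x y\<close> its powers are explicit combinations of the coroot
  values \<open>p i v\<close> and \<open>p j v\<close>; the root \<open>\<alpha> i\<close> shows
  that no smaller power is the identity.\<close>

lemma coxeter:
  assumes ij: "i \<noteq> j"
  shows "coxeter_order \<Phi> \<alpha> i j = (if ca i j * ca j i = 0 then 2 else if ca i j * ca j i = 1 then 3
     else if ca i j * ca j i = 2 then 4 else 6)"
proof -
  let ?f = "reflection (\<alpha> i) \<circ> reflection (\<alpha> j)"
  let ?A = "real_of_int (ca i j)" and ?B = "real_of_int (ca j i)"
  have c: "?f \<in> carrier (weyl_group \<Phi>)" and co: "coxeter_order \<Phi> \<alpha> i j = group.ord (weyl_group \<Phi>) ?f"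
  proof -
    interpret W: group "weyl_group \<Phi>" by (rule weyl_group)
    have e: "reflection (\<alpha> i) \<otimes>\<^bsub>weyl_group \<Phi>\<^esub> reflection (\<alpha> j) = ?f"
      by (intro weyl_mult refl_weyl alpha_root)
    show "?f \<in> carrier (weyl_group \<Phi>)" unfolding e[symmetric] by (intro W.m_closed refl_weyl alpha_root)
    show "coxeter_order \<Phi> \<alpha> i j = group.ord (weyl_group \<Phi>) ?f" by (simp only: coxeter_order_def e)
  qed
  define p where "p i v = 2 * (\<alpha> i \<bullet> v) / (\<alpha> i \<bullet> \<alpha> i)" for i v
  have pl: "p i (v - x *\<^sub>R \<alpha> j) = p i v - x * real_of_int (ca i j)" for i j v x
    by (simp add: p_def cartan_real inner_diff_right diff_divide_distrib right_diff_distrib)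
  have r: "reflection (\<alpha> i) v = v - p i v *\<^sub>R \<alpha> i" for i v by (simp add: reflection_def p_def)
  define g where "g v x y = v - x *\<^sub>R \<alpha> i - y *\<^sub>R \<alpha> j" for v x y
  have f: "?f (g v x y) = g v (p i v - x - ?A * (p j v - ?B * x - y)) (p j v - ?B * x - y)" for v x y
  proof -
    have pg: "p k (g v x y) = p k v - x * ca k i - y * ca k j" for k v x y by (simp add: g_def pl)
    have "reflection (\<alpha> j) (g v x y) = g v x (y + p j (g v x y))" for v x y
      by (simp add: r g_def scaleR_add_left)
    moreover have "reflection (\<alpha> i) (g v x y) = g v (x + p i (g v x y)) y" for v x y
      by (simp add: r g_def scaleR_add_left)
    ultimately have "?f (g v x y) = g v (x + p i (g v x (y + p j (g v x y)))) (y + p j (g v x y))" by simp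
    also have "y + p j (g v x y) = p j v - ?B * x - y" unfolding pg by (simp add: cartan_diag)
    also have "x + p i (g v x (p j v - ?B * x - y)) = p i v - x - ?A * (p j v - ?B * x - y)"
      unfolding pg by (simp add: cartan_diag)
    finally show ?thesis .
  qed
  have g0: "g v 0 0 = v" for v by (simp add: g_def)
  have gi: "g v x y = v \<Longrightarrow> x = 0 \<and> y = 0" for v x y
    using lin_indep2[OF ij, of x y] by (simp add: g_def algebra_simps)
  have pi: "p i (\<alpha> i) = 2" "p j (\<alpha> i) = ?B"
    using root_nz(2)[OF alpha_root, of i] by (simp_all add: p_def cartan_real)
  define F where "F = ?f"
  have st: "F w = g v x' y'" if "w = g v x y" "y' = p j v - ?B * x - y" "x' = p i v - x - ?A * y'" for w v x y x' y'
    unfolding that F_def f ..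
  have F: "(F ^^ 1) v = F v" "(F ^^ 2) v = F ((F ^^ 1) v)" "(F ^^ 3) v = F ((F ^^ 2) v)" "(F ^^ 4) v = F ((F ^^ 3) v)"
    "(F ^^ 5) v = F ((F ^^ 4) v)" "(F ^^ 6) v = F ((F ^^ 5) v)" for v
    by (simp_all add: numeral_eq_Suc)
  have ordI: "group.ord (weyl_group \<Phi>) ?f = n" if o: "\<And>v. (F ^^ n) v = g v 0 0" "n > 0"
      "\<And>k. 0 < k \<Longrightarrow> k < n \<Longrightarrow> \<exists>x y. (F ^^ k) (\<alpha> i) = g (\<alpha> i) x y \<and> (x \<noteq> 0 \<or> y \<noteq> 0)" for n
  proof (rule ord_eqI[OF c _ o(2)])
    show "?f ^^ n = id" using o(1) by (simp add: g0 fun_eq_iff flip: F_def)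
    show "?f ^^ k \<noteq> id" if k: "0 < k" "k < n" for k
    proof
      assume "?f ^^ k = id"
      then have "(F ^^ k) (\<alpha> i) = \<alpha> i" by (simp add: F_def)
      then show False using o(3)[OF k] gi by metis
    qed
  qed
  consider "ca i j = 0" "ca j i = 0" | "ca i j = -1" "ca j i = -1" | "ca i j = -1" "ca j i = -2" | "ca i j = -2" "ca j i = -1"
    | "ca i j = -1" "ca j i = -3" | "ca i j = -3" "ca j i = -1"
    using cartan_pairs[OF ij] by auto
  then have "group.ord (weyl_group \<Phi>) ?f = (if ca i j * ca j i = 0 then 2 else if ca i j * ca j i = 1 then 3
     else if ca i j * ca j i = 2 then 4 else 6)"
  proof cases
    case 1
    have e1: "(F ^^ 1) v = g v (1 * p i v + (0) * p j v) (0 * p i v + (1) * p j v)" for v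
      unfolding F(1) by (rule st[OF g0[symmetric]]) (simp_all add: 1 algebra_simps)
    have e2: "(F ^^ 2) v = g v (0) (0)" for v
      unfolding F(2) by (rule st[OF e1]) (simp_all add: 1 algebra_simps)
    have "\<exists>x y. (F ^^ k) (\<alpha> i) = g (\<alpha> i) x y \<and> (x \<noteq> 0 \<or> y \<noteq> 0)" if k: "0 < k" "k < 2" for k
    proof -
      consider "k = 1" using k by linarith
      then show ?thesis
        by cases (use e1[of "\<alpha> i"] in \<open>fastforce simp: pi 1\<close>)+
    qed
    then have "group.ord (weyl_group \<Phi>) ?f = 2" by (intro ordI e2) auto
    then show ?thesis using 1 by simp
  next
    case 2
    have e1: "(F ^^ 1) v = g v (1 * p i v + (1) * p j v) (0 * p i v + (1) * p j v)" for v
      unfolding F(1) by (rule st[OF g0[symmetric]]) (simp_all add: 2 algebra_simps)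
    have e2: "(F ^^ 2) v = g v (1 * p i v + (0) * p j v) (1 * p i v + (1) * p j v)" for v
      unfolding F(2) by (rule st[OF e1]) (simp_all add: 2 algebra_simps)
    have e3: "(F ^^ 3) v = g v (0) (0)" for v
      unfolding F(3) by (rule st[OF e2]) (simp_all add: 2 algebra_simps)
    have "\<exists>x y. (F ^^ k) (\<alpha> i) = g (\<alpha> i) x y \<and> (x \<noteq> 0 \<or> y \<noteq> 0)" if k: "0 < k" "k < 3" for k
    proof -
      consider "k = 1" | "k = 2" using k by linarith
      then show ?thesis
        by cases (use e1[of "\<alpha> i"] e2[of "\<alpha> i"] in \<open>fastforce simp: pi 2\<close>)+
    qed
    then have "group.ord (weyl_group \<Phi>) ?f = 3" by (intro ordI e3) auto
    then show ?thesis using 2 by simp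
  next
    case 3
    have e1: "(F ^^ 1) v = g v (1 * p i v + (1) * p j v) (0 * p i v + (1) * p j v)" for v
      unfolding F(1) by (rule st[OF g0[symmetric]]) (simp_all add: 3 algebra_simps)
    have e2: "(F ^^ 2) v = g v (2 * p i v + (1) * p j v) (2 * p i v + (2) * p j v)" for v
      unfolding F(2) by (rule st[OF e1]) (simp_all add: 3 algebra_simps)
    have e3: "(F ^^ 3) v = g v (1 * p i v + (0) * p j v) (2 * p i v + (1) * p j v)" for v
      unfolding F(3) by (rule st[OF e2]) (simp_all add: 3 algebra_simps)
    have e4: "(F ^^ 4) v = g v (0) (0)" for v
      unfolding F(4) by (rule st[OF e3]) (simp_all add: 3 algebra_simps)
    have "\<exists>x y. (F ^^ k) (\<alpha> i) = g (\<alpha> i) x y \<and> (x \<noteq> 0 \<or> y \<noteq> 0)" if k: "0 < k" "k < 4" for k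
    proof -
      consider "k = 1" | "k = 2" | "k = 3" using k by linarith
      then show ?thesis
        by cases (use e1[of "\<alpha> i"] e2[of "\<alpha> i"] e3[of "\<alpha> i"] in \<open>fastforce simp: pi 3\<close>)+
    qed
    then have "group.ord (weyl_group \<Phi>) ?f = 4" by (intro ordI e4) auto
    then show ?thesis using 3 by simp
  next
    case 4
    have e1: "(F ^^ 1) v = g v (1 * p i v + (2) * p j v) (0 * p i v + (1) * p j v)" for v
      unfolding F(1) by (rule st[OF g0[symmetric]]) (simp_all add: 4 algebra_simps)
    have e2: "(F ^^ 2) v = g v (2 * p i v + (2) * p j v) (1 * p i v + (2) * p j v)" for v
      unfolding F(2) by (rule st[OF e1]) (simp_all add: 4 algebra_simps)
    have e3: "(F ^^ 3) v = g v (1 * p i v + (0) * p j v) (1 * p i v + (1) * p j v)" for v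
      unfolding F(3) by (rule st[OF e2]) (simp_all add: 4 algebra_simps)
    have e4: "(F ^^ 4) v = g v (0) (0)" for v
      unfolding F(4) by (rule st[OF e3]) (simp_all add: 4 algebra_simps)
    have "\<exists>x y. (F ^^ k) (\<alpha> i) = g (\<alpha> i) x y \<and> (x \<noteq> 0 \<or> y \<noteq> 0)" if k: "0 < k" "k < 4" for k
    proof -
      consider "k = 1" | "k = 2" | "k = 3" using k by linarith
      then show ?thesis
        by cases (use e1[of "\<alpha> i"] e2[of "\<alpha> i"] e3[of "\<alpha> i"] in \<open>fastforce simp: pi 4\<close>)+
    qed
    then have "group.ord (weyl_group \<Phi>) ?f = 4" by (intro ordI e4) auto
    then show ?thesis using 4 by simp
  next
    case 5
    have e1: "(F ^^ 1) v = g v (1 * p i v + (1) * p j v) (0 * p i v + (1) * p j v)" for v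
      unfolding F(1) by (rule st[OF g0[symmetric]]) (simp_all add: 5 algebra_simps)
    have e2: "(F ^^ 2) v = g v (3 * p i v + (2) * p j v) (3 * p i v + (3) * p j v)" for v
      unfolding F(2) by (rule st[OF e1]) (simp_all add: 5 algebra_simps)
    have e3: "(F ^^ 3) v = g v (4 * p i v + (2) * p j v) (6 * p i v + (4) * p j v)" for v
      unfolding F(3) by (rule st[OF e2]) (simp_all add: 5 algebra_simps)
    have e4: "(F ^^ 4) v = g v (3 * p i v + (1) * p j v) (6 * p i v + (3) * p j v)" for v
      unfolding F(4) by (rule st[OF e3]) (simp_all add: 5 algebra_simps)
    have e5: "(F ^^ 5) v = g v (1 * p i v + (0) * p j v) (3 * p i v + (1) * p j v)" for v
      unfolding F(5) by (rule st[OF e4]) (simp_all add: 5 algebra_simps)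
    have e6: "(F ^^ 6) v = g v (0) (0)" for v
      unfolding F(6) by (rule st[OF e5]) (simp_all add: 5 algebra_simps)
    have "\<exists>x y. (F ^^ k) (\<alpha> i) = g (\<alpha> i) x y \<and> (x \<noteq> 0 \<or> y \<noteq> 0)" if k: "0 < k" "k < 6" for k
    proof -
      consider "k = 1" | "k = 2" | "k = 3" | "k = 4" | "k = 5" using k by linarith
      then show ?thesis
        by cases (use e1[of "\<alpha> i"] e2[of "\<alpha> i"] e3[of "\<alpha> i"] e4[of "\<alpha> i"] e5[of "\<alpha> i"] in \<open>fastforce simp: pi 5\<close>)+
    qed
    then have "group.ord (weyl_group \<Phi>) ?f = 6" by (intro ordI e6) auto
    then show ?thesis using 5 by simp
  next
    case 6
    have e1: "(F ^^ 1) v = g v (1 * p i v + (3) * p j v) (0 * p i v + (1) * p j v)" for v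
      unfolding F(1) by (rule st[OF g0[symmetric]]) (simp_all add: 6 algebra_simps)
    have e2: "(F ^^ 2) v = g v (3 * p i v + (6) * p j v) (1 * p i v + (3) * p j v)" for v
      unfolding F(2) by (rule st[OF e1]) (simp_all add: 6 algebra_simps)
    have e3: "(F ^^ 3) v = g v (4 * p i v + (6) * p j v) (2 * p i v + (4) * p j v)" for v
      unfolding F(3) by (rule st[OF e2]) (simp_all add: 6 algebra_simps)
    have e4: "(F ^^ 4) v = g v (3 * p i v + (3) * p j v) (2 * p i v + (3) * p j v)" for v
      unfolding F(4) by (rule st[OF e3]) (simp_all add: 6 algebra_simps)
    have e5: "(F ^^ 5) v = g v (1 * p i v + (0) * p j v) (1 * p i v + (1) * p j v)" for v
      unfolding F(5) by (rule st[OF e4]) (simp_all add: 6 algebra_simps)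
    have e6: "(F ^^ 6) v = g v (0) (0)" for v
      unfolding F(6) by (rule st[OF e5]) (simp_all add: 6 algebra_simps)
    have "\<exists>x y. (F ^^ k) (\<alpha> i) = g (\<alpha> i) x y \<and> (x \<noteq> 0 \<or> y \<noteq> 0)" if k: "0 < k" "k < 6" for k
    proof -
      consider "k = 1" | "k = 2" | "k = 3" | "k = 4" | "k = 5" using k by linarith
      then show ?thesis
        by cases (use e1[of "\<alpha> i"] e2[of "\<alpha> i"] e3[of "\<alpha> i"] e4[of "\<alpha> i"] e5[of "\<alpha> i"] in \<open>fastforce simp: pi 6\<close>)+
    qed
    then have "group.ord (weyl_group \<Phi>) ?f = 6" by (intro ordI e6) auto
    then show ?thesis using 6 by simp
  qed
  then show ?thesis unfolding co .
qed

end

section \<open>Presented algebras and their automorphisms\<close>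

lemma ring_of_type_simps [simp]:
  "carrier ring_of_type_algebra = UNIV" "monoid.mult ring_of_type_algebra = (*)" "one ring_of_type_algebra = 1"
  "zero ring_of_type_algebra = 0" "add ring_of_type_algebra = (+)"
  by (simp_all add: ring_of_type_algebra_def)

lemma ring_type: "ring (ring_of_type_algebra :: 'r::ring_1 ring)"
proof (rule ringI)
  show "abelian_group (ring_of_type_algebra :: 'r ring)"
    by (rule abelian_groupI) (auto simp: add.assoc add.commute intro: exI[of _ "- _"] left_minus)
  show "monoid (ring_of_type_algebra :: 'r ring)"
    by (rule monoidI) (auto simp: mult.assoc)
qed (auto simp: distrib_left distrib_right)

lemma ideal_two_sided: "ideal J (ring_of_type_algebra :: 'r::ring_1 ring) \<longleftrightarrow> two_sided J"
proof
  assume "ideal J (ring_of_type_algebra :: 'r ring)"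
  then interpret J: ideal J "ring_of_type_algebra :: 'r ring" .
  show "two_sided J"
    using additive_subgroup.a_closed[OF J.is_additive_subgroup] additive_subgroup.zero_closed[OF J.is_additive_subgroup]
      J.I_l_closed J.I_r_closed by (auto simp: two_sided_def)
next
  assume J: "two_sided J"
  interpret ring "ring_of_type_algebra :: 'r ring" by (rule ring_type)
  have neg: "a_inv ring_of_type_algebra x = - x" for x :: 'r
    by (rule minus_equality) auto
  show "ideal J (ring_of_type_algebra :: 'r ring)"
  proof (rule idealI)
    show "subgroup J (add_monoid (ring_of_type_algebra :: 'r ring))"
      by (rule subgroup.intro) (auto simp: two_sidedD[OF J] neg[unfolded a_inv_def, simplified])
  qed (auto simp: two_sidedD[OF J] ring_type)
qed

lemma genideal_fa_ideal:
  fixes rels :: "('a, 'k::field) free_algebra set"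
  shows "genideal ring_of_type_algebra rels = fa_ideal rels"
proof
  interpret ring "ring_of_type_algebra :: ('a, 'k) free_algebra ring" by (rule ring_type)
  show "genideal ring_of_type_algebra rels \<subseteq> fa_ideal rels"
    by (rule genideal_minimal) (auto simp: ideal_two_sided two_sided_fa_ideal intro: fa_ideal_gen)
  have "ideal (genideal ring_of_type_algebra rels) ring_of_type_algebra" by (rule genideal_ideal) simp
  then show "fa_ideal rels \<subseteq> genideal ring_of_type_algebra rels"
    by (intro fa_ideal_minimal) (simp_all add: ideal_two_sided genideal_self)
qed

text \<open>An algebra given as the image of a free algebra. All its operations become operations on
  representatives, which serves both the quantized enveloping algebra and the coideal
  subalgebra.\<close>

locale algebra_image =
  fixes M :: "('k::field, 'b) module" (structure) and c :: "('a, 'k) free_algebra \<Rightarrow> 'b"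
  assumes carrier: "carrier M = range c"
    and mult: "c p \<otimes> c r = c (p * r)" and add: "c p \<oplus> c r = c (p + r)"
    and one: "\<one> = c 1" and zero: "\<zero> = c 0" and smult: "b \<odot> c p = c (fa_const b * p)"
begin

lemma ring: "ring M"
proof (rule ringI)
  show "abelian_group M"
  proof (rule abelian_groupI)
    fix x assume "x \<in> carrier M"
    then obtain p where "x = c p" by (auto simp: carrier)
    then show "\<exists>y\<in>carrier M. y \<oplus> x = \<zero>"
      by (intro bexI[of _ "c (- p)"]) (simp_all add: add zero carrier)
  qed (auto simp: carrier add zero add_ac)
  show "monoid M" by (rule monoidI) (auto simp: carrier mult one mult.assoc)
qed (auto simp: carrier add mult distrib_left distrib_right)

sublocale R: ring M by (rule ring)

lemma closed [simp]: "c p \<in> carrier M"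
  by (simp add: carrier)

lemma uminus: "\<ominus> c p = c (- p)"
  by (rule R.minus_equality) (simp_all add: add zero)

lemma diff: "c p \<ominus> c r = c (p - r)"
  by (simp add: a_minus_def uminus add)

lemma power: "c p [^] (n::nat) = c (p ^ n)"
  by (induction n) (simp_all add: one mult power_commutes)

lemmas ops = mult add one zero smult uminus diff power

lemma cong_diff: "c p = c r \<longleftrightarrow> c (p - r) = \<zero>"
  using R.r_right_minus_eq[of "c p" "c r"] by (simp add: diff)

lemma automorphism_eqI:
  assumes \<phi>: "\<phi> \<in> algebra_automorphisms M" and \<psi>: "\<psi> \<in> algebra_automorphisms M"
    and gens: "\<And>j. \<phi> (c (fa_gen j)) = \<psi> (c (fa_gen j))"
  shows "\<phi> = \<psi>"
proof (rule extensionalityI[of _ "carrier M"])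
  show "\<phi> \<in> extensional (carrier M)" "\<psi> \<in> extensional (carrier M)"
    using \<phi> \<psi> by (auto simp: algebra_automorphisms_def Bij_def)
  have \<phi>': "\<phi> \<in> ring_hom M M" "\<And>b p. \<phi> (b \<odot> c p) = b \<odot> \<phi> (c p)"
    and \<psi>': "\<psi> \<in> ring_hom M M" "\<And>b p. \<psi> (b \<odot> c p) = b \<odot> \<psi> (c p)"
    using \<phi> \<psi> by (auto simp: algebra_automorphisms_def)
  have "\<phi> (c p) = \<psi> (c p)" for p
  proof (induction p rule: fa_left_induct)
    case (const b)
    have "c (fa_const b) = b \<odot> \<one>" by (simp add: one smult)
    then show ?case using \<phi>' \<psi>' by (metis one ring_hom_one)
  next
    case (gen x p)
    then show ?case
      using ring_hom_mult[OF \<phi>'(1) closed closed, of "fa_gen x" p] ring_hom_mult[OF \<psi>'(1) closed closed, of "fa_gen x" p]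
        gens[of x] by (simp add: mult)
  next
    case (add p r)
    then show ?case
      using ring_hom_add[OF \<phi>'(1) closed closed, of p r] ring_hom_add[OF \<psi>'(1) closed closed, of p r]
      by (simp add: ops(2))
  qed
  then show "\<phi> x = \<psi> x" if "x \<in> carrier M" for x using that by (auto simp: carrier)
qed

text \<open>The choice of a representative is immaterial for homomorphisms that preserve the kernel
  of \<open>c\<close>.\<close>

definition lift :: "(('a, 'k) free_algebra \<Rightarrow> ('a, 'k) free_algebra) \<Rightarrow> 'b \<Rightarrow> 'b" where
  "lift f = restrict (\<lambda>x. c (f (SOME p. c p = x))) (carrier M)"

lemma lift:
  assumes "\<And>p. c p = \<zero> \<Longrightarrow> c (fa_hom f p) = \<zero>"
  shows "lift (fa_hom f) (c p) = c (fa_hom f p)"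
proof -
  have "c (SOME r. c r = c p) = c p" by (rule someI) (rule HOL.refl)
  then have "c (fa_hom f (SOME r. c r = c p)) = c (fa_hom f p)"
    using assms by (subst cong_diff) (simp add: cong_diff flip: fa_hom_linear)
  then show ?thesis by (simp add: lift_def)
qed

lemma lift_automorphism:
  assumes f: "\<And>p. c p = \<zero> \<Longrightarrow> c (fa_hom f p) = \<zero>" and g: "\<And>p. c p = \<zero> \<Longrightarrow> c (fa_hom g p) = \<zero>"
    and fg: "\<And>p. c (fa_hom f (fa_hom g p)) = c p" and gf: "\<And>p. c (fa_hom g (fa_hom f p)) = c p"
  shows "lift (fa_hom f) \<in> algebra_automorphisms M"
proof -
  note lf = lift[OF f] and lg = lift[OF g]
  have "bij_betw (lift (fa_hom f)) (carrier M) (carrier M)"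
    by (rule bij_betw_byWitness[where f' = "lift (fa_hom g)"]) (auto simp: carrier lf lg fg gf)
  moreover have "lift (fa_hom f) \<in> extensional (carrier M)" by (simp add: lift_def)
  moreover have "lift (fa_hom f) \<in> ring_hom M M"
    by (rule ring_hom_memI) (auto simp: carrier lf mult add one fa_hom_linear)
  ultimately show ?thesis
    by (auto simp: algebra_automorphisms_def Bij_def carrier lf smult)
qed

lemma Aut_closed:
  assumes "\<phi> \<in> algebra_automorphisms M" "x \<in> carrier M" shows "\<phi> x \<in> carrier M"
  using assms by (auto simp: algebra_automorphisms_def Bij_def bij_betw_def)

lemma subgroup_Aut: "subgroup (algebra_automorphisms M) (BijGroup (carrier M))"
proof (rule subgroup.intro)
  show "algebra_automorphisms M \<subseteq> carrier (BijGroup (carrier M))"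
    by (auto simp: BijGroup_def algebra_automorphisms_def)
next
  fix \<phi> \<psi> assume \<phi>: "\<phi> \<in> algebra_automorphisms M" and \<psi>: "\<psi> \<in> algebra_automorphisms M"
  have "compose (carrier M) \<phi> \<psi> \<in> Bij (carrier M)"
    using \<phi> \<psi> by (intro compose_Bij) (auto simp: algebra_automorphisms_def)
  moreover have "compose (carrier M) \<phi> \<psi> \<in> ring_hom M M"
  proof (rule ring_hom_memI)
    have h: "\<phi> \<in> ring_hom M M" "\<psi> \<in> ring_hom M M" using \<phi> \<psi> by (auto simp: algebra_automorphisms_def)
    note hs = ring_hom_mult[OF h(1)] ring_hom_mult[OF h(2)] ring_hom_add[OF h(1)] ring_hom_add[OF h(2)]
    fix x assume x: "x \<in> carrier M"
    then show "compose (carrier M) \<phi> \<psi> x \<in> carrier M"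
      by (simp add: compose_def Aut_closed[OF \<phi>] Aut_closed[OF \<psi>])
    fix y assume "y \<in> carrier M"
    with x show
      "compose (carrier M) \<phi> \<psi> (x \<otimes> y) = compose (carrier M) \<phi> \<psi> x \<otimes> compose (carrier M) \<phi> \<psi> y"
      "compose (carrier M) \<phi> \<psi> (x \<oplus> y) = compose (carrier M) \<phi> \<psi> x \<oplus> compose (carrier M) \<phi> \<psi> y"
      by (simp_all add: compose_def hs Aut_closed[OF \<phi>] Aut_closed[OF \<psi>])
  next
    have "\<phi> \<one> = \<one>" "\<psi> \<one> = \<one>" using \<phi> \<psi> by (auto simp: algebra_automorphisms_def intro: ring_hom_one)
    then show "compose (carrier M) \<phi> \<psi> \<one> = \<one>" by (simp add: compose_def)
  qed
  moreover have "compose (carrier M) \<phi> \<psi> (b \<odot> x) = b \<odot> compose (carrier M) \<phi> \<psi> x" if x: "x \<in> carrier M" for b x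
  proof -
    have "b \<odot> x \<in> carrier M" using x by (auto simp: carrier smult)
    then show ?thesis using x \<phi> \<psi> Aut_closed[OF \<psi> x] by (simp add: compose_def algebra_automorphisms_def)
  qed
  ultimately show "\<phi> \<otimes>\<^bsub>BijGroup (carrier M)\<^esub> \<psi> \<in> algebra_automorphisms M"
    using \<phi> \<psi> by (simp add: BijGroup_def algebra_automorphisms_def)
next
  show "\<one>\<^bsub>BijGroup (carrier M)\<^esub> \<in> algebra_automorphisms M"
    by (auto simp: BijGroup_def algebra_automorphisms_def id_Bij carrier ops intro!: ring_hom_memI)
next
  fix \<phi> assume \<phi>: "\<phi> \<in> algebra_automorphisms M"
  then have bij: "\<phi> \<in> Bij (carrier M)" and h: "\<phi> \<in> ring_hom M M"
    and s: "\<And>b x. x \<in> carrier M \<Longrightarrow> \<phi> (b \<odot> x) = b \<odot> \<phi> x" by (auto simp: algebra_automorphisms_def)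
  have b: "bij_betw \<phi> (carrier M) (carrier M)" using bij by (simp add: Bij_def)
  let ?g = "\<lambda>x. inv_into (carrier M) \<phi> x"
  have g: "?g x \<in> carrier M" "\<phi> (?g x) = x" if "x \<in> carrier M" for x
    using that b bij_betw_inv_into_right[OF b] Bij_inv_into_mem[OF bij] by auto
  have gI: "?g x = y" if "y \<in> carrier M" "\<phi> y = x" for x y
    using that bij_betw_inv_into_left[OF b] by auto
  have "(\<lambda>x\<in>carrier M. ?g x) \<in> ring_hom M M"
  proof (rule ring_hom_memI)
    fix x assume x: "x \<in> carrier M"
    show "(\<lambda>x\<in>carrier M. ?g x) x \<in> carrier M" using x g by simp
    fix y assume y: "y \<in> carrier M"
    have "?g (x \<otimes> y) = ?g x \<otimes> ?g y" by (rule gI) (simp_all add: x y g ring_hom_mult[OF h])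
    then show "(\<lambda>x\<in>carrier M. ?g x) (x \<otimes> y) = (\<lambda>x\<in>carrier M. ?g x) x \<otimes> (\<lambda>x\<in>carrier M. ?g x) y"
      using x y by simp
    have "?g (x \<oplus> y) = ?g x \<oplus> ?g y" by (rule gI) (simp_all add: x y g ring_hom_add[OF h])
    then show "(\<lambda>x\<in>carrier M. ?g x) (x \<oplus> y) = (\<lambda>x\<in>carrier M. ?g x) x \<oplus> (\<lambda>x\<in>carrier M. ?g x) y"
      using x y by simp
  next
    have "?g \<one> = \<one>" by (rule gI) (simp_all add: ring_hom_one[OF h])
    then show "(\<lambda>x\<in>carrier M. ?g x) \<one> = \<one>" by simp
  qed
  moreover have "(\<lambda>x\<in>carrier M. ?g x) (b \<odot> x) = b \<odot> (\<lambda>x\<in>carrier M. ?g x) x" if x: "x \<in> carrier M" for b x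
  proof -
    have sc: "b \<odot> y \<in> carrier M" if "y \<in> carrier M" for y using that by (auto simp: carrier smult)
    have "?g (b \<odot> x) = b \<odot> ?g x" by (rule gI) (simp_all add: x g sc s)
    then show ?thesis using x sc by simp
  qed
  ultimately show "inv\<^bsub>BijGroup (carrier M)\<^esub> \<phi> \<in> algebra_automorphisms M"
    using restrict_inv_into_Bij[OF bij] by (simp add: inv_BijGroup[OF bij] algebra_automorphisms_def)
qed

lemma group_Aut: "group (Aut_alg M)"
  unfolding Aut_alg_def by (intro subgroup.subgroup_is_group subgroup_Aut group_BijGroup)

lemma carrier_Aut: "carrier (Aut_alg M) = algebra_automorphisms M"
  by (simp add: Aut_alg_def)

lemma mult_Aut:
  "\<phi> \<in> algebra_automorphisms M \<Longrightarrow> \<psi> \<in> algebra_automorphisms M \<Longrightarrow>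
    \<phi> \<otimes>\<^bsub>Aut_alg M\<^esub> \<psi> = compose (carrier M) \<phi> \<psi>"
  by (simp add: Aut_alg_def BijGroup_def algebra_automorphisms_def)

lemma one_Aut: "\<one>\<^bsub>Aut_alg M\<^esub> = (\<lambda>x\<in>carrier M. x)"
  by (simp add: Aut_alg_def BijGroup_def)

end

lemma presented_algebra_image:
  fixes rels :: "('a, 'b::field) free_algebra set"
  shows "algebra_image (presented_algebra rels) (\<lambda>p. fa_ideal rels +>\<^bsub>ring_of_type_algebra\<^esub> p)"
  and presented_zero_iff: "fa_ideal rels +>\<^bsub>ring_of_type_algebra\<^esub> p = fa_ideal rels \<longleftrightarrow> p \<in> fa_ideal rels"
  and presented_zero: "zero (presented_algebra rels) = fa_ideal rels"
proof -
  interpret R: ring "ring_of_type_algebra :: ('a, 'b) free_algebra ring" by (rule ring_type)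
  interpret J: ideal "fa_ideal rels" "ring_of_type_algebra :: ('a, 'b) free_algebra ring"
    by (simp add: ideal_two_sided two_sided_fa_ideal)
  let ?c = "\<lambda>p. fa_ideal rels +>\<^bsub>ring_of_type_algebra\<^esub> p"
  have eq: "?c p = {r. r - p \<in> fa_ideal rels}" for p
    by (auto simp: a_r_coset_def' intro!: bexI[of _ "_ - p"])
  show "?c p = fa_ideal rels \<longleftrightarrow> p \<in> fa_ideal rels"
    using two_sidedD(1)[OF two_sided_fa_ideal[of rels]] J.a_rcos_const[of p] J.a_rcos_self[of p] by auto
  have c0: "?c 0 = fa_ideal rels" by (simp add: eq)
  show "zero (presented_algebra rels) = fa_ideal rels"
    by (simp add: presented_algebra_def Let_def FactRing_def genideal_fa_ideal)
  show "algebra_image (presented_algebra rels) ?c"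
  proof
    show "carrier (presented_algebra rels) = range ?c"
      by (auto simp: presented_algebra_def Let_def FactRing_def genideal_fa_ideal A_RCOSETS_def' )
    show "?c p \<otimes>\<^bsub>presented_algebra rels\<^esub> ?c r = ?c (p * r)"
      and "b \<odot>\<^bsub>presented_algebra rels\<^esub> ?c p = ?c (fa_const b * p)" for p r b
      using J.rcoset_mult_add by (simp_all add: presented_algebra_def Let_def FactRing_def genideal_fa_ideal)
    show "?c p \<oplus>\<^bsub>presented_algebra rels\<^esub> ?c r = ?c (p + r)" for p r
      using J.a_rcos_sum by (simp add: presented_algebra_def Let_def FactRing_def genideal_fa_ideal)
  qed (simp_all add: presented_algebra_def Let_def FactRing_def genideal_fa_ideal c0)
qed

text \<open>The image of the free algebra on the generators is a subalgebra, and induction on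
  representatives places it inside every subalgebra containing them.\<close>

lemma generated_image:
  assumes "algebra_image A c"
  shows "algebra_image (generated_subalgebra A (range (\<lambda>j. c (f j)))) (\<lambda>p. c (fa_hom f p))"
proof -
  interpret A: algebra_image A c by fact
  let ?V = "range (\<lambda>p. c (fa_hom f p))"
  have "subring ?V A"
  proof (rule A.R.subringI)
    fix x assume "x \<in> ?V"
    then obtain p where p: "x = c (fa_hom f p)" by blast
    have "\<ominus>\<^bsub>A\<^esub> x = c (fa_hom f (- p))" by (simp add: p A.ops fa_hom_linear)
    then show "\<ominus>\<^bsub>A\<^esub> x \<in> ?V" by blast
    fix y assume "y \<in> ?V"
    then obtain r where r: "y = c (fa_hom f r)" by blast
    have "x \<otimes>\<^bsub>A\<^esub> y = c (fa_hom f (p * r))" "x \<oplus>\<^bsub>A\<^esub> y = c (fa_hom f (p + r))"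
      by (simp_all add: p r A.ops fa_hom_linear)
    then show "x \<otimes>\<^bsub>A\<^esub> y \<in> ?V" "x \<oplus>\<^bsub>A\<^esub> y \<in> ?V" by blast+
  next
    have "\<one>\<^bsub>A\<^esub> = c (fa_hom f 1)" by (simp add: A.one)
    then show "\<one>\<^bsub>A\<^esub> \<in> ?V" by blast
  qed auto
  moreover have "b \<odot>\<^bsub>A\<^esub> x \<in> ?V" if "x \<in> ?V" for b x
  proof -
    obtain p where "x = c (fa_hom f p)" using \<open>x \<in> ?V\<close> by blast
    then have "b \<odot>\<^bsub>A\<^esub> x = c (fa_hom f (fa_const b * p))" by (simp add: A.smult)
    then show ?thesis by blast
  qed
  moreover have "c (f j) \<in> ?V" for j using rangeI[of "\<lambda>p. c (fa_hom f p)" "fa_gen j"] by simp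
  ultimately have V: "subalgebra_of A ?V \<and> range (\<lambda>j. c (f j)) \<subseteq> ?V" by (auto simp: subalgebra_of_def)
  have "c (fa_hom f p) \<in> U" if U: "subalgebra_of A U" "range (\<lambda>j. c (f j)) \<subseteq> U" for U p
  proof (induction p rule: fa_left_induct)
    case (const b)
    have "\<one>\<^bsub>A\<^esub> \<in> U" using U by (simp add: subalgebra_of_def subringE)
    then have "b \<odot>\<^bsub>A\<^esub> \<one>\<^bsub>A\<^esub> \<in> U" using U by (simp add: subalgebra_of_def)
    then show ?case by (simp add: A.one A.smult)
  next
    case (gen x p)
    have "c (f x) \<in> U" using U by blast
    with gen have "c (f x) \<otimes>\<^bsub>A\<^esub> c (fa_hom f p) \<in> U" using U(1) by (simp add: subalgebra_of_def subringE)
    then show ?case by (simp add: A.mult)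
  next
    case (add p r)
    then have "c (fa_hom f p) \<oplus>\<^bsub>A\<^esub> c (fa_hom f r) \<in> U" using U(1) by (simp add: subalgebra_of_def subringE)
    then show ?case by (simp add: A.add fa_hom_linear)
  qed
  then have "\<Inter>{U. subalgebra_of A U \<and> range (\<lambda>j. c (f j)) \<subseteq> U} = ?V" using V by blast
  then show ?thesis
    by unfold_locales (simp_all add: generated_subalgebra_def A.ops fa_hom_linear)
qed

section \<open>Homomorphisms from the braid group\<close>

lemma braid_class_eq_iff: "braid_class m u = braid_class m v \<longleftrightarrow> braid_eq m u v"
  unfolding braid_class_def using braid_eq.refl braid_eq.sym braid_eq.trans by blast

lemma braid_class_self: "u \<in> braid_class m u"
  by (simp add: braid_class_def braid_eq.refl)

lemma braid_mult: "braid_class m u \<otimes>\<^bsub>braid_group m\<^esub> braid_class m v = braid_class m (u @ v)"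
proof -
  have "braid_class m (u' @ v') = braid_class m (u @ v)" if "u' \<in> braid_class m u" "v' \<in> braid_class m v" for u' v'
    using that braid_eq.append[of m u u' v v'] braid_class_eq_iff[of m "u @ v" "u' @ v'"] by (simp add: braid_class_def)
  then have "(\<Union>u'\<in>braid_class m u. \<Union>v'\<in>braid_class m v. braid_class m (u' @ v')) =
      (\<Union>u'\<in>braid_class m u. \<Union>v'\<in>braid_class m v. braid_class m (u @ v))"
    by (intro SUP_cong HOL.refl)
  moreover have "braid_class m u \<noteq> {}" "braid_class m v \<noteq> {}"
    using braid_class_self[of u m] braid_class_self[of v m] by blast+
  ultimately show ?thesis by (simp add: braid_group_def UN_constant)
qed

context group
begin

primrec word_eval :: "('i \<Rightarrow> 'a) \<Rightarrow> 'i braid_word \<Rightarrow> 'a" where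
  "word_eval t [] = \<one>"
| "word_eval t (l # u) = (if snd l then t (fst l) else inv t (fst l)) \<otimes> word_eval t u"

lemma word_eval_closed: "range t \<subseteq> carrier G \<Longrightarrow> word_eval t u \<in> carrier G"
  by (induction u) auto

lemma word_eval_append:
  assumes "range t \<subseteq> carrier G" shows "word_eval t (u @ v) = word_eval t u \<otimes> word_eval t v"
proof -
  have "t i \<in> carrier G" for i using assms by auto
  then show ?thesis using word_eval_closed[OF assms] by (induction u) (simp_all add: m_assoc)
qed

lemma word_eval_braid_eq:
  assumes t: "range t \<subseteq> carrier G"
    and rel: "\<And>i j. i \<noteq> j \<Longrightarrow> word_eval t (alternating (m i j) i j) = word_eval t (alternating (m i j) j i)"
  shows "braid_eq m u v \<Longrightarrow> word_eval t u = word_eval t v"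
proof (induction rule: braid_eq.induct)
  case (cancel i b)
  have "t i \<in> carrier G" using t by auto
  then show ?case by simp
next
  case (braid i j)
  then show ?case by (rule rel)
qed (simp_all add: word_eval_append[OF t])

text \<open>The universal property of generators and relations. The values on inverse letters are
  forced by the cancellation relation, and extensionality makes the homomorphism unique as a
  function.\<close>

lemma braid_group_hom:
  assumes t: "range t \<subseteq> carrier G"
    and rel: "\<And>i j. i \<noteq> j \<Longrightarrow> word_eval t (alternating (m i j) i j) = word_eval t (alternating (m i j) j i)"
  shows "\<exists>!h. h \<in> hom (braid_group m) G \<and> h \<in> extensional (carrier (braid_group m)) \<and> (\<forall>j. h (braid_gen m j) = t j)"
proof -
  have car: "carrier (braid_group m) = range (braid_class m)" by (simp add: braid_group_def)
  define h where "h = restrict (\<lambda>S. word_eval t (SOME u. u \<in> S)) (carrier (braid_group m))"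
  have h: "h (braid_class m u) = word_eval t u" for u
  proof -
    have "(SOME v. v \<in> braid_class m u) \<in> braid_class m u" by (rule someI) (rule braid_class_self)
    then have "braid_eq m u (SOME v. v \<in> braid_class m u)" by (simp add: braid_class_def)
    then show ?thesis using word_eval_braid_eq[OF t rel] by (simp add: h_def car)
  qed
  have tc: "t j \<in> carrier G" for j using t by auto
  show ?thesis
  proof (rule ex1I[of _ h])
    have "h \<in> hom (braid_group m) G"
      by (rule homI) (auto simp: car h braid_mult word_eval_append[OF t] word_eval_closed[OF t])
    then show "h \<in> hom (braid_group m) G \<and> h \<in> extensional (carrier (braid_group m)) \<and> (\<forall>j. h (braid_gen m j) = t j)"
      by (auto simp: h_def[symmetric] braid_gen_def h tc) (simp add: h_def)
  next
    fix g assume "g \<in> hom (braid_group m) G \<and> g \<in> extensional (carrier (braid_group m)) \<and> (\<forall>j. g (braid_gen m j) = t j)"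
    then have g: "g \<in> hom (braid_group m) G" "g \<in> extensional (carrier (braid_group m))" "\<And>j. g (braid_class m [(j, True)]) = t j"
      by (auto simp: braid_gen_def)
    have gm: "g (braid_class m (u @ v)) = g (braid_class m u) \<otimes> g (braid_class m v)" for u v
      using hom_mult[OF g(1), of "braid_class m u" "braid_class m v"] by (simp add: car braid_mult)
    have gc: "g (braid_class m u) \<in> carrier G" for u using hom_in_carrier[OF g(1)] by (simp add: car)
    have g1: "g (braid_class m []) = \<one>" using gm[of "[]" "[]"] gc[of "[]"] by simp
    have gi: "g (braid_class m [(j, False)]) = inv t j" for j
    proof -
      have "braid_class m [(j, False), (j, True)] = braid_class m []"
        using braid_eq.cancel[of m j False] by (simp add: braid_class_eq_iff)
      then have "g (braid_class m [(j, False)]) \<otimes> t j = \<one>"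
        using gm[of "[(j, False)]" "[(j, True)]"] g(3) g1 by simp
      from inv_equality[OF this tc gc] show ?thesis by simp
    qed
    have "g (braid_class m u) = word_eval t u" for u
    proof (induction u)
      case (Cons l u)
      obtain j b where l: "l = (j, b)" by (cases l)
      have "g (braid_class m [(j, b)]) = (if b then t j else inv t j)" by (simp add: g(3) gi)
      then show ?case using gm[of "[l]" u] Cons by (simp add: l)
    qed (simp add: g1)
    then show "g = h"
      by (intro extensionalityI[OF g(2)]) (auto simp: car h, simp add: h_def car)
  qed
qed

end

section \<open>The braid group action\<close>

locale quantum_system = simple_system \<Phi> \<alpha>
  for \<Phi> :: "'v::euclidean_space set" and \<alpha> :: "'i::finite \<Rightarrow> 'v" +
  fixes q :: "'k::field"
  assumes q0: "q \<noteq> 0" and q_power: "\<And>n::nat. n > 0 \<Longrightarrow> q ^ n \<noteq> 1"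
begin

sublocale B: braid_datum ca dd q "coxeter_order \<Phi> \<alpha>"
proof
  show "dd i > 0" for i using dd_cases[of i] by auto
  show "ca i j \<in> {0, -1, -2, -3}" if "i \<noteq> j" for i j using cartan_pairs[OF that] by auto
  show "dd i = 1" if "i \<noteq> j" "ca i j < -1" for i j
  proof -
    have "ca j i = -1" "ca i j = -2 \<or> ca i j = -3" using cartan_pairs[OF that(1)] that(2) by auto
    then show ?thesis using dd_sym[of i j] dd_cases[of i] dd_cases[of j] by auto
  qed
qed (fact q0 q_power cartan_diag dd_sym cartan_pairs no_triangle coxeter)+

lemma q_root_qi: "q_root \<alpha> q i = B.qi i"
  by (simp add: q_root_def B.qi_def dd_def)

lemma qi_short: "i \<noteq> j \<Longrightarrow> ca i j < -1 \<Longrightarrow> B.qi i = q"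
  by (simp add: B.qi_def B.short)

lemma serre_poly: "i \<noteq> j \<Longrightarrow> serre \<alpha> q G i j = q_generic.serre_poly (B.qi i) (B.N i j) (fa_gen (G i)) (fa_gen (G j))"
  using B.int_N[of i j]
  by (simp add: serre_def Let_def q_generic.serre_poly_def[OF B.qi_generic] q_generic.sc_def[OF B.qi_generic] q_root_qi B.N_def)

lemma uq_relators: "uq_relators \<alpha> q = B.uq_rels"
proof -
  have "(\<Union>i. \<Union>j\<in>- {i}. {serre \<alpha> q GE i j, serre \<alpha> q GF i j}) =
      (\<Union>i. \<Union>j\<in>- {i}. {q_generic.serre_poly (B.qi i) (B.N i j) (fa_gen (GE i)) (fa_gen (GE j)),
        q_generic.serre_poly (B.qi i) (B.N i j) (fa_gen (GF i)) (fa_gen (GF j))})"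
    by (intro SUP_cong HOL.refl) (auto simp: serre_poly)
  then show ?thesis
    unfolding uq_relators_def B.uq_rels_def q_root_qi pairing_dd B.ip_def by simp
qed

definition cls :: "('i uq_gen, 'k) free_algebra \<Rightarrow> ('i uq_gen, 'k) free_algebra set" where
  "cls p = B.UJ +>\<^bsub>ring_of_type_algebra\<^esub> p"

sublocale U: algebra_image "Uq \<alpha> q" cls
  using presented_algebra_image(1)[of B.uq_rels] by (simp add: Uq_def uq_relators cls_def[abs_def])

lemma uq_elem_cls: "uq_elem \<alpha> q x = cls (fa_gen x)"
  by (simp add: uq_elem_def presented_gen_def uq_relators genideal_fa_ideal cls_def)

definition bcls :: "('i, 'k) free_algebra \<Rightarrow> ('i uq_gen, 'k) free_algebra set" where
  "bcls p = cls (B.ev p)"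

lemma qsp_B_bcls: "qsp_B \<alpha> q j = bcls (fa_gen j)"
  by (simp add: qsp_B_def uq_elem_cls U.ops bcls_def B.ev_def)

sublocale A: algebra_image "Uqk \<alpha> q" bcls
proof -
  have "range (qsp_B \<alpha> q) = range (\<lambda>j. cls (fa_gen (GF j) - fa_gen (GKinv j) * fa_gen (GE j)))"
    by (simp add: qsp_B_def uq_elem_cls U.ops)
  then show "algebra_image (Uqk \<alpha> q) bcls"
    using generated_image[OF U.algebra_image_axioms, of "\<lambda>j. fa_gen (GF j) - fa_gen (GKinv j) * fa_gen (GE j)"]
    by (simp add: Uqk_def bcls_def[abs_def] B.ev_def)
qed

lemma bcls_zero: "bcls p = \<zero>\<^bsub>Uqk \<alpha> q\<^esub> \<longleftrightarrow> p \<in> B.ker"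
proof -
  have "\<zero>\<^bsub>Uqk \<alpha> q\<^esub> = B.UJ"
    by (simp add: Uqk_def generated_subalgebra_def Uq_def presented_zero uq_relators)
  then show ?thesis by (simp add: bcls_def cls_def presented_zero_iff B.ker_def)
qed

lemma bcls_eqv: "bcls p = bcls r \<longleftrightarrow> B.eqv p r"
  by (simp add: A.cong_diff bcls_zero B.eqv_def)

text \<open>Brings both sides to sums of words with a product of constants in front; no reordering
  of summands is required, as \<open>plist\<close> follows the order of the formulas.\<close>

lemmas expand_simps = tau_minus_expr_def tau_expr_def A.ops bip_simps add_0_right power_0 power_one_right mult_1_right
  mult_1_left fa_const_1 fa_const_uminus distrib_left distrib_right left_diff_distrib right_diff_distrib
  mult_minus_left mult_minus_right diff_conv_add_uminus minus_add_distrib minus_minus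
  mult.assoc[symmetric] fa_const_mult[symmetric] add.assoc list.map B.flip_def prod.case

lemma tau_minus_image: "tau_minus_image \<alpha> q i j = bcls (B.tm i (fa_gen j))"
  and tau_image: "tau_image \<alpha> q i j = bcls (B.tp i (fa_gen j))"
proof -
  interpret qq: q_generic "B.qi i" by (rule B.qi_generic)
  have "tau_minus_image \<alpha> q i j = bcls (B.tm i (fa_gen j)) \<and> tau_image \<alpha> q i j = bcls (B.tp i (fa_gen j))"
  proof (cases "j = i")
    case True
    then show ?thesis
      by (simp add: tau_minus_image_def tau_image_def qsp_B_bcls B.tm_gen B.tp_gen B.phim_def B.phip_def B.flip_def qq.plist_def)
  next
    case False
    consider "ca i j = 0" | "ca i j = -1" | "ca i j = -2" | "ca i j = -3" using B.a_range[of i j] False by auto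
    then show ?thesis
    proof cases
      case 1
      then show ?thesis using False
        by (simp add: tau_minus_image_def tau_image_def qsp_B_bcls B.tm_gen B.tp_gen B.phim_def B.phip_def
            B.flip_def qq.plist_def tau_minus_expr_def tau_expr_def)
    next
      case 2
      have l: "B.phim i j = [(1,1,0), (- B.qi i,0,1)]" using 2 False by (simp add: B.phim_def qq.plist_def)
      show ?thesis unfolding tau_minus_image_def tau_image_def if_not_P[OF False] qsp_B_bcls B.tm_gen B.tp_gen
          B.phip_def l 2 q_root_qi by (simp add: A.ops B.flip_def tau_minus_expr_def tau_expr_def fa_const_uminus mult.assoc)
    next
      case 3
      have q: "B.qi i = q" using qi_short[of i j] False 3 by simp
      have l: "B.phim i j = [(inverse (qint q 2),2,0), (- (inverse (qint q 2) * (q * qint q 2)),1,1),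
          (inverse (qint q 2) * q ^ 2,0,2), (1,0,0)]"
        using 3 False by (simp add: B.phim_def B.plist_def q Let_def)
      have e: "(-2::int) = 0 \<longleftrightarrow> False" "(-2::int) = -1 \<longleftrightarrow> False" "(-2::int) = -2 \<longleftrightarrow> True" by simp_all
      show ?thesis unfolding tau_minus_image_def tau_image_def if_not_P[OF False] qsp_B_bcls B.tm_gen B.tp_gen
          B.phip_def l 3 by (simp only: expand_simps e if_True if_False simp_thms)
    next
      case 4
      have q: "B.qi i = q" using qi_short[of i j] False 4 by simp
      define w where "w = inverse (qint q 3) * inverse (qint q 2)"
      have l: "B.phim i j = [(w,3,0), (- (w * (q * qint q 3)),2,1), (w * (q ^ 2 * qint q 3),1,2), (- (w * q ^ 3),0,3),
          (w * inverse q,1,0), (- (w * (inverse q * q ^ 3)),0,1), (1,1,0), (- q,0,1)]"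
        using 4 False by (simp add: B.phim_def B.plist_def q w_def Let_def)
      have e: "(-3::int) = 0 \<longleftrightarrow> False" "(-3::int) = -1 \<longleftrightarrow> False" "(-3::int) = -2 \<longleftrightarrow> False" "(-3::int) = -3 \<longleftrightarrow> True" by simp_all
      show ?thesis unfolding tau_minus_image_def tau_image_def if_not_P[OF False] qsp_B_bcls B.tm_gen B.tp_gen
          B.phip_def l 4 by (simp only: expand_simps e if_True if_False simp_thms w_def)
    qed
  qed
  then show "tau_minus_image \<alpha> q i j = bcls (B.tm i (fa_gen j))" "tau_image \<alpha> q i j = bcls (B.tp i (fa_gen j))" by auto
qed

abbreviation "Aut \<equiv> algebra_automorphisms (Uqk \<alpha> q)"

definition lm :: "'i \<Rightarrow> ('i uq_gen, 'k) free_algebra set \<Rightarrow> ('i uq_gen, 'k) free_algebra set" where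
  "lm i = A.lift (B.tm i)"
definition lp :: "'i \<Rightarrow> ('i uq_gen, 'k) free_algebra set \<Rightarrow> ('i uq_gen, 'k) free_algebra set" where
  "lp i = A.lift (B.tp i)"

lemma lm: "lm i (bcls p) = bcls (B.tm i p)" and lp: "lp i (bcls p) = bcls (B.tp i p)"
  unfolding lm_def lp_def B.tm_hom B.tp_hom
  by (rule A.lift; unfold bcls_zero; fold B.tm_hom B.tp_hom; erule B.tm_ker B.tp_ker)+

lemma lm_Aut: "lm i \<in> Aut" and lp_Aut: "lp i \<in> Aut"
proof -
  have *: "bcls p = \<zero>\<^bsub>Uqk \<alpha> q\<^esub> \<Longrightarrow> bcls (B.tm i p) = \<zero>\<^bsub>Uqk \<alpha> q\<^esub>"
    "bcls p = \<zero>\<^bsub>Uqk \<alpha> q\<^esub> \<Longrightarrow> bcls (B.tp i p) = \<zero>\<^bsub>Uqk \<alpha> q\<^esub>"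
    "bcls (B.tm i (B.tp i p)) = bcls p" "bcls (B.tp i (B.tm i p)) = bcls p" for p
    by (auto simp: bcls_zero bcls_eqv intro: B.tm_ker B.tp_ker B.tm_tp_eqv B.tp_tm_eqv)
  show "lm i \<in> Aut" unfolding lm_def B.tm_hom
    by (rule A.lift_automorphism[OF *[unfolded B.tm_hom B.tp_hom]])
  show "lp i \<in> Aut" unfolding lp_def B.tp_hom
    by (rule A.lift_automorphism[OF *(2,1,4,3)[unfolded B.tm_hom B.tp_hom]])
qed

lemma Aut_eqI: "\<phi> \<in> Aut \<Longrightarrow> \<psi> \<in> Aut \<Longrightarrow> (\<And>j. \<phi> (qsp_B \<alpha> q j) = \<psi> (qsp_B \<alpha> q j)) \<Longrightarrow> \<phi> = \<psi>"
  unfolding qsp_B_bcls by (rule A.automorphism_eqI)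

lemma lm_gens: "lm i (qsp_B \<alpha> q j) = tau_minus_image \<alpha> q i j" and lp_gens: "lp i (qsp_B \<alpha> q j) = tau_image \<alpha> q i j"
  by (simp_all add: qsp_B_bcls lm lp tau_minus_image tau_image)

lemma unique_tau_minus:
  "\<exists>!\<phi>. \<phi> \<in> carrier (Aut_alg (Uqk \<alpha> q)) \<and> (\<forall>j. \<phi> (qsp_B \<alpha> q j) = tau_minus_image \<alpha> q i j)"
  unfolding A.carrier_Aut by (rule ex1I[of _ "lm i"]) (auto simp: lm_Aut lm_gens intro: Aut_eqI)

lemma tau_minus_lm: "tau_minus \<alpha> q i = lm i"
  unfolding tau_minus_def by (rule the1_equality[OF unique_tau_minus]) (simp add: A.carrier_Aut lm_Aut lm_gens)

sublocale G: group "Aut_alg (Uqk \<alpha> q)"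
  by (rule A.group_Aut)

lemma inv_tau_minus: "inv\<^bsub>Aut_alg (Uqk \<alpha> q)\<^esub> (tau_minus \<alpha> q i) = lp i"
  unfolding tau_minus_lm
proof (rule G.inv_equality)
  have "lp i (lm i (bcls p)) = bcls p" for p by (simp add: lm lp bcls_eqv B.tp_tm_eqv)
  then show "lp i \<otimes>\<^bsub>Aut_alg (Uqk \<alpha> q)\<^esub> lm i = \<one>\<^bsub>Aut_alg (Uqk \<alpha> q)\<^esub>"
    by (auto simp: A.mult_Aut lm_Aut lp_Aut A.one_Aut compose_def A.carrier fun_eq_iff)
qed (simp_all add: A.carrier_Aut lm_Aut lp_Aut)

lemma range_tau_minus: "range (tau_minus \<alpha> q) \<subseteq> carrier (Aut_alg (Uqk \<alpha> q))"
  by (auto simp: A.carrier_Aut tau_minus_lm lm_Aut)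

lemma word_eval_Aut: "G.word_eval (tau_minus \<alpha> q) u \<in> Aut"
  using G.word_eval_closed[OF range_tau_minus, of u] by (simp add: A.carrier_Aut)

lemma word_eval_alternating:
  "G.word_eval (tau_minus \<alpha> q) (alternating n i j) (bcls p) = bcls (B.talt n i j p)"
proof (induction n arbitrary: i j)
  case 0
  then show ?case by (simp add: A.one_Aut)
next
  case (Suc n)
  show ?case by (simp add: A.mult_Aut tau_minus_lm[of i] word_eval_Aut lm_Aut compose_def Suc lm)
qed

lemma tau_minus_braid:
  assumes "i \<noteq> j" and n: "n = coxeter_order \<Phi> \<alpha> i j"
  shows "G.word_eval (tau_minus \<alpha> q) (alternating n i j) = G.word_eval (tau_minus \<alpha> q) (alternating n j i)"
proof -
  show ?thesis
    by (intro Aut_eqI word_eval_Aut) (simp_all add: qsp_B_bcls word_eval_alternating bcls_eqv n B.braid_relation[OF assms(1)])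
qed

end

theorem theorem3p3:
  fixes \<Phi> :: "'v::euclidean_space set" and \<alpha> :: "'i::finite \<Rightarrow> 'v"
    and q :: "'k::field" and i :: 'i
  assumes "irreducible_root_system \<Phi>"
    and "simple_roots \<Phi> \<alpha>"
    and "\<And>\<beta>. short_root \<Phi> \<beta> \<Longrightarrow> \<beta> \<bullet> \<beta> = 2"
    and "q \<noteq> 0"
    and "\<And>n::nat. n > 0 \<Longrightarrow> q ^ n \<noteq> 1"
    and "\<exists>r. r ^ 2 = q"
  shows "(\<exists>!\<phi>. \<phi> \<in> carrier (Aut_alg (Uqk \<alpha> q)) \<and>
             (\<forall>j. \<phi> (qsp_B \<alpha> q j) = tau_minus_image \<alpha> q i j))
       \<and> (\<forall>\<psi>\<in>carrier (Aut_alg (Uqk \<alpha> q)).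
             \<psi> = inv\<^bsub>Aut_alg (Uqk \<alpha> q)\<^esub> (tau_minus \<alpha> q i) \<longleftrightarrow>
             (\<forall>j. \<psi> (qsp_B \<alpha> q j) = tau_image \<alpha> q i j))
       \<and> (\<exists>!h. h \<in> hom (braid_group (coxeter_order \<Phi> \<alpha>)) (Aut_alg (Uqk \<alpha> q)) \<and>
             h \<in> extensional (carrier (braid_group (coxeter_order \<Phi> \<alpha>))) \<and>
             (\<forall>j. h (braid_gen (coxeter_order \<Phi> \<alpha>) j) = tau_minus \<alpha> q j))"
proof -
  interpret quantum_system \<Phi> \<alpha> q
    by unfold_locales (fact assms)+
  show ?thesis
  proof (intro conjI ballI)
    show "\<exists>!\<phi>. \<phi> \<in> carrier (Aut_alg (Uqk \<alpha> q)) \<and> (\<forall>j. \<phi> (qsp_B \<alpha> q j) = tau_minus_image \<alpha> q i j)"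
      by (rule unique_tau_minus)
    show "\<psi> = inv\<^bsub>Aut_alg (Uqk \<alpha> q)\<^esub> (tau_minus \<alpha> q i) \<longleftrightarrow> (\<forall>j. \<psi> (qsp_B \<alpha> q j) = tau_image \<alpha> q i j)"
      if "\<psi> \<in> carrier (Aut_alg (Uqk \<alpha> q))" for \<psi>
      unfolding inv_tau_minus using that Aut_eqI[OF _ lp_Aut[of i], of \<psi>] by (auto simp: A.carrier_Aut lp_gens)
    show "\<exists>!h. h \<in> hom (braid_group (coxeter_order \<Phi> \<alpha>)) (Aut_alg (Uqk \<alpha> q)) \<and>
        h \<in> extensional (carrier (braid_group (coxeter_order \<Phi> \<alpha>))) \<and>
        (\<forall>j. h (braid_gen (coxeter_order \<Phi> \<alpha>) j) = tau_minus \<alpha> q j)"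
      by (rule G.braid_group_hom[OF range_tau_minus tau_minus_braid[OF _ HOL.refl]])
  qed
qed

end
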